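(* Let $\mathbf{X} = (X,\mathcal{X},\mu,T)$ be a fixed ergodic system. Then the generic extension of $T$ does not increase entropy: the set of Rokhlin cocycles $S \in \mathcal{S}$ whose associated skew product $\hat{S}$ satisfies $h(\hat{S}) = h(T)$ is comeager in $\mathcal{S}$.
   Context: Here $(X,\mathcal{X},\mu)$ is a nonatomic standard probability space and $T$ is invertible and measure preserving. Let $I = [0,1]$ with Lebesgue measure $\lambda$. $\mathcal{S}$ is the collection of Rokhlin cocycles, i.e. measurable maps $S : x \mapsto S_x$ from $X$ to the Polish group $\mathrm{Aut}(I,\lambda)$ of invertible measure preserving transformations of $(I,\lambda)$ (modulo $\mu$-a.e. equality). To $S \in \mathcal{S}$ one associates the skew product $\hat{S}(x,u) = (Tx, S_x u)$ on $(X \times I, \mu \times \lambda)$, an extension of $T$. $\mathcal{S}$ carries the Polish topology inherited from $\mathrm{Aut}(X \times I, \mu\times\lambda)$ via $S \mapsto \hat{S}$. ($\mathrm{Aut}$ of a standard probability space carries its usual Polish topology: $T_k \to T$ iff $m(T_kA \triangle TA) \to 0$ for all measurable $A$.) "The generic extension of $T$ has a property" means that the set of $S \in \mathcal{S}$ such that $\hat{S}$ has the property is comeager in $\mathcal{S}$. $h$ denotes Kolmogorov–Sinai entropy. *)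

theory Defs
  imports "HOL-Analysis.Analysis" "HOL-Probability.Probability"
begin

section \<open>Standard probability spaces and their automorphism groups\<close>

definition borel_space :: "'a topology \<Rightarrow> 'a measure" where
  "borel_space X = sigma (topspace X) {U. openin X U}"

definition standard_borel :: "'a measure \<Rightarrow> bool" where
  "standard_borel M \<longleftrightarrow>
     (\<exists>X. second_countable X \<and> completely_metrizable_space X \<and>
          space M = topspace X \<and> sets M = sets (borel_space X))"

definition nonatomic :: "'a measure \<Rightarrow> bool" where
  "nonatomic M \<longleftrightarrow>
     (\<forall>A\<in>sets M. 0 < emeasure M A \<longrightarrow>
        (\<exists>B\<in>sets M. B \<subseteq> A \<and> 0 < emeasure M B \<and> emeasure M B < emeasure M A))"

definition unit_interval :: "real measure" where
  "unit_interval = restrict_space lborel {0..1}"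

definition inv_mp :: "'a measure \<Rightarrow> ('a \<Rightarrow> 'a) set" where
  "inv_mp M =
     {f \<in> measurable M M. bij_betw f (space M) (space M) \<and>
        the_inv_into (space M) f \<in> measurable M M \<and> distr M M f = M}"

definition ergodic :: "'a measure \<Rightarrow> ('a \<Rightarrow> 'a) \<Rightarrow> bool" where
  "ergodic M T \<longleftrightarrow>
     (\<forall>A\<in>sets M. T -` A \<inter> space M = A \<longrightarrow> measure M A = 0 \<or> measure M A = 1)"

definition ae_rel :: "'a measure \<Rightarrow> ('a \<Rightarrow> 'b) set \<Rightarrow> (('a \<Rightarrow> 'b) \<times> ('a \<Rightarrow> 'b)) set" where
  "ae_rel M F = {(f, g). f \<in> F \<and> g \<in> F \<and> (AE x in M. f x = g x)}"

text \<open>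
  Elements of \<open>Aut M\<close> are classes modulo null sets of bimeasurable measure preserving
  bijections. On a nonatomic standard probability space every map that is invertible
  only modulo null sets agrees almost everywhere with such a bijection.
\<close>

definition Aut :: "'a measure \<Rightarrow> ('a \<Rightarrow> 'a) set set" where
  "Aut M = inv_mp M // ae_rel M (inv_mp M)"

text \<open>
  The topology generated by the pseudometrics \<open>(f, g) \<mapsto> \<mu> (f A \<triangle> g A)\<close>, where \<open>A\<close> ranges
  over the measurable sets; the subbasic sets below are their open balls. The value
  \<open>\<mu> (f A \<triangle> g A)\<close> depends only on the classes of \<open>f\<close> and \<open>g\<close>.
\<close>

definition Aut_top :: "'a measure \<Rightarrow> ('a \<Rightarrow> 'a) set topology" where
  "Aut_top M = topology_generated_by
     {{q \<in> Aut M. \<exists>f\<in>q. measure M (sym_diff (f ` A) (g ` A)) < e} | g A e.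
        g \<in> inv_mp M \<and> A \<in> sets M \<and> (0::real) < e}"


section \<open>Rokhlin cocycles and skew products\<close>

definition cocycle_maps :: "'a measure \<Rightarrow> ('a \<Rightarrow> (real \<Rightarrow> real) set) set" where
  "cocycle_maps M = measurable M (borel_space (Aut_top unit_interval))"

definition cocycles :: "'a measure \<Rightarrow> ('a \<Rightarrow> (real \<Rightarrow> real) set) set set" where
  "cocycles M = cocycle_maps M // ae_rel M (cocycle_maps M)"

text \<open>
  For a cocycle class \<open>C\<close>, \<open>skew_product M T C\<close> is the element of \<open>Aut (M \<Otimes>\<^sub>M unit_interval)\<close>
  given by \<open>(x, u) \<mapsto> (T x, S\<^sub>x u)\<close>. Since \<open>S x\<close> is itself a class modulo null sets,
  the formula determines a map on the product only almost everywhere, and the class is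
  collected as the set of all its representatives.
\<close>

definition skew_product ::
  "'a measure \<Rightarrow> ('a \<Rightarrow> 'a) \<Rightarrow> ('a \<Rightarrow> (real \<Rightarrow> real) set) set \<Rightarrow> ('a \<times> real \<Rightarrow> 'a \<times> real) set"
  where
  "skew_product M T C =
     {F \<in> inv_mp (M \<Otimes>\<^sub>M unit_interval).
        \<exists>S\<in>C. AE x in M. \<forall>s\<in>S x. AE u in unit_interval. F (x, u) = (T x, s u)}"

definition cocycle_top ::
  "'a measure \<Rightarrow> ('a \<Rightarrow> 'a) \<Rightarrow> ('a \<Rightarrow> (real \<Rightarrow> real) set) set topology" where
  "cocycle_top M T =
     pullback_topology (cocycles M) (skew_product M T) (Aut_top (M \<Otimes>\<^sub>M unit_interval))"


section \<open>Comeager sets\<close>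

definition nowhere_dense_in :: "'a topology \<Rightarrow> 'a set \<Rightarrow> bool" where
  "nowhere_dense_in X N \<longleftrightarrow> N \<subseteq> topspace X \<and> X interior_of (X closure_of N) = {}"

definition meager_in :: "'a topology \<Rightarrow> 'a set \<Rightarrow> bool" where
  "meager_in X A \<longleftrightarrow> (\<exists>N :: nat \<Rightarrow> 'a set. (\<forall>n. nowhere_dense_in X (N n)) \<and> A = (\<Union>n. N n))"

definition comeager_in :: "'a topology \<Rightarrow> 'a set \<Rightarrow> bool" where
  "comeager_in X A \<longleftrightarrow> A \<subseteq> topspace X \<and> meager_in X (topspace X - A)"


section \<open>Kolmogorov--Sinai entropy\<close>

definition finite_partition :: "'a measure \<Rightarrow> 'a set set \<Rightarrow> bool" where
  "finite_partition M P \<longleftrightarrow> finite P \<and> P \<subseteq> sets M \<and> partition_on (space M) P"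

definition partition_entropy :: "'a measure \<Rightarrow> 'a set set \<Rightarrow> real" where
  "partition_entropy M P = (\<Sum>A\<in>P. - (measure M A * ln (measure M A)))"

text \<open>\<open>dyn_join M T P n\<close> is the join of the partitions \<open>T\<^sup>-\<^sup>i P\<close> over \<open>i < n\<close>.\<close>

primrec dyn_join :: "'a measure \<Rightarrow> ('a \<Rightarrow> 'a) \<Rightarrow> 'a set set \<Rightarrow> nat \<Rightarrow> 'a set set" where
  "dyn_join M T P 0 = {space M}"
| "dyn_join M T P (Suc n) =
     {A \<inter> ((T ^^ n) -` B \<inter> space M) | A B. A \<in> dyn_join M T P n \<and> B \<in> P} - {{}}"

definition entropy_wrt :: "'a measure \<Rightarrow> ('a \<Rightarrow> 'a) \<Rightarrow> 'a set set \<Rightarrow> real" where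
  "entropy_wrt M T P = lim (\<lambda>n. partition_entropy M (dyn_join M T P n) / real n)"

definition KS_entropy :: "'a measure \<Rightarrow> ('a \<Rightarrow> 'a) \<Rightarrow> ereal" where
  "KS_entropy M T = (SUP P\<in>{P. finite_partition M P}. ereal (entropy_wrt M T P))"

text \<open>Entropy is invariant under almost everywhere equality, so any representative will do.\<close>

definition Aut_entropy :: "'a measure \<Rightarrow> ('a \<Rightarrow> 'a) set \<Rightarrow> ereal" where
  "Aut_entropy M p = KS_entropy M (SOME f. f \<in> p)"

end

theory Submission
  imports Defs "HOL-Real_Asymp.Real_Asymp"
begin

text \<open>
  Fix labels \<open>Q\<^sub>m\<close> on \<open>X \<times> [0,1]\<close> that record the first \<open>m\<close> sets of a countable base of \<open>X\<close> and the
  dyadic interval of level \<open>m\<close>. The entropy rate of a skew product along \<open>Q\<^sub>m\<close> is an infimum of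
  continuous functions of the skew product, so the cocycles with rate \<open>< h(T) + 1/j\<close> form an open
  set, and a skew product on which all these inequalities hold has entropy at most \<open>h(T)\<close>, since the
  \<open>Q\<^sub>m\<close> generate. These open sets are dense: every cocycle is a limit of cocycles with finitely many
  dyadic permutations as values (a measurable version of Halmos' weak approximation theorem). Such a
  cocycle permutes the dyadic intervals of some fixed level \<open>L\<close>, so the fibre adds at most
  \<open>ln (2\<^sup>L + 1)\<close> to the entropy of an itinerary of any length, hence nothing to the rate. The
  opposite inequality holds because \<open>T\<close> is a factor.
\<close>

section \<open>Entropy of finite-valued functions\<close>

text \<open>Cocycle values are classes modulo null sets, measurable only in the sense of the weak
  topology, while \<open>Aut\<close> consists of classes of bimeasurable bijections of the whole
  product. So even the existence of the skew product of a cocycle is a theorem: the fibre maps and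
  their inverses need jointly measurable versions, and the resulting pair, inverse only almost
  everywhere, must be repaired on a null set.

  This and the density of dyadic cocycles rest on one device. At level n a fibre map is compared
  with the first dyadic permutation, in a fixed enumeration, whose images of the 2^n cells miss
  those of the fibre map by at most (1/4)^n each. Being first makes the choice measurable in the
  base point, and the total error (1/2)^n is summable. Summability makes the inverses converge
  almost everywhere, which gives the measurable versions; cutting the index off beyond a bound
  exceeded only on a set of measure at most (1/2)^n gives the finitely valued cocycles.

  If h(T) is infinite, the factor inequality alone proves the claim, so the open sets are needed
  only for finite h(T).\<close>

definition eta :: "real \<Rightarrow> real" where
  "eta x = - (x * ln x)"

text \<open>Finite partitions are handled as level sets of finite-valued functions: joins become
  pairs, and the results on simple random variables from the library apply.\<close>

definition label_entropy :: "'a measure \<Rightarrow> ('a \<Rightarrow> 'l) \<Rightarrow> real" where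
  "label_entropy M X = (\<Sum>a\<in>X ` space M. eta (measure M (X -` {a} \<inter> space M)))"

lemma eta_0 [simp]: "eta 0 = 0"
  by (simp add: eta_def)

lemma continuous_on_eta: "continuous_on {0..} eta"
  unfolding continuous_on_def
proof
  fix x :: real assume x: "x \<in> {0..}"
  show "(eta \<longlongrightarrow> eta x) (at x within {0..})"
  proof (cases "x = 0")
    case True
    have "((\<lambda>x::real. - (x * ln x)) \<longlongrightarrow> 0) (at_right 0)"
      by real_asymp
    then show ?thesis
      unfolding True eta_0 by (simp add: eta_def[abs_def] at_within_Ici_at_right)
  next
    case False
    then have "isCont eta x"
      by (auto simp: eta_def[abs_def] intro!: continuous_intros)
    then show ?thesis
      by (auto simp: isCont_def intro: tendsto_within_subset)
  qed
qed

lemma tendsto_eta: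
  assumes "(f \<longlongrightarrow> l) F" and "\<And>x. 0 \<le> f x" and "0 \<le> l"
  shows "((\<lambda>x. eta (f x)) \<longlongrightarrow> eta l) F"
  by (rule continuous_on_tendsto_compose[OF continuous_on_eta assms(1)]) (use assms in auto)

lemma log_exp1: "log (exp 1) x = ln x"
  by (simp add: log_def)

section \<open>Entropy inequalities for finite-valued functions\<close>

context prob_space
begin

text \<open>The values of \<open>W\<close> lying over a fixed v partition the event that
  \<open>f\<close> of \<open>W\<close> equals v. Applied with g the logarithm of a marginal, this
  turns the terms of a conditional mutual information into entropies.\<close>

lemma prob_marginal:
  assumes W: "simple_function M W"
  shows "(\<Sum>t\<in>W ` space M. prob (W -` {t} \<inter> space M) * g (f t)) =
         (\<Sum>v\<in>(\<lambda>w. f (W w)) ` space M. prob ((\<lambda>w. f (W w)) -` {v} \<inter> space M) * g v)"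
    (is "?L = ?R")
proof -
  have fin: "finite (W ` space M)"
    using W by (rule simple_functionD)
  have img: "(\<lambda>w. f (W w)) ` space M = f ` W ` space M"
    by auto
  have "?L = (\<Sum>v\<in>f ` W ` space M. \<Sum>t\<in>{t \<in> W ` space M. f t = v}. prob (W -` {t} \<inter> space M) * g
      (f t))"
    using sum.image_gen[OF fin, of "\<lambda>t. prob (W -` {t} \<inter> space M) * g (f t)" f] .
  also have "\<dots> = (\<Sum>v\<in>f ` W ` space M. prob ((\<lambda>w. f (W w)) -` {v} \<inter> space M) * g v)"
  proof (rule sum.cong[OF refl])
    fix v
    have "prob ((\<lambda>w. f (W w)) -` {v} \<inter> space M) = prob (\<Union>t\<in>{t \<in> W ` space M. f t = v}. W -` {t} \<inter>
        space M)"
      by (rule arg_cong[where f=prob]) auto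
    also have "\<dots> = (\<Sum>t\<in>{t \<in> W ` space M. f t = v}. prob (W -` {t} \<inter> space M))"
      using fin simple_functionD(2)[OF W]
      by (intro finite_measure_finite_Union) (auto simp: disjoint_family_on_def)
    finally show "(\<Sum>t\<in>{t \<in> W ` space M. f t = v}. prob (W -` {t} \<inter> space M) * g (f t)) =
      prob ((\<lambda>w. f (W w)) -` {v} \<inter> space M) * g v"
      by (simp add: sum_distrib_right)
  qed
  finally show ?thesis unfolding img .
qed

text \<open>Base \<open>exp 1\<close> makes the logarithms of the information theory library
  natural, as in \<open>partition_entropy\<close>.\<close>

lemma info_space: "information_space M (exp 1)"
  by unfold_locales simp

lemma label_entropy_eq_entropy:
  assumes X: "simple_function M X"
  shows "label_entropy M X = entropy (exp 1) (count_space (X ` space M)) X"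
proof -
  interpret information_space M "exp 1" by (rule info_space)
  show ?thesis
    using entropy_simple_distributed[OF simple_distributedI[OF X measure_nonneg refl]]
    by (simp add: label_entropy_def eta_def log_def sum_negf)
qed

lemma label_entropy_nonneg: "0 \<le> label_entropy M X"
  unfolding label_entropy_def eta_def
proof (rule sum_nonneg)
  fix a
  have "prob (X -` {a} \<inter> space M) * ln (prob (X -` {a} \<inter> space M)) \<le> 0"
    by (cases "prob (X -` {a} \<inter> space M) = 0")
       (auto intro!: mult_nonneg_nonpos simp: ln_le_zero_iff zero_less_measure_iff)
  then show "0 \<le> - (prob (X -` {a} \<inter> space M) * ln (prob (X -` {a} \<inter> space M)))"
    by simp
qed

lemma label_entropy_compose_le:
  assumes X: "simple_function M X"
  shows "label_entropy M (\<lambda>w. f (X w)) \<le> label_entropy M X"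
proof -
  interpret information_space M "exp 1" by (rule info_space)
  show ?thesis
    using entropy_data_processing[OF X, of f] X simple_function_compose[OF X, of f]
    by (simp add: label_entropy_eq_entropy comp_def)
qed

lemma label_entropy_le_card:
  assumes X: "simple_function M X"
  shows "label_entropy M X \<le> ln (real (card (X ` space M)))"
proof -
  interpret information_space M "exp 1" by (rule info_space)
  show ?thesis
    using entropy_le_card[OF simple_distributedI[OF X measure_nonneg refl]] X
    by (simp add: label_entropy_eq_entropy log_def)
qed

lemma label_entropy_Pair_le:
  assumes X: "simple_function M X" and Y: "simple_function M Y"
  shows "label_entropy M (\<lambda>w. (X w, Y w)) \<le> label_entropy M X + label_entropy M Y"
proof -
  interpret information_space M "exp 1" by (rule info_space)
  show ?thesis
    using entropy_chain_rule[OF X Y] conditional_entropy_less_eq_entropy[OF Y X]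
      X Y simple_function_Pair[OF X Y]
    by (simp add: label_entropy_eq_entropy)
qed

text \<open>This is the nonnegativity of the conditional mutual information I(X;Y|Z) = H(X,Z) +
  H(Y,Z) - H(X,Y,Z) - H(Z).\<close>

lemma label_entropy_submodular:
  assumes X: "simple_function M X" and Y: "simple_function M Y" and Z: "simple_function M Z"
  shows "label_entropy M (\<lambda>w. (X w, Y w, Z w)) + label_entropy M Z \<le>
         label_entropy M (\<lambda>w. (X w, Z w)) + label_entropy M (\<lambda>w. (Y w, Z w))"
proof -
  interpret information_space M "exp 1" by (rule info_space)
  define W where "W w = (X w, Y w, Z w)" for w
  have W: "simple_function M W"
    unfolding W_def by (intro simple_function_Pair X Y Z)

  define pxyz where "pxyz v = prob (W -` {v} \<inter> space M)" for v
  define pxz where "pxz v = prob ((\<lambda>w. (X w, Z w)) -` {v} \<inter> space M)" for v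
  define pyz where "pyz v = prob ((\<lambda>w. (Y w, Z w)) -` {v} \<inter> space M)" for v
  define pz where "pz v = prob (Z -` {v} \<inter> space M)" for v
  have "0 \<le> conditional_mutual_information (exp 1) (count_space (X ` space M))
      (count_space (Y ` space M)) (count_space (Z ` space M)) X Y Z"
    by (rule conditional_mutual_information_nonneg[OF X Y Z])
  also have "\<dots> = (\<Sum>(x, y, z)\<in>W ` space M. pxyz (x,y,z) * ln
      (pxyz (x,y,z) / (pxz (x,z) * (pyz (y,z) / pz z))))"
    unfolding W_def[abs_def]
    using conditional_mutual_information_eq[OF
      simple_distributedI[OF Z measure_nonneg refl]
      simple_distributedI[OF simple_function_Pair[OF Y Z] measure_nonneg refl]
      simple_distributedI[OF simple_function_Pair[OF X Z] measure_nonneg refl]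
      simple_distributedI[OF simple_function_Pair[OF X simple_function_Pair[OF Y Z]] measure_nonneg
          refl]]
    unfolding log_exp1 pxyz_def pxz_def pyz_def pz_def W_def[abs_def] .
  also have "\<dots> = (\<Sum>t\<in>W ` space M. pxyz t * ln (pxyz t) - pxyz t * ln (pxz ((\<lambda>(x,y,z). (x,z)) t))
      - pxyz t * ln (pyz ((\<lambda>(x,y,z). (y,z)) t)) + pxyz t * ln (pz ((\<lambda>(x,y,z). z) t)))"
  proof (rule sum.cong[OF refl])
    fix t :: "'b \<times> 'c \<times> 'd"
    obtain x y z where t: "t = (x, y, z)" by (cases t)
    have 1: "pxyz (x,y,z) \<le> pxz (x,z)" "pxyz (x,y,z) \<le> pyz (y,z)" "pxyz (x,y,z) \<le> pz z"
        "0 \<le> pxyz (x,y,z)"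
      unfolding pxyz_def pxz_def pyz_def pz_def
      by (intro finite_measure_mono simple_functionD(2) simple_function_Pair X Y Z; auto simp:
          W_def)+
         simp
    \<comment> \<open>A vanishing joint probability annihilates the summand whatever the
      denominators are; otherwise all marginals are positive and the logarithm splits.\<close>
    have "pxyz (x,y,z) = 0 \<or> pxyz (x,y,z) > 0 \<and> pxz (x,z) > 0 \<and> pyz (y,z) > 0 \<and> pz z > 0"
      using 1 by linarith
    then show "(case t of (x, y, z) \<Rightarrow> pxyz (x,y,z) * ln
        (pxyz (x,y,z) / (pxz (x,z) * (pyz (y,z) / pz z)))) =
        pxyz t * ln (pxyz t) - pxyz t * ln (pxz ((\<lambda>(x,y,z). (x,z)) t))
      - pxyz t * ln (pyz ((\<lambda>(x,y,z). (y,z)) t)) + pxyz t * ln (pz ((\<lambda>(x,y,z). z) t))"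
      unfolding t by (auto simp: ln_div ln_mult field_simps)
  qed
  also have "\<dots> = - label_entropy M W + label_entropy M (\<lambda>w. (X w, Z w))
      + label_entropy M (\<lambda>w. (Y w, Z w)) - label_entropy M Z"
    using prob_marginal[OF W, of "\<lambda>v. ln (pxz v)" "\<lambda>(x,y,z). (x,z)"]
      prob_marginal[OF W, of "\<lambda>v. ln (pyz v)" "\<lambda>(x,y,z). (y,z)"]
      prob_marginal[OF W, of "\<lambda>v. ln (pz v)" "\<lambda>(x,y,z). z"]
    by (simp add: sum.distrib sum_subtractf label_entropy_def eta_def sum_negf
        pxyz_def pxz_def pyz_def pz_def) (simp add: W_def)
  finally show ?thesis by (simp add: W_def[abs_def])
qed

text \<open>Values that are not attained contribute \<open>eta 0 = 0\<close>. Functions with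
  different ranges can thus be compared term by term over one common finite set.\<close>

lemma label_entropy_alt:
  assumes "finite R" and "X ` space M \<subseteq> R"
  shows "label_entropy M X = (\<Sum>a\<in>R. eta (prob (X -` {a} \<inter> space M)))"
  unfolding label_entropy_def
proof (rule sum.mono_neutral_left[OF assms], rule ballI)
  fix a assume "a \<in> R - X ` space M"
  then have "X -` {a} \<inter> space M = {}" by auto
  then show "eta (prob (X -` {a} \<inter> space M)) = 0" by simp
qed

lemma label_entropy_cong_AE:
  assumes X: "simple_function M X" and Y: "simple_function M Y" and "AE w in M. X w = Y w"
  shows "label_entropy M X = label_entropy M Y"
proof -
  let ?R = "X ` space M \<union> Y ` space M"
  have "prob (X -` {a} \<inter> space M) = prob (Y -` {a} \<inter> space M)" for a
    using assms(3) simple_functionD(2)[OF X, of "{a}"] simple_functionD(2)[OF Y, of "{a}"]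
    by (intro finite_measure_eq_AE) auto
  then show ?thesis
    using simple_functionD(1)[OF X] simple_functionD(1)[OF Y]
      label_entropy_alt[of ?R X] label_entropy_alt[of ?R Y] by simp
qed

lemma tendsto_label_entropy:
  assumes "finite R" and "X ` space M \<subseteq> R" and "\<And>k. Y k ` space M \<subseteq> R"
    and "\<And>a. a \<in> R \<Longrightarrow> ((\<lambda>k. prob (Y k -` {a} \<inter> space M)) \<longlongrightarrow> prob (X -` {a} \<inter> space M)) F"
  shows "((\<lambda>k. label_entropy M (Y k)) \<longlongrightarrow> label_entropy M X) F"
  unfolding label_entropy_alt[OF assms(1,2)] label_entropy_alt[OF assms(1,3)]
  by (intro tendsto_sum tendsto_eta assms(4)) auto

text \<open>Each level probability moves by at most the probability of disagreement, and over a
  fixed finite range the entropy is a continuous function of the level probabilities.\<close>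

lemma tendsto_label_entropy_of_diff:
  assumes X: "simple_function M X" and Y: "\<And>k. simple_function M (Y k)"
    and R: "finite R" "X ` space M \<subseteq> R" "\<And>k. Y k ` space M \<subseteq> R"
    and lim: "((\<lambda>k. prob {w \<in> space M. Y k w \<noteq> X w}) \<longlongrightarrow> 0) F"
  shows "((\<lambda>k. label_entropy M (Y k)) \<longlongrightarrow> label_entropy M X) F"
proof (rule tendsto_label_entropy[OF R])
  fix a assume "a \<in> R"
  have meas: "{w \<in> space M. Y k w \<noteq> X w} \<in> events" for k
  proof -
    have "simple_function M (\<lambda>w. (Y k w, X w))"
      by (intro simple_function_Pair X Y)
    from simple_functionD(2)[OF this, of "{(a, b). a \<noteq> b}"]
    show ?thesis by (rule back_subst[where P="\<lambda>A. A \<in> events"]) auto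
  qed
  have "\<bar>prob (Y k -` {a} \<inter> space M) - prob (X -` {a} \<inter> space M)\<bar> \<le> prob {w \<in> space M. Y k w \<noteq> X w}"
      for k
  proof -
    have 1: "prob A \<le> prob B + prob {w \<in> space M. Y k w \<noteq> X w}"
      if "A \<in> events" "B \<in> events" "A \<subseteq> B \<union> {w \<in> space M. Y k w \<noteq> X w}" for A B
    proof -
      have "prob A \<le> prob (B \<union> {w \<in> space M. Y k w \<noteq> X w})"
        using that meas by (intro finite_measure_mono) auto
      also have "\<dots> \<le> prob B + prob {w \<in> space M. Y k w \<noteq> X w}"
        using that meas by (intro measure_Un_le) auto
      finally show ?thesis .
    qed
    have "prob (Y k -` {a} \<inter> space M) \<le> prob (X -` {a} \<inter> space M) + prob {w \<in> space M. Y k w \<noteq> X w}"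
      by (rule 1[OF simple_functionD(2)[OF Y] simple_functionD(2)[OF X]]) auto
    moreover have "prob (X -` {a} \<inter> space M) \<le> prob (Y k -` {a} \<inter> space M) +
        prob {w \<in> space M. Y k w \<noteq> X w}"
      by (rule 1[OF simple_functionD(2)[OF X] simple_functionD(2)[OF Y]]) auto
    ultimately show ?thesis by linarith
  qed
  then have "((\<lambda>k. prob (Y k -` {a} \<inter> space M) - prob (X -` {a} \<inter> space M)) \<longlongrightarrow> 0) F"
    by (intro Lim_null_comparison[OF _ lim]) auto
  then show "((\<lambda>k. prob (Y k -` {a} \<inter> space M)) \<longlongrightarrow> prob (X -` {a} \<inter> space M)) F"
    by (rule LIM_zero_cancel)
qed

lemma label_entropy_le_of_factor:
  assumes Y: "simple_function M Y" and "\<And>w. w \<in> space M \<Longrightarrow> X w = f (Y w)"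
  shows "label_entropy M X \<le> label_entropy M Y"
proof -
  have "label_entropy M X = label_entropy M (\<lambda>w. f (Y w))"
    unfolding label_entropy_def using assms(2)
    by (intro sum.cong arg_cong[where f=eta] arg_cong[where f=prob]) auto
  then show ?thesis
    using label_entropy_compose_le[OF Y, of f] by simp
qed

end

lemma label_entropy_measure_preserving:
  assumes f: "f \<in> measurable N M" and d: "distr N M f = M" and X: "simple_function M X"
    and S: "f ` space N = space M"
  shows "label_entropy N (\<lambda>w. X (f w)) = label_entropy M X"
proof -
  have "measure N ((\<lambda>w. X (f w)) -` {a} \<inter> space N) = measure M (X -` {a} \<inter> space M)" for a
  proof -
    have "measure M (X -` {a} \<inter> space M) = measure (distr N M f) (X -` {a} \<inter> space M)"
      by (simp add: d)
    also have "\<dots> = measure N (f -` (X -` {a} \<inter> space M) \<inter> space N)"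
      by (rule measure_distr[OF f simple_functionD(2)[OF X]])
    also have "f -` (X -` {a} \<inter> space M) \<inter> space N = (\<lambda>w. X (f w)) -` {a} \<inter> space N"
      using measurable_space[OF f] by auto
    finally show ?thesis ..
  qed
  moreover have "(\<lambda>w. X (f w)) ` space N = X ` space M"
    using S by (auto simp: image_image[symmetric])
  ultimately show ?thesis
    by (simp add: label_entropy_def)
qed

section \<open>Invertible measure preserving maps and entropy rates\<close>

lemma inv_mpD:
  assumes "f \<in> inv_mp M"
  shows "f \<in> measurable M M" "bij_betw f (space M) (space M)"
    "the_inv_into (space M) f \<in> measurable M M" "distr M M f = M"
  using assms by (auto simp: inv_mp_def)

lemma inv_mpI:
  assumes "f \<in> measurable M M" "g \<in> measurable M M" "distr M M f = M"
    and "\<And>x. x \<in> space M \<Longrightarrow> g (f x) = x" "\<And>x. x \<in> space M \<Longrightarrow> f (g x) = x"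
  shows "f \<in> inv_mp M"
proof -
  have bij: "bij_betw f (space M) (space M)"
    using assms measurable_space[OF assms(1)] measurable_space[OF assms(2)]
    by (intro bij_betwI[where g=g]) auto
  have "the_inv_into (space M) f x = g x" if "x \<in> space M" for x
    using bij that assms measurable_space[OF assms(2)]
    by (intro the_inv_into_f_eq) (auto simp: bij_betw_def)
  then have "the_inv_into (space M) f \<in> measurable M M"
    using assms(2) by (simp cong: measurable_cong)
  then show ?thesis
    using assms bij by (simp add: inv_mp_def)
qed

lemma id_inv_mp [simp]: "(\<lambda>x. x) \<in> inv_mp M"
  by (rule inv_mpI[where g="\<lambda>x. x"]) (auto simp: distr_id2)

lemma inv_mp_inverse:
  assumes f: "f \<in> inv_mp M"
  defines "g \<equiv> the_inv_into (space M) f"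
  shows "g \<in> inv_mp M" "\<And>x. x \<in> space M \<Longrightarrow> g (f x) = x" "\<And>x. x \<in> space M \<Longrightarrow> f (g x) = x"
proof -
  note fD = inv_mpD[OF f]
  show gf: "g (f x) = x" if "x \<in> space M" for x
    using fD(2) that by (auto simp: g_def bij_betw_def the_inv_into_f_f)
  show fg: "f (g x) = x" if "x \<in> space M" for x
    using fD(2) that by (auto simp: g_def bij_betw_def f_the_inv_into_f)
  have "distr M M g = distr (distr M M f) M g"
    by (simp add: fD)
  also have "\<dots> = distr M M (g \<circ> f)"
    using fD by (intro distr_distr) (auto simp: g_def)
  also have "\<dots> = distr M M (\<lambda>x. x)"
    using gf by (intro distr_cong) auto
  finally have "distr M M g = M" by (simp add: distr_id2)
  with fg gf fD show "g \<in> inv_mp M"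
    by (intro inv_mpI[where g=f]) (auto simp: g_def)
qed

lemma inv_mp_comp:
  assumes f: "f \<in> inv_mp M" and g: "g \<in> inv_mp M"
  shows "(\<lambda>x. f (g x)) \<in> inv_mp M"
proof -
  note fD = inv_mpD[OF f] inv_mp_inverse[OF f] and gD = inv_mpD[OF g] inv_mp_inverse[OF g]
  note [measurable] = fD(1,3) gD(1,3)
  have "distr M M (f \<circ> g) = distr (distr M M g) M f"
    using fD gD by (intro distr_distr[symmetric]) auto
  then show ?thesis
    using fD gD measurable_space[OF fD(3)] measurable_space[OF gD(1)]
    by (intro inv_mpI[where g="\<lambda>x. the_inv_into (space M) g (the_inv_into (space M) f x)"])
      (auto simp: comp_def)
qed

lemma inv_mp_funpow: "T \<in> inv_mp M \<Longrightarrow> (T ^^ n) \<in> inv_mp M"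
proof (induction n)
  case 0 then show ?case using id_inv_mp by (simp add: id_def)
next
  case (Suc n)
  then show ?case using inv_mp_comp[of T M "T ^^ n"] by (simp add: comp_def)
qed

lemma inv_mp_space: "f \<in> inv_mp M \<Longrightarrow> x \<in> space M \<Longrightarrow> f x \<in> space M"
  using inv_mpD(1) measurable_space by metis

lemma inv_mp_AE:
  assumes f: "f \<in> inv_mp M" and P: "AE x in M. P x"
  shows "AE x in M. P (f x)"
proof -
  have "AE x in distr M M f. P x"
    using P by (simp only: inv_mpD[OF f])
  then show ?thesis
    by (rule AE_distrD[OF inv_mpD(1)[OF f]])
qed

lemma inv_mp_vimage:
  assumes f: "f \<in> inv_mp M" and A: "A \<in> sets M"
  shows "f -` A \<inter> space M \<in> sets M" "measure M (f -` A \<inter> space M) = measure M A"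
proof -
  show "f -` A \<inter> space M \<in> sets M"
    using inv_mpD[OF f] A by measurable
  have "measure M A = measure (distr M M f) A"
    by (simp add: inv_mpD[OF f])
  then show "measure M (f -` A \<inter> space M) = measure M A"
    using measure_distr[OF inv_mpD(1)[OF f] A] by simp
qed

lemma inv_mp_image:
  assumes f: "f \<in> inv_mp M" and A: "A \<in> sets M"
  shows "f ` A \<in> sets M" "measure M (f ` A) = measure M A"
proof -
  let ?g = "the_inv_into (space M) f"
  note g = inv_mp_inverse[OF f]
  have "f ` A = ?g -` A \<inter> space M"
    using sets.sets_into_space[OF A] g inv_mp_space[OF f] by (force simp: image_iff)
  then show "f ` A \<in> sets M" "measure M (f ` A) = measure M A"
    using inv_mp_vimage[OF g(1) A] by auto
qed

lemma inv_mp_image_vimage: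
  assumes f: "f \<in> inv_mp M" and A: "A \<in> sets M"
  shows "f ` (f -` A \<inter> space M) = A" "f -` (f ` A) \<inter> space M = A"
proof -
  have b: "inj_on f (space M)" "f ` space M = space M"
    using inv_mpD(2)[OF f] by (auto simp: bij_betw_def)
  show "f ` (f -` A \<inter> space M) = A"
  proof (intro equalityI subsetI)
    fix x assume "x \<in> A"
    then have "x \<in> f ` space M" using sets.sets_into_space[OF A] b by auto
    then show "x \<in> f ` (f -` A \<inter> space M)" using \<open>x \<in> A\<close> by blast
  qed auto
  show "f -` (f ` A) \<inter> space M = A"
    using sets.sets_into_space[OF A] b by (auto dest: inj_onD)
qed

section \<open>Itineraries and their entropy rates\<close>

definition itin :: "('a \<Rightarrow> 'a) \<Rightarrow> ('a \<Rightarrow> 'l) \<Rightarrow> nat \<Rightarrow> 'a \<Rightarrow> 'l list" where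
  "itin T X n w = map (\<lambda>i. X ((T ^^ i) w)) [0..<n]"

definition label_rate :: "'a measure \<Rightarrow> ('a \<Rightarrow> 'a) \<Rightarrow> ('a \<Rightarrow> 'l) \<Rightarrow> real" where
  "label_rate M T X = lim (\<lambda>n. label_entropy M (itin T X n) / real n)"

lemma itin_0 [simp]: "itin T X 0 w = []"
  by (simp add: itin_def)

lemma itin_Suc: "itin T X (Suc n) w = itin T X n w @ [X ((T ^^ n) w)]"
  by (simp add: itin_def)

lemma itin_add: "itin T X (m + n) w = itin T X m w @ itin T X n ((T ^^ m) w)"
  by (induction n) (simp_all add: itin_Suc, metis add.commute comp_apply funpow_add)

lemma simple_function_inv_mp:
  "f \<in> inv_mp M \<Longrightarrow> simple_function M X \<Longrightarrow> simple_function M (\<lambda>w. X (f w))"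
  by (rule simple_function_comp[OF inv_mpD(1)])

lemma simple_function_itin:
  assumes T: "T \<in> inv_mp M" and X: "simple_function M X"
  shows "simple_function M (itin T X n)"
proof (induction n)
  case (Suc n)
  have "simple_function M (\<lambda>w. (itin T X n w, X ((T ^^ n) w)))"
    by (intro simple_function_Pair Suc simple_function_inv_mp[OF inv_mp_funpow[OF T] X])
  from simple_function_compose[OF this, of "\<lambda>(l, a). l @ [a]"]
  show ?case by (simp add: comp_def itin_Suc[abs_def])
qed simp

lemma label_entropy_inv_mp:
  assumes T: "T \<in> inv_mp M" and X: "simple_function M X"
  shows "label_entropy M (\<lambda>w. X (T w)) = label_entropy M X"
  using inv_mpD[OF T] X by (intro label_entropy_measure_preserving) (auto simp: bij_betw_def)

text \<open>Fekete's lemma. Writing n = q m + r with r < m gives a n <= q a m + C, where C bounds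
  the first m terms; after division by n only a m / m survives. The index 0 is left out of the
  infimum because the quotient there is 0 by the convention on division by zero.\<close>

lemma fekete:
  fixes a :: "nat \<Rightarrow> real"
  assumes sub: "\<And>m n. a (m + n) \<le> a m + a n" and pos: "\<And>n. 0 \<le> a n"
  shows "(\<lambda>n. a n / real n) \<longlonglongrightarrow> (INF n\<in>{1..}. a n / real n)"
proof -
  define L where "L = (INF n\<in>{1..}. a n / real n)"
  have bdd: "bdd_below ((\<lambda>n. a n / real n) ` {1..})"
    using pos by (intro bdd_belowI[of _ 0]) auto
  have lower: "L \<le> a n / real n" if "n \<ge> 1" for n
    unfolding L_def by (rule cINF_lower[OF bdd]) (use that in auto)
  have mult: "a (q * m + r) \<le> real q * a m + a r" for q m r
  proof (induction q)
    case (Suc q)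
    have "a (Suc q * m + r) \<le> a m + a (q * m + r)"
      using sub[of m "q * m + r"] by (simp add: add.assoc)
    with Suc show ?case by (simp add: distrib_right)
  qed simp
  have "(\<lambda>n. a n / real n) \<longlonglongrightarrow> L"
  proof (rule LIMSEQ_I)
    fix e :: real assume e: "0 < e"
    have "L < L + e / 2" using e by simp
    then obtain m where m: "m \<ge> 1" "a m / real m < L + e / 2"
      unfolding L_def by (subst (asm) cINF_less_iff[OF _ bdd]) auto
    define C where "C = (\<Sum>r<m. a r)"
    have C: "a r \<le> C" if "r < m" for r
      unfolding C_def using that pos by (intro member_le_sum) auto
    have C0: "0 \<le> C" using C[of 0] m pos[of 0] by simp
    obtain N :: nat where N: "2 * C / e < real N"
      using reals_Archimedean2 by blast
    show "\<exists>no. \<forall>n\<ge>no. norm (a n / real n - L) < e"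
    proof (intro exI allI impI)
      fix n assume n: "max N 1 \<le> n"
      then have n1: "n \<ge> 1" by simp
      have "a n \<le> real (n div m) * a m + C"
        using mult[of "n div m" m "n mod m"] C[of "n mod m"] m by simp
      also have "real (n div m) \<le> real n / real m"
        by (rule of_nat_div_le_of_nat)
      then have "real (n div m) * a m \<le> real n / real m * a m"
        using pos by (rule mult_right_mono)
      finally have "a n / real n \<le> (real n / real m * a m + C) / real n"
        by (simp add: divide_right_mono)
      also have "\<dots> = a m / real m + C / real n"
        using n1 by (simp add: add_divide_distrib)
      also have "C / real n < e / 2"
      proof -
        have "2 * C / e < real n" using N n by simp
        then show ?thesis using e n1 by (simp add: field_simps)
      qed
      finally have "a n / real n < L + e" using m by simp
      with lower[OF n1] show "norm (a n / real n - L) < e" by simp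
    qed
  qed
  then show ?thesis by (simp add: L_def)
qed

lemma label_entropy_itin_add:
  assumes "prob_space M" and T: "T \<in> inv_mp M" and X: "simple_function M X"
  shows "label_entropy M (itin T X (m + n)) \<le> label_entropy M (itin T X m) + label_entropy M
      (itin T X n)"
proof -
  interpret prob_space M by fact
  note s = simple_function_itin[OF T X]
  note s' = simple_function_inv_mp[OF inv_mp_funpow[OF T] s]
  have "label_entropy M (itin T X (m + n)) \<le> label_entropy M
      (\<lambda>w. (itin T X m w, itin T X n ((T ^^ m) w)))"
    by (rule label_entropy_le_of_factor[where f="\<lambda>(u, v). u @ v"])
       (auto intro!: simple_function_Pair s s' simp: itin_add)
  also have "\<dots> \<le> label_entropy M (itin T X m) + label_entropy M (\<lambda>w. itin T X n ((T ^^ m) w))"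
    by (intro label_entropy_Pair_le s s')
  finally show ?thesis
    by (simp add: label_entropy_inv_mp[OF inv_mp_funpow[OF T] s])
qed

text \<open>The second claim lets a strict upper bound on the rate be certified at a single finite
  time, which is what makes such bounds open conditions.\<close>

lemma label_rate:
  assumes "prob_space M" and T: "T \<in> inv_mp M" and X: "simple_function M X"
  shows "(\<lambda>n. label_entropy M (itin T X n) / real n) \<longlonglongrightarrow> label_rate M T X"
    and "n \<ge> 1 \<Longrightarrow> label_rate M T X \<le> label_entropy M (itin T X n) / real n"
proof -
  interpret prob_space M by fact
  let ?a = "\<lambda>n. label_entropy M (itin T X n)"
  note f = fekete[of ?a, OF label_entropy_itin_add[OF assms] label_entropy_nonneg]
  from f show lim: "(\<lambda>n. ?a n / real n) \<longlonglongrightarrow> label_rate M T X"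
    unfolding label_rate_def by (simp add: limI)
  have eq: "label_rate M T X = (INF n\<in>{1..}. ?a n / real n)"
    using LIMSEQ_unique[OF lim f] .
  show "label_rate M T X \<le> ?a n / real n" if "n \<ge> 1"
    unfolding eq using that
    by (intro cINF_lower bdd_belowI[of _ 0])
        (auto intro!: divide_nonneg_nonneg label_entropy_nonneg)
qed

text \<open>A bounded excess d disappears after division by n, while a linear one survives as c. The
  systems may differ: c will be a conditional entropy, and d the contribution of the fibre when the
  product is compared with the base.\<close>

lemma label_rate_le:
  assumes M: "prob_space M" and T: "T \<in> inv_mp M" and X: "simple_function M X"
    and N: "prob_space N" and S: "S \<in> inv_mp N" and Y: "simple_function N Y"
    and le: "\<And>n. label_entropy M (itin T X n) \<le> label_entropy N (itin S Y n) + real n * c + d"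
  shows "label_rate M T X \<le> label_rate N S Y + c"
proof (rule LIMSEQ_le[OF label_rate(1)[OF M T X]])
  have "(\<lambda>n. label_entropy N (itin S Y n) / real n + c + d / real n) \<longlonglongrightarrow> label_rate N S Y + c + 0"
    by (intro tendsto_add label_rate(1)[OF N S Y] tendsto_const lim_const_over_n)
  then show "(\<lambda>n. label_entropy N (itin S Y n) / real n + c + d / real n) \<longlonglongrightarrow> label_rate N S Y + c"
    by simp
  show "\<exists>n0. \<forall>n\<ge>n0. label_entropy M (itin T X n) / real n \<le> label_entropy N (itin S Y n) / real n +
      c + d / real n"
  proof (intro exI[of _ 1] allI impI)
    fix n :: nat assume "n \<ge> 1"
    then show "label_entropy M (itin T X n) / real n \<le> label_entropy N (itin S Y n) / real n + c +
        d / real n"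
      using divide_right_mono[OF le[of n], of "real n"] by (simp add: add_divide_distrib)
  qed
qed

lemma label_rate_factor_le:
  assumes M: "prob_space M" and T: "T \<in> inv_mp M" and X: "simple_function M X" and Y:
      "simple_function M Y"
    and f: "\<And>w. w \<in> space M \<Longrightarrow> X w = f (Y w)"
  shows "label_rate M T X \<le> label_rate M T Y"
proof -
  interpret prob_space M by fact
  have "label_entropy M (itin T X n) \<le> label_entropy M (itin T Y n)" for n
    by (rule label_entropy_le_of_factor[OF simple_function_itin[OF T Y], where f="map f"])
       (auto simp: itin_def inv_mp_space[OF inv_mp_funpow[OF T]] f)
  then show ?thesis
    using label_rate_le[OF M T X M T Y, of 0 0] by simp
qed

text \<open>The added term is H(X|Y): once the itinerary of \<open>Y\<close> is known, each further
  symbol of \<open>X\<close> costs at most H(X|Y).\<close>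

lemma label_rate_le_conditional:
  assumes M: "prob_space M" and T: "T \<in> inv_mp M" and X: "simple_function M X" and Y:
      "simple_function M Y"
  shows "label_rate M T X \<le> label_rate M T Y + (label_entropy M (\<lambda>w. (X w, Y w)) - label_entropy M
      Y)"
    (is "_ \<le> _ + ?d")
proof -
  interpret prob_space M by fact
  have step: "label_entropy M (\<lambda>w. (itin T X n w, itin T Y n w)) \<le> label_entropy M (itin T Y n) +
      real n * ?d" for n
  proof (induction n)
    case 0
    then show ?case by (simp add: label_entropy_def eta_def prob_space image_constant_conv)
  next
    case (Suc n)
    define A B x y where "A = itin T X n" and "B = itin T Y n"
      and "x = (\<lambda>w. X ((T ^^ n) w))" and "y = (\<lambda>w. Y ((T ^^ n) w))"
    note Tn = inv_mp_funpow[OF T, of n]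
    have s: "simple_function M A" "simple_function M B" "simple_function M x" "simple_function M y"
      unfolding A_def B_def x_def y_def
      by (simp_all add: simple_function_itin[OF T X] simple_function_itin[OF T Y]
            simple_function_inv_mp[OF Tn X] simple_function_inv_mp[OF Tn Y])
    have eq: "label_entropy M (\<lambda>w. (x w, y w)) = label_entropy M (\<lambda>w. (X w, Y w))"
      "label_entropy M y = label_entropy M Y"
      unfolding x_def y_def
      using label_entropy_inv_mp[OF Tn simple_function_Pair[OF X Y]] label_entropy_inv_mp[OF Tn Y]
          by auto
    have "label_entropy M (\<lambda>w. (itin T X (Suc n) w, itin T Y (Suc n) w)) \<le> label_entropy M
        (\<lambda>w. (A w, x w, B w, y w))"
      by (rule label_entropy_le_of_factor[where f="\<lambda>(a, b, c, d). (a @ [b], c @ [d])"])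
         (intro simple_function_Pair s, simp add: itin_Suc A_def B_def x_def y_def)
    \<comment> \<open>In conditional form the three instances read H(A,x|B,y) <= H(A|B,y) +
      H(x|B,y), then H(A|B,y) <= H(A|B), and H(x|B,y) <= H(x|y), which equals H(X|Y) by
      invariance.\<close>
    moreover have "label_entropy M (\<lambda>w. (A w, x w, B w, y w)) + label_entropy M (\<lambda>w. (B w, y w)) \<le>
        label_entropy M (\<lambda>w. (A w, B w, y w)) + label_entropy M (\<lambda>w. (x w, B w, y w))"
      by (intro label_entropy_submodular simple_function_Pair s)
    moreover have "label_entropy M (\<lambda>w. (A w, y w, B w)) + label_entropy M B \<le>
        label_entropy M (\<lambda>w. (A w, B w)) + label_entropy M (\<lambda>w. (y w, B w))"
      by (intro label_entropy_submodular simple_function_Pair s)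
    moreover have "label_entropy M (\<lambda>w. (x w, B w, y w)) + label_entropy M y \<le>
        label_entropy M (\<lambda>w. (x w, y w)) + label_entropy M (\<lambda>w. (B w, y w))"
      by (intro label_entropy_submodular simple_function_Pair s)
    moreover have "label_entropy M (\<lambda>w. (A w, B w, y w)) \<le> label_entropy M (\<lambda>w. (A w, y w, B w))"
      by (rule label_entropy_le_of_factor[where f="\<lambda>(a, b, c). (a, c, b)"])
          (intro simple_function_Pair s, simp)
    moreover have "label_entropy M (\<lambda>w. (y w, B w)) \<le> label_entropy M (itin T Y (Suc n))"
      by (rule label_entropy_le_of_factor[where f="\<lambda>l. (last l, butlast l)"])
         (intro simple_function_itin T Y, simp add: itin_Suc B_def y_def)
    ultimately show ?case
      using Suc eq by (simp add: A_def B_def algebra_simps)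
  qed
  have "label_entropy M (itin T X n) \<le> label_entropy M (itin T Y n) + real n * ?d" for n
  proof -
    have "label_entropy M (itin T X n) \<le> label_entropy M (\<lambda>w. (itin T X n w, itin T Y n w))"
      by (rule label_entropy_le_of_factor[where f=fst])
         (intro simple_function_itin simple_function_Pair T X Y, simp)
    with step[of n] show ?thesis by simp
  qed
  then show ?thesis
    using label_rate_le[OF M T X M T Y, of ?d 0] by simp
qed

section \<open>Kolmogorov--Sinai entropy through refining labels\<close>

definition levels :: "'a measure \<Rightarrow> ('a \<Rightarrow> 'l) \<Rightarrow> 'a set set" where
  "levels M X = (\<lambda>a. X -` {a} \<inter> space M) ` (X ` space M)"

lemma levels_eq_image: "levels M X = (\<lambda>w. {v \<in> space M. X v = X w}) ` space M"
  unfolding levels_def image_image by (intro image_cong refl) auto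

lemma levels_iff: "A \<in> levels M X \<longleftrightarrow> (\<exists>w\<in>space M. A = {v \<in> space M. X v = X w})"
  unfolding levels_eq_image by blast

lemma partition_entropy_levels: "partition_entropy M (levels M X) = label_entropy M X"
proof -
  have "inj_on (\<lambda>a. X -` {a} \<inter> space M) (X ` space M)"
    by (auto simp: inj_on_def)
  then show ?thesis
    unfolding partition_entropy_def levels_def label_entropy_def eta_def
    by (simp add: sum.reindex)
qed

lemma finite_partition_levels:
  assumes "simple_function M X"
  shows "finite_partition M (levels M X)"
  unfolding finite_partition_def
proof (intro conjI)
  show "finite (levels M X)" "levels M X \<subseteq> sets M"
    unfolding levels_def using simple_functionD[OF assms] by auto
  show "partition_on (space M) (levels M X)"
  proof (rule partition_onI)
    show "\<Union> (levels M X) = space M"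
      unfolding set_eq_iff Union_iff Bex_def levels_iff by blast
  qed (auto simp: levels_iff disjnt_def)
qed

text \<open>The label of a point is the cell that contains it, so labels with values in the subsets
  of the space already account for all finite partitions.\<close>

lemma finite_partition_is_levels:
  assumes "finite_partition M P"
  obtains X :: "'a \<Rightarrow> 'a set" where "simple_function M X" "P = levels M X"
proof -
  have P: "finite P" "P \<subseteq> sets M" "\<Union>P = space M" "{} \<notin> P"
    and disj: "\<And>A B w. A \<in> P \<Longrightarrow> B \<in> P \<Longrightarrow> w \<in> A \<Longrightarrow> w \<in> B \<Longrightarrow> A = B"
    using assms unfolding finite_partition_def partition_on_def disjoint_def by blast+
  define X where "X w = \<Union>{A \<in> P. w \<in> A}" for w
  have X: "X w = A" if "w \<in> A" "A \<in> P" for w A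
  proof -
    have "{A \<in> P. w \<in> A} = {A}" using that disj by auto
    then show ?thesis by (simp add: X_def)
  qed
  have img: "X ` space M = P"
  proof
    show "X ` space M \<subseteq> P" using P(3) X by auto
    show "P \<subseteq> X ` space M"
    proof
      fix A assume A: "A \<in> P"
      then obtain w where "w \<in> A" using P(4) by (cases "A = {}") auto
      then show "A \<in> X ` space M" using X[of w A] A P(3) by auto
    qed
  qed
  have lev: "X -` {A} \<inter> space M = A" if "A \<in> P" for A
    using that P(3) X by auto
  have "simple_function M X"
    unfolding simple_function_def using img lev P by auto
  moreover have "P = levels M X"
    unfolding levels_def img using lev by simp
  ultimately show ?thesis by (rule that)
qed

text \<open>Points have the same itinerary exactly when they lie in the same cell of every preimage
  partition. At n = 0 the space must be nonempty: \<open>dyn_join\<close> starts with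
  \<open>{space M}\<close>, whereas an empty space has no level sets.\<close>

lemma dyn_join_levels:
  assumes T: "T \<in> inv_mp M" and "space M \<noteq> {}"
  shows "dyn_join M T (levels M X) n = levels M (itin T X n)"
proof (induction n)
  case 0
  have "levels M (itin T X 0) = {space M}"
    using assms(2) by (auto simp: levels_iff)
  then show ?case unfolding dyn_join.simps by (rule sym)
next
  case (Suc n)
  note Tn = inv_mp_space[OF inv_mp_funpow[OF T]]
  have eq: "{v \<in> space M. itin T X (Suc n) v = itin T X (Suc n) w} =
      {v \<in> space M. itin T X n v = itin T X n w} \<inter> ((T ^^ n) -` {v \<in> space M. X v = X ((T ^^ n) w)}
          \<inter> space M)" for w
    using Tn by (auto simp: itin_Suc)
  show ?case
  proof (rule set_eqI)
    fix C
    have "C \<in> dyn_join M T (levels M X) (Suc n) \<longleftrightarrow>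
      (\<exists>w\<in>space M. \<exists>z\<in>space M. C = {v \<in> space M. itin T X n v = itin T X n w} \<inter>
          ((T ^^ n) -` {v \<in> space M. X v = X z} \<inter> space M)) \<and> C \<noteq> {}"
      (is "_ \<longleftrightarrow> ?ex \<and> C \<noteq> {}")
    proof -
      have "C \<in> dyn_join M T (levels M X) (Suc n) \<longleftrightarrow>
        (\<exists>A\<in>levels M (itin T X n). \<exists>B\<in>levels M X. C = A \<inter> ((T ^^ n) -` B \<inter> space M)) \<and> C \<noteq> {}"
        unfolding dyn_join.simps Suc by blast
      also have "(\<exists>A\<in>levels M (itin T X n). \<exists>B\<in>levels M X. C = A \<inter> ((T ^^ n) -` B \<inter> space M)) \<longleftrightarrow> ?ex"
        unfolding levels_eq_image by simp
      finally show ?thesis .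
    qed
    also have "\<dots> \<longleftrightarrow> (\<exists>w\<in>space M. C = {v \<in> space M. itin T X (Suc n) v = itin T X (Suc n) w})"
    proof (intro iffI)
      assume "?ex \<and> C \<noteq> {}"
      then obtain w z v where C: "C = {v \<in> space M. itin T X n v = itin T X n w} \<inter>
          ((T ^^ n) -` {v \<in> space M. X v = X z} \<inter> space M)"
        and v: "v \<in> C" by blast
      have v': "v \<in> space M" "itin T X n v = itin T X n w" "X ((T ^^ n) v) = X z"
        using v unfolding C by auto
      have "C = {u \<in> space M. itin T X (Suc n) u = itin T X (Suc n) v}"
        unfolding eq C v'(2,3) by simp
      with v'(1) show "\<exists>w\<in>space M. C = {v \<in> space M. itin T X (Suc n) v = itin T X (Suc n) w}"
        by (intro bexI[of _ v])
    next
      assume "\<exists>w\<in>space M. C = {v \<in> space M. itin T X (Suc n) v = itin T X (Suc n) w}"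
      then obtain w where w: "w \<in> space M" "C = {v \<in> space M. itin T X (Suc n) v = itin T X (Suc n)
          w}" by blast
      then have "w \<in> C" by simp
      moreover have ?ex
        unfolding w(2) eq
        by (rule bexI[where x=w], rule bexI[where x="(T ^^ n) w"], rule refl) (use w(1) Tn in auto)
      ultimately show "?ex \<and> C \<noteq> {}" by blast
    qed
    finally show "C \<in> dyn_join M T (levels M X) (Suc n) \<longleftrightarrow> C \<in> levels M (itin T X (Suc n))"
      by (simp add: levels_iff)
  qed
qed

lemma entropy_wrt_levels:
  assumes "prob_space M" and T: "T \<in> inv_mp M"
  shows "entropy_wrt M T (levels M X) = label_rate M T X"
  using prob_space.not_empty[OF assms(1)]
  by (simp add: entropy_wrt_def label_rate_def dyn_join_levels[OF T] partition_entropy_levels)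

lemma label_rate_le_KS_entropy:
  assumes "prob_space M" and T: "T \<in> inv_mp M" and "simple_function M X"
  shows "ereal (label_rate M T X) \<le> KS_entropy M T"
  unfolding KS_entropy_def entropy_wrt_levels[OF assms(1,2), symmetric]
  using finite_partition_levels[OF assms(3)] by (intro SUP_upper) auto

lemma KS_entropy_le:
  fixes M :: "'a measure"
  assumes "prob_space M" and T: "T \<in> inv_mp M"
    and le: "\<And>X :: 'a \<Rightarrow> 'a set. simple_function M X \<Longrightarrow> ereal (label_rate M T X) \<le> c"
  shows "KS_entropy M T \<le> c"
  unfolding KS_entropy_def
proof (rule SUP_least)
  fix P assume "P \<in> {P. finite_partition M P}"
  then obtain X :: "'a \<Rightarrow> 'a set" where "simple_function M X" "P = levels M X"
    using finite_partition_is_levels by auto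
  then show "ereal (entropy_wrt M T P) \<le> c"
    using le[of X] entropy_wrt_levels[OF assms(1,2), of X] by simp
qed

text \<open>The factorisations through some \<open>f\<close> say that the partitions refine one
  another and that every generating set is a union of cells from some stage on. Labels are used
  because the same lemmas then serve the interval and the product.\<close>

locale refining_labels = prob_space M for M :: "'a measure" +
  fixes Q :: "nat \<Rightarrow> 'a \<Rightarrow> 'l" and G :: "'a set set"
  assumes simple_Q: "simple_function M (Q m)"
    and Q_Suc: "\<exists>f. \<forall>w\<in>space M. Q m w = f (Q (Suc m) w)"
    and G: "G \<subseteq> Pow (space M)" "sets M = sigma_sets (space M) G"
    and Q_gen: "A \<in> G \<Longrightarrow> \<exists>m f. \<forall>w\<in>space M. w \<in> A \<longleftrightarrow> f (Q m w)"
begin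

lemma Q_mono: "m \<le> n \<Longrightarrow> \<exists>f. \<forall>w\<in>space M. Q m w = f (Q n w)"
proof (induction n rule: dec_induct)
  case base
  show ?case by (rule exI[of _ "\<lambda>x. x"]) simp
next
  case (step n)
  then obtain f where "\<forall>w\<in>space M. Q m w = f (Q n w)" by blast
  moreover obtain g where "\<forall>w\<in>space M. Q n w = g (Q (Suc n) w)" using Q_Suc by blast
  ultimately show ?case by (intro exI[of _ "\<lambda>x. f (g x)"]) simp
qed

lemma approx_sets_measurable:
  "A \<in> events \<Longrightarrow> {w \<in> space M. (w \<in> A) \<noteq> f (Q m w)} \<in> events"
proof -
  assume A: "A \<in> events"
  have "{w \<in> space M. (w \<in> A) \<noteq> f (Q m w)} = (A - (Q m -` {q. f q} \<inter> space M)) \<union>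
      ((Q m -` {q. f q} \<inter> space M) - A)"
    using sets.sets_into_space[OF A] by auto
  then show ?thesis
    using A simple_functionD(2)[OF simple_Q, of m "{q. f q}"] by auto
qed

text \<open>The sets approximable at all large m form a sigma-algebra: complements negate
  \<open>f\<close>, and a countable union is first cut off at a finite stage within e/2. Asking for
  all large m rather than some m gives the finitely many members a common level.\<close>

lemma approx_set:
  assumes "A \<in> events" and "0 < e"
  shows "\<forall>\<^sub>F m in sequentially. \<exists>f. prob {w \<in> space M. (w \<in> A) \<noteq> f (Q m w)} < e"
proof -
  have "A \<in> sigma_sets (space M) G" using assms(1) G(2) by simp
  then show ?thesis using \<open>0 < e\<close>
  proof (induction A arbitrary: e rule: sigma_sets.induct)
    case (Basic A)
    then obtain m f where f: "\<forall>w\<in>space M. w \<in> A \<longleftrightarrow> f (Q m w)" using Q_gen by blast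
    show ?case
      unfolding eventually_sequentially
    proof (rule exI, intro allI impI)
      fix n assume "m \<le> n"
      then obtain g where "\<forall>w\<in>space M. Q m w = g (Q n w)" using Q_mono by blast
      with f have "{w \<in> space M. (w \<in> A) \<noteq> f (g (Q n w))} = {}" by auto
      then have "prob {w \<in> space M. (w \<in> A) \<noteq> f (g (Q n w))} < e" using Basic
          by (metis measure_empty)
      then show "\<exists>f. prob {w \<in> space M. (w \<in> A) \<noteq> f (Q n w)} < e"
        by (intro exI[of _ "\<lambda>q. f (g q)"])
    qed
  next
    case Empty
    show ?case
      by (intro always_eventually allI exI[of _ "\<lambda>_. False"]) (use Empty in simp)
  next
    case (Compl A)
    show ?case
    proof (rule eventually_mono[OF Compl.IH[OF Compl.prems]], elim exE)
      fix m f assume *: "prob {w \<in> space M. (w \<in> A) \<noteq> f (Q m w)} < e"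
      have "{w \<in> space M. (w \<in> space M - A) \<noteq> (\<not> f (Q m w))} = {w \<in> space M. (w \<in> A) \<noteq> f (Q m w)}"
        by auto
      with * show "\<exists>f. prob {w \<in> space M. (w \<in> space M - A) \<noteq> f (Q m w)} < e"
        by (intro exI[of _ "\<lambda>q. \<not> f q"]) simp
    qed
  next
    case (Union A)
    have A: "A i \<in> events" for i using Union.hyps G(2) by simp
    have "(\<lambda>n. prob (\<Union>i<n. A i)) \<longlonglongrightarrow> prob (\<Union>n. \<Union>i<n. A i)"
      using A by (intro finite_Lim_measure_incseq) (auto simp: incseq_def, force)
    moreover have "(\<Union>n. \<Union>i<n. A i) = (\<Union>i. A i)" by auto
    ultimately have "\<forall>\<^sub>F n in sequentially. prob (\<Union>i. A i) - e / 2 < prob (\<Union>i<n. A i)"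
      using Union.prems by (intro order_tendstoD) auto
    then obtain N where N: "prob (\<Union>i. A i) - e / 2 < prob (\<Union>i<N. A i)"
      by (auto simp: eventually_sequentially)
    have "\<forall>\<^sub>F m in sequentially. \<forall>i\<in>{..<N}. \<exists>f. prob {w \<in> space M. (w \<in> A i) \<noteq> f (Q m w)} <
        e / (2 * real (Suc N))"
      by (intro eventually_ball_finite ballI Union.IH) (use Union.prems in auto)
    then show ?case
    proof eventually_elim
      fix m assume "\<forall>i\<in>{..<N}. \<exists>f. prob {w \<in> space M. (w \<in> A i) \<noteq> f (Q m w)} <
          e / (2 * real (Suc N))"
      from bchoice[OF this] obtain f
        where "\<forall>i\<in>{..<N}. prob {w \<in> space M. (w \<in> A i) \<noteq> f i (Q m w)} < e / (2 * real (Suc N))" ..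
      then have f: "prob {w \<in> space M. (w \<in> A i) \<noteq> f i (Q m w)} < e / (2 * real (Suc N))" if "i < N"
          for i
        using that by blast
      let ?E = "\<lambda>i. {w \<in> space M. (w \<in> A i) \<noteq> f i (Q m w)}"
      let ?f = "\<lambda>q. \<exists>i<N. f i q"
      have E: "?E i \<in> events" for i using A by (rule approx_sets_measurable)
      have "prob {w \<in> space M. (w \<in> (\<Union>i. A i)) \<noteq> ?f (Q m w)} \<le> prob (((\<Union>i. A i) - (\<Union>i<N. A i)) \<union>
          (\<Union>i<N. ?E i))"
        using A E by (intro finite_measure_mono) auto
      also have "\<dots> \<le> prob ((\<Union>i. A i) - (\<Union>i<N. A i)) + prob (\<Union>i<N. ?E i)"
        using A E by (intro measure_Un_le) auto
      also have "prob ((\<Union>i. A i) - (\<Union>i<N. A i)) = prob (\<Union>i. A i) - prob (\<Union>i<N. A i)"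
        using A by (intro finite_measure_Diff) auto
      also have "prob (\<Union>i<N. ?E i) \<le> (\<Sum>i<N. prob (?E i))"
        using E by (intro measure_UNION_le) auto
      also have "\<dots> \<le> (\<Sum>i<N. e / (2 * real (Suc N)))"
        using f by (intro sum_mono less_imp_le) auto
      also have "\<dots> \<le> e / 2"
        using Union.prems by (simp add: field_simps)
      finally show "\<exists>f. prob {w \<in> space M. (w \<in> \<Union> (range A)) \<noteq> f (Q m w)} < e"
        using N by (intro exI[of _ ?f]) simp
    qed
  qed
qed

lemma approx_label:
  assumes X: "simple_function M X" and e: "0 < e"
  shows "\<forall>\<^sub>F m in sequentially. \<exists>f. range f \<subseteq> X ` space M \<and> prob {w \<in> space M. X w \<noteq> f (Q m w)} < e"
proof -
  let ?R = "X ` space M"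
  let ?A = "\<lambda>a. X -` {a} \<inter> space M"
  have fin: "finite ?R" and A: "?A a \<in> events" for a
    using simple_functionD[OF X] by auto
  obtain a0 where a0: "a0 \<in> ?R" using not_empty by auto
  have card: "0 < real (card ?R)" using fin a0 by (auto simp: card_gt_0_iff)
  have "\<forall>\<^sub>F m in sequentially. \<forall>a\<in>?R. \<exists>f. prob {w \<in> space M. (w \<in> ?A a) \<noteq> f (Q m w)} <
      e / real (card ?R)"
    using fin A e card by (intro eventually_ball_finite ballI approx_set) auto
  then show ?thesis
  proof eventually_elim
    fix m assume "\<forall>a\<in>?R. \<exists>f. prob {w \<in> space M. (w \<in> ?A a) \<noteq> f (Q m w)} < e / real (card ?R)"
    from bchoice[OF this] obtain f
      where "\<forall>a\<in>?R. prob {w \<in> space M. (w \<in> ?A a) \<noteq> f a (Q m w)} < e / real (card ?R)" ..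
    then have f: "prob {w \<in> space M. (w \<in> ?A a) \<noteq> f a (Q m w)} < e / real (card ?R)" if "a \<in> ?R"
        for a
      using that by blast
    let ?E = "\<lambda>a. {w \<in> space M. (w \<in> ?A a) \<noteq> f a (Q m w)}"
    \<comment> \<open>Away from the error sets \<open>?E a\<close>, exactly one value a of
      \<open>X\<close> satisfies \<open>f a\<close>, and \<open>g\<close> selects it;
      \<open>a0\<close> only keeps \<open>g\<close> inside the range of \<open>X\<close>.\<close>
    define g where "g q = (if \<exists>a\<in>?R. f a q then SOME a. a \<in> ?R \<and> f a q else a0)" for q
    have E: "?E a \<in> events" for a using A by (rule approx_sets_measurable)
    have g: "g q \<in> ?R" for q
    proof (cases "\<exists>a\<in>?R. f a q")
      case True
      then have "(SOME a. a \<in> ?R \<and> f a q) \<in> ?R \<and> f (SOME a. a \<in> ?R \<and> f a q) q"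
        using someI_ex[of "\<lambda>a. a \<in> ?R \<and> f a q"] by blast
      with True show ?thesis by (simp add: g_def)
    qed (use a0 in \<open>simp add: g_def\<close>)
    have sub: "{w \<in> space M. X w \<noteq> g (Q m w)} \<subseteq> (\<Union>a\<in>?R. ?E a)"
    proof clarify
      fix w assume w: "w \<in> space M" "X w \<noteq> g (Q m w)"
      show "w \<in> (\<Union>a\<in>?R. ?E a)"
      proof (rule ccontr)
        assume n: "w \<notin> (\<Union>a\<in>?R. ?E a)"
        then have iff: "f a (Q m w) \<longleftrightarrow> X w = a" if "a \<in> ?R" for a
          using that w by auto
        then have "\<exists>a\<in>?R. f a (Q m w)" using w by auto
        moreover have "(SOME a. a \<in> ?R \<and> f a (Q m w)) = X w"
          using iff w by (intro some_equality) auto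
        ultimately show False using w by (simp add: g_def)
      qed
    qed
    have "prob {w \<in> space M. X w \<noteq> g (Q m w)} \<le> prob (\<Union>a\<in>?R. ?E a)"
      using sub E fin by (intro finite_measure_mono sets.finite_UN) auto
    also have "\<dots> \<le> (\<Sum>a\<in>?R. prob (?E a))"
      using E fin by (intro measure_UNION_le) auto
    also have "\<dots> < (\<Sum>a\<in>?R. e / real (card ?R))"
      using fin a0 f by (intro sum_strict_mono) auto
    also have "\<dots> = e" using card by simp
    finally show "\<exists>f. range f \<subseteq> ?R \<and> prob {w \<in> space M. X w \<noteq> f (Q m w)} < e"
      using g by (intro exI[of _ g]) auto
  qed
qed

text \<open>\<open>X\<close> is the limit in measure of functions \<open>Y k\<close> of the refining
  labels. The rate of \<open>X\<close> exceeds that of \<open>Y k\<close> by at most H(X, Y k) - H(Y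
  k), and by continuity this tends to H(X, X) - H(X), which is at most 0.\<close>

lemma label_rate_le_of_refining:
  assumes T: "T \<in> inv_mp M" and X: "simple_function M X" and c: "\<And>m. label_rate M T (Q m) \<le> c"
  shows "label_rate M T X \<le> c"
proof -
  have "\<forall>k. \<exists>m f. range f \<subseteq> X ` space M \<and> prob {w \<in> space M. X w \<noteq> f (Q m w)} < 1 / real (Suc k)"
  proof
    fix k :: nat
    have "0 < 1 / real (Suc k)" by simp
    from approx_label[OF X this]
    show "\<exists>m f. range f \<subseteq> X ` space M \<and> prob {w \<in> space M. X w \<noteq> f (Q m w)} < 1 / real (Suc k)"
      unfolding eventually_sequentially by blast
  qed
  from choice[OF this] obtain m
    where "\<forall>k. \<exists>f. range f \<subseteq> X ` space M \<and> prob {w \<in> space M. X w \<noteq> f (Q (m k) w)} <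
        1 / real (Suc k)" ..
  from choice[OF this] obtain f
    where "\<forall>k. range (f k) \<subseteq> X ` space M \<and> prob {w \<in> space M. X w \<noteq> f k (Q (m k) w)} <
        1 / real (Suc k)" ..
  then have f: "range (f k) \<subseteq> X ` space M"
    and err: "prob {w \<in> space M. X w \<noteq> f k (Q (m k) w)} < 1 / real (Suc k)" for k
    by blast+
  define Y where "Y k w = f k (Q (m k) w)" for k w
  have Y: "simple_function M (Y k)" for k
    unfolding Y_def[abs_def] using simple_function_compose[OF simple_Q, of "f k" "m k"] by
        (simp add: comp_def)
  have YR: "Y k w \<in> X ` space M" for k w
    using f[of k] by (auto simp: Y_def)
  have lim0: "(\<lambda>k. prob {w \<in> space M. Y k w \<noteq> X w}) \<longlonglongrightarrow> 0"
  proof (rule Lim_null_comparison)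
    show "\<forall>\<^sub>F k in sequentially. norm (prob {w \<in> space M. Y k w \<noteq> X w}) \<le> 1 / real (Suc k)"
      using err by (intro always_eventually allI) (simp add: Y_def eq_commute less_imp_le)
    show "(\<lambda>k. 1 / real (Suc k)) \<longlonglongrightarrow> 0"
      using LIMSEQ_inverse_real_of_nat by (simp add: inverse_eq_divide)
  qed
  have fin: "finite (X ` space M)" using X by (rule simple_functionD)
  have 1: "(\<lambda>k. label_entropy M (Y k)) \<longlonglongrightarrow> label_entropy M X"
    using YR by (intro tendsto_label_entropy_of_diff[OF X Y fin _ _ lim0]) auto
  have 2: "(\<lambda>k. label_entropy M (\<lambda>w. (X w, Y k w))) \<longlonglongrightarrow> label_entropy M (\<lambda>w. (X w, X w))"
    using YR lim0 fin
    by (intro tendsto_label_entropy_of_diff[where R="X ` space M \<times> X ` space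
        M"] simple_function_Pair X Y) auto
  have "label_rate M T X \<le> c + (label_entropy M (\<lambda>w. (X w, Y k w)) - label_entropy M (Y k))" for k
  proof -
    have "label_rate M T (Y k) \<le> label_rate M T (Q (m k))"
      by (rule label_rate_factor_le[OF prob_space_axioms T Y simple_Q, where f="f k"])
          (simp add: Y_def)
    then show ?thesis
      using label_rate_le_conditional[OF prob_space_axioms T X Y, of k] c[of "m k"] by simp
  qed
  then have "label_rate M T X \<le> c + (label_entropy M (\<lambda>w. (X w, X w)) - label_entropy M X)"
    by (intro LIMSEQ_le_const[OF tendsto_add[OF tendsto_const tendsto_diff[OF 2 1]]]) auto
  moreover have "label_entropy M (\<lambda>w. (X w, X w)) \<le> label_entropy M X"
    by (rule label_entropy_compose_le[OF X])
  ultimately show ?thesis by simp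
qed

lemma KS_entropy_le_of_refining:
  assumes T: "T \<in> inv_mp M" and c: "\<And>m. label_rate M T (Q m) \<le> c"
  shows "KS_entropy M T \<le> ereal c"
  using label_rate_le_of_refining[OF T _ c] by (intro KS_entropy_le[OF prob_space_axioms T]) auto

end

section \<open>Dyadic intervals and dyadic permutations\<close>

lemma space_unit_interval [simp]: "space unit_interval = {0..1}"
  by (simp add: unit_interval_def space_restrict_space)

lemma sets_unit_interval_iff: "A \<in> sets unit_interval \<longleftrightarrow> A \<in> sets borel \<and> A \<subseteq> {0..1}"
  unfolding unit_interval_def by (subst sets_restrict_space_iff) auto

lemma emeasure_unit_interval:
  "A \<in> sets unit_interval \<Longrightarrow> emeasure unit_interval A = emeasure lborel A"
  unfolding unit_interval_def
  by (subst emeasure_restrict_space) (auto simp: sets_unit_interval_iff[unfolded unit_interval_def])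

lemma measure_unit_interval:
  "A \<in> sets unit_interval \<Longrightarrow> measure unit_interval A = measure lborel A"
  by (simp add: measure_def emeasure_unit_interval)

interpretation unit_interval: prob_space unit_interval
proof
  have "{0..1::real} \<in> sets unit_interval" by (auto simp: sets_unit_interval_iff)
  then show "emeasure unit_interval (space unit_interval) = 1"
    by (simp add: emeasure_unit_interval)
qed

lemma borel_measurable_unit_interval:
  "f \<in> borel_measurable borel \<Longrightarrow> f \<in> borel_measurable unit_interval"
  unfolding unit_interval_def by (intro measurable_restrict_space1) simp

lemma measurable_unit_intervalI:
  assumes "f \<in> borel_measurable N" "\<And>x. x \<in> space N \<Longrightarrow> f x \<in> {0..1}"
  shows "f \<in> measurable N unit_interval"
  unfolding unit_interval_def using assms by (intro measurable_restrict_space2) auto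

text \<open>The endpoint 1 receives the index \<open>2 ^ n\<close>, so there are 2^n + 1 indices on
  the closed interval, and the last cell is the null set consisting of 1 alone.\<close>

definition dyadic :: "nat \<Rightarrow> real \<Rightarrow> nat" where
  "dyadic n u = nat \<lfloor>2 ^ n * u\<rfloor>"

definition cell :: "nat \<Rightarrow> nat \<Rightarrow> real set" where
  "cell n j = {u \<in> {0..1}. dyadic n u = j}"

lemma dyadic_eq_iff: "0 \<le> u \<Longrightarrow> dyadic n u = j \<longleftrightarrow> real j \<le> 2 ^ n * u \<and> 2 ^ n * u < real j + 1"
  unfolding dyadic_def by (auto simp: nat_eq_iff floor_eq_iff)

lemma dyadic_bounds: "0 \<le> u \<Longrightarrow> real (dyadic n u) \<le> 2 ^ n * u \<and> 2 ^ n * u < real (dyadic n u) + 1"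
  using dyadic_eq_iff by blast

lemma dyadic_le: "u \<in> {0..1} \<Longrightarrow> dyadic n u \<le> 2 ^ n"
proof -
  assume u: "u \<in> {0..1}"
  then have "real (dyadic n u) \<le> 2 ^ n * u" using dyadic_bounds by auto
  also have "\<dots> \<le> 2 ^ n * 1" using u by (intro mult_left_mono) auto
  finally show ?thesis by (metis mult.right_neutral of_nat_le_iff of_nat_numeral of_nat_power)
qed

lemma dyadic_lt: "0 \<le> u \<Longrightarrow> u < 1 \<Longrightarrow> dyadic n u < 2 ^ n"
proof -
  assume u: "0 \<le> u" "u < 1"
  then have "real (dyadic n u) \<le> 2 ^ n * u" using dyadic_bounds by auto
  also have "\<dots> < 2 ^ n * 1" using u by (intro mult_strict_left_mono) auto
  finally show ?thesis by (metis mult.right_neutral of_nat_less_iff of_nat_numeral of_nat_power)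
qed

lemma dyadic_div:
  assumes u: "0 \<le> u" and nm: "n \<le> m"
  shows "dyadic n u = dyadic m u div 2 ^ (m - n)"
proof -
  let ?c = "2 ^ (m - n) :: nat" and ?k = "dyadic m u"
  have cm: "(2::real) ^ m = 2 ^ n * real ?c" using nm by (simp add: power_add[symmetric])
  have b: "real ?k \<le> 2 ^ n * u * real ?c" "2 ^ n * u * real ?c < real ?k + 1"
    using dyadic_bounds[OF u, of m] unfolding cm by (simp_all add: mult_ac)
  have c0: "0 < real ?c" by simp
  have "?k = ?c * (?k div ?c) + ?k mod ?c" by simp
  have "real (?k div ?c) * real ?c \<le> real ?k"
    by (metis div_times_less_eq_dividend of_nat_le_iff of_nat_mult)
  then have 1: "real (?k div ?c) \<le> 2 ^ n * u"
    using b(1) c0 by (meson mult_le_cancel_right_pos order_trans)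
  have "?k < ?c * (?k div ?c) + ?c"
    by (metis \<open>?k = ?c * (?k div ?c) + ?k mod ?c\<close> mod_less_divisor nat_add_left_cancel_less pos2
        zero_less_power)
  then have "?k + 1 \<le> (?k div ?c + 1) * ?c" by (simp add: algebra_simps)
  then have "real (?k + 1) \<le> real ((?k div ?c + 1) * ?c)"
    by (simp only: of_nat_le_iff)
  then have "real ?k + 1 \<le> (real (?k div ?c) + 1) * real ?c"
    by (simp only: of_nat_add of_nat_mult of_nat_1)
  then have "2 ^ n * u * real ?c < (real (?k div ?c) + 1) * real ?c" using b(2) by linarith
  then have 2: "2 ^ n * u < real (?k div ?c) + 1" using c0 by
      (simp only: mult_less_cancel_right_pos)
  show ?thesis using dyadic_eq_iff[OF u] 1 2 by blast
qed

lemma cell_sets [simp]: "cell n j \<in> sets unit_interval"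
proof -
  have "cell n j = {u \<in> {0..1}. real j \<le> 2 ^ n * u \<and> 2 ^ n * u < real j + 1}"
    unfolding cell_def by (intro Collect_cong conj_cong refl dyadic_eq_iff) auto
  also have "\<dots> \<in> sets borel" by measurable
  finally show ?thesis by (auto simp: sets_unit_interval_iff cell_def)
qed

lemma simple_function_dyadic: "simple_function unit_interval (dyadic n)"
  unfolding simple_function_def
proof (intro conjI ballI)
  have "dyadic n ` space unit_interval \<subseteq> {..2 ^ n}" using dyadic_le by auto
  then show "finite (dyadic n ` space unit_interval)" by (rule finite_subset) simp
  fix j
  have "dyadic n -` {j} \<inter> space unit_interval = cell n j" by (auto simp: cell_def)
  then show "dyadic n -` {j} \<inter> space unit_interval \<in> sets unit_interval" by simp
qed

lemma cell_eq_interval: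
  assumes "j < 2 ^ n"
  shows "cell n j = {real j / 2 ^ n ..< (real j + 1) / 2 ^ n}"
proof -
  have "real j + 1 \<le> 2 ^ n" using assms
    by (metis Suc_eq_plus1 Suc_leI of_nat_1 of_nat_add of_nat_le_iff of_nat_numeral of_nat_power)
  then have "(real j + 1) / 2 ^ n \<le> 1" by simp
  moreover have "0 \<le> real j / 2 ^ n" by simp
  ultimately have "u \<in> {0..1}" if "u \<in> {real j / 2 ^ n ..< (real j + 1) / 2 ^ n}" for u
    using that by (simp only: atLeastLessThan_iff atLeastAtMost_iff) linarith
  moreover have "dyadic n u = j \<longleftrightarrow> u \<in> {real j / 2 ^ n ..< (real j + 1) / 2 ^ n}" if "0 \<le> u" for u
    unfolding dyadic_eq_iff[OF that] by (simp add: field_simps)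
  ultimately show ?thesis unfolding cell_def by (auto simp del: atLeastLessThan_iff)
qed

lemma measure_cell: "j < 2 ^ n \<Longrightarrow> measure unit_interval (cell n j) = 1 / 2 ^ n"
  using cell_sets[of n j]
  by (simp add: measure_unit_interval cell_eq_interval divide_right_mono flip: diff_divide_distrib)

text \<open>It suffices that the inclusion into the reals is measurable for the generated
  sigma-algebra, and the part of the interval below a is the countable union of the cells whose
  right endpoint is at most a.\<close>

lemma sets_unit_interval_cell: "sets unit_interval = sigma_sets {0..1} {cell n j | n j. True}"
proof
  let ?G = "{cell n j | n j. True}"
  have G: "?G \<subseteq> Pow {0..1}" by (auto simp: cell_def)
  show "sigma_sets {0..1} ?G \<subseteq> sets unit_interval"
  proof -
    have "?G \<subseteq> sets unit_interval" using cell_sets by blast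
    from sets.sigma_sets_subset[OF this] show ?thesis by (simp only: space_unit_interval)
  qed
  have "(\<lambda>u. u) \<in> borel_measurable (sigma {0..1} ?G)"
  proof (rule borel_measurableI_less)
    fix a :: real
    have "{u \<in> {0..1}. u < a} = (\<Union>n. \<Union>j\<in>{j. (real j + 1) / 2 ^ n \<le> a}. cell n j)"
    proof (intro set_eqI iffI)
      fix u assume "u \<in> (\<Union>n. \<Union>j\<in>{j. (real j + 1) / 2 ^ n \<le> a}. cell n j)"
      then obtain n where u: "u \<in> {0..1}" "(real (dyadic n u) + 1) / 2 ^ n \<le> a" by
          (auto simp: cell_def)
      have "u < (real (dyadic n u) + 1) / 2 ^ n" using dyadic_bounds[of u n] u by
          (simp add: field_simps)
      with u show "u \<in> {u \<in> {0..1}. u < a}" by auto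
    next
      fix u assume u: "u \<in> {u \<in> {0..1}. u < a}"
      then have "0 < a - u" by simp
      then obtain n where n: "(1/2) ^ n < a - u"
        using real_arch_pow_inv[of "a - u" "1/2"] by auto
      have "real (dyadic n u) \<le> 2 ^ n * u" using dyadic_bounds[of u n] u by auto
      then have "(real (dyadic n u) + 1) / 2 ^ n \<le> u + (1/2) ^ n" by (simp add: field_simps)
      with n have "(real (dyadic n u) + 1) / 2 ^ n \<le> a" by linarith
      with u show "u \<in> (\<Union>n. \<Union>j\<in>{j. (real j + 1) / 2 ^ n \<le> a}. cell n j)" by (auto simp: cell_def)
    qed
    also have "\<dots> \<in> sets (sigma {0..1} ?G)"
    proof (intro sets.countable_UN subsetI, elim imageE, simp only:)
      fix n
      have "cell n j \<in> sets (sigma {0..1} ?G)" for j using G by auto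
      then show "(\<Union>j\<in>{j. (real j + 1) / 2 ^ n \<le> a}. cell n j) \<in> sets (sigma {0..1} ?G)"
        by (intro sets.countable_UN') auto
    qed
    finally show "{w \<in> space (sigma {0..1} ?G). w < a} \<in> sets (sigma {0..1} ?G)"
      using G by simp
  qed
  then have "A \<inter> {0..1} \<in> sigma_sets {0..1} ?G" if "A \<in> sets borel" for A
    using measurable_sets[OF \<open>(\<lambda>u. u) \<in> borel_measurable (sigma {0..1} ?G)\<close> that] G
    by (simp only: vimage_ident space_measure_of sets_measure_of)
  note * = this
  show "sets unit_interval \<subseteq> sigma_sets {0..1} ?G"
  proof
    fix A assume "A \<in> sets unit_interval"
    then have "A \<in> sets borel" "A \<inter> {0..1} = A" by (auto simp: sets_unit_interval_iff)
    with *[of A] show "A \<in> sigma_sets {0..1} ?G" by (simp only:)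
  qed
qed

interpretation dyadic: refining_labels unit_interval dyadic "{cell n j | n j. True}"
proof
  show "simple_function unit_interval (dyadic m)" for m by (rule simple_function_dyadic)
  show "\<exists>f. \<forall>w\<in>space unit_interval. dyadic m w = f (dyadic (Suc m) w)" for m
    by (intro exI[of _ "\<lambda>k. k div 2 ^ (Suc m - m)"]) (simp add: dyadic_div[of _ m "Suc m"])
  show "{cell n j |n j. True} \<subseteq> Pow (space unit_interval)" by (auto simp: cell_def)
  show "sets unit_interval = sigma_sets (space unit_interval) {cell n j |n j. True}"
    by (simp add: sets_unit_interval_cell)
  show "\<exists>m f. \<forall>w\<in>space unit_interval. (w \<in> A) = f (dyadic m w)" if "A \<in> {cell n j |n j. True}" for A
  proof -
    from that obtain n j where "A = cell n j" by auto
    then show ?thesis by (intro exI[of _ n] exI[of _ "\<lambda>k. k = j"]) (auto simp: cell_def)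
  qed
qed

text \<open>Cell k of level m is translated rigidly onto cell \<sigma> k. A permutation of the
  indices below 2^m fixes the index 2^m, so the endpoint 1 stays in place.\<close>

definition dperm :: "nat \<Rightarrow> (nat \<Rightarrow> nat) \<Rightarrow> real \<Rightarrow> real" where
  "dperm m \<sigma> u = u + (real (\<sigma> (dyadic m u)) - real (dyadic m u)) / 2 ^ m"

lemma dperm:
  assumes \<sigma>: "\<sigma> permutes {..<2 ^ m}" and u: "u \<in> {0..1}"
  shows "dperm m \<sigma> u \<in> {0..1}" "dyadic m (dperm m \<sigma> u) = \<sigma> (dyadic m u)"
proof -
  let ?k = "dyadic m u"
  have eq: "2 ^ m * dperm m \<sigma> u = 2 ^ m * u + real (\<sigma> ?k) - real ?k"
    by (simp add: dperm_def field_simps)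
  have b: "real (\<sigma> ?k) \<le> 2 ^ m * dperm m \<sigma> u" "2 ^ m * dperm m \<sigma> u < real (\<sigma> ?k) + 1"
    unfolding eq using dyadic_bounds[of u m] u by auto
  have pos: "0 \<le> dperm m \<sigma> u"
  proof -
    have "2 ^ m * 0 \<le> 2 ^ m * dperm m \<sigma> u" using b(1) of_nat_0_le_iff[of "\<sigma> ?k"] by linarith
    then show ?thesis by (simp only: mult_le_cancel_left_pos zero_less_power zero_less_numeral)
  qed
  have "dperm m \<sigma> u \<le> 1"
  proof (cases "?k < 2 ^ m")
    case True
    then have "\<sigma> ?k < 2 ^ m" using permutes_in_image[OF \<sigma>, of ?k] by simp
    then have "real (\<sigma> ?k + 1) \<le> real (2 ^ m)" by (simp only: of_nat_le_iff)
    then have "real (\<sigma> ?k) + 1 \<le> 2 ^ m" by simp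
    then have "2 ^ m * dperm m \<sigma> u \<le> 2 ^ m * 1" using b(2) by linarith
    then show ?thesis by (simp only: mult_le_cancel_left_pos zero_less_power zero_less_numeral)
  next
    case False
    then have "\<sigma> ?k = ?k" using permutes_not_in[OF \<sigma>, of ?k] by simp
    then show ?thesis using u by (simp add: dperm_def)
  qed
  with pos show "dperm m \<sigma> u \<in> {0..1}" by simp
  show "dyadic m (dperm m \<sigma> u) = \<sigma> ?k" using dyadic_eq_iff[OF pos] b by blast
qed

lemma dperm_inv:
  assumes \<sigma>: "\<sigma> permutes {..<2 ^ m}" and u: "u \<in> {0..1}"
  shows "dperm m (inv \<sigma>) (dperm m \<sigma> u) = u" "dperm m \<sigma> (dperm m (inv \<sigma>) u) = u"
  using dperm(2)[OF \<sigma> u] dperm(2)[OF permutes_inv[OF \<sigma>] u] permutes_inverses[OF \<sigma>]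
  by (simp_all add: dperm_def[of m _ "dperm m _ _"]) (simp_all add: dperm_def diff_divide_distrib)

lemma dperm_measurable:
  assumes \<sigma>: "\<sigma> permutes {..<2 ^ m}"
  shows "dperm m \<sigma> \<in> measurable unit_interval unit_interval"
proof (rule measurable_unit_intervalI)
  have "dyadic m \<in> measurable unit_interval (count_space UNIV)"
    by (rule measurable_simple_function[OF simple_function_dyadic])
  then have [measurable]: "(\<lambda>u. real (\<sigma> (dyadic m u)) - real (dyadic m u)) \<in> borel_measurable
      unit_interval"
    by (rule measurable_compose[where g="\<lambda>k. real (\<sigma> k) - real k"]) simp
  have [measurable]: "(\<lambda>u. u) \<in> borel_measurable unit_interval"
    by (rule borel_measurable_unit_interval) simp
  show "dperm m \<sigma> \<in> borel_measurable unit_interval"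
    unfolding dperm_def[abs_def] by measurable
qed (use dperm[OF \<sigma>] in auto)

lemma disjoint_family_cell: "disjoint_family_on (\<lambda>k. A \<inter> cell m k) V"
  by (auto simp: disjoint_family_on_def cell_def)

lemma emeasure_cell_split:
  assumes A: "A \<in> sets unit_interval"
  shows "emeasure unit_interval A = (\<Sum>k\<le>2 ^ m. emeasure unit_interval (A \<inter> cell m k))"
proof -
  have "A = (\<Union>k\<in>{..2 ^ m}. A \<inter> cell m k)"
    using A dyadic_le by (auto simp: sets_unit_interval_iff cell_def)
  also have "emeasure unit_interval \<dots> = (\<Sum>k\<le>2 ^ m. emeasure unit_interval (A \<inter> cell m k))"
    using A by (intro sum_emeasure[symmetric]) (auto intro: disjoint_family_cell)
  finally show ?thesis .
qed

text \<open>On each cell the map is a translation, which preserves Lebesgue measure; summing over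
  the cells, \<sigma> only permutes the summands.\<close>

lemma distr_dperm:
  assumes \<sigma>: "\<sigma> permutes {..<2 ^ m}"
  shows "distr unit_interval unit_interval (dperm m \<sigma>) = unit_interval"
proof (rule measure_eqI)
  fix A assume "A \<in> sets (distr unit_interval unit_interval (dperm m \<sigma>))"
  then have A: "A \<in> sets unit_interval" by simp
  let ?B = "dperm m \<sigma> -` A \<inter> {0..1}"
  have B: "?B \<in> sets unit_interval"
    using measurable_sets[OF dperm_measurable[OF \<sigma>] A] by simp
  have piece: "emeasure unit_interval (?B \<inter> cell m k) = emeasure unit_interval (A \<inter> cell m (\<sigma> k))"
      for k
  proof -
    let ?c = "(real (\<sigma> k) - real k) / 2 ^ m"
    have "?B \<inter> cell m k = (+) ?c -` (A \<inter> cell m (\<sigma> k))"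
    proof (intro set_eqI iffI)
      fix u assume "u \<in> ?B \<inter> cell m k"
      then have u: "u \<in> {0..1}" "dyadic m u = k" "dperm m \<sigma> u \<in> A" by (auto simp: cell_def)
      moreover have "?c + u = dperm m \<sigma> u" using u by (simp add: dperm_def)
      ultimately show "u \<in> (+) ?c -` (A \<inter> cell m (\<sigma> k))"
        using dperm[OF \<sigma>, of u] by (simp add: cell_def)
    next
      fix u assume "u \<in> (+) ?c -` (A \<inter> cell m (\<sigma> k))"
      then have u: "?c + u \<in> A" "?c + u \<in> {0..1}" "dyadic m (?c + u) = \<sigma> k" by (auto simp: cell_def)
      have k: "inv \<sigma> (\<sigma> k) = k" using permutes_inverses[OF \<sigma>] by simp
      have "dperm m (inv \<sigma>) (?c + u) = u"
        unfolding dperm_def u(3) k by (simp add: field_simps)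
      then have "u \<in> {0..1}" "dyadic m u = k" "dperm m \<sigma> u = ?c + u"
        using dperm[OF permutes_inv[OF \<sigma>] u(2)] dperm_inv[OF \<sigma> u(2)] u(3) k by auto
      with u show "u \<in> ?B \<inter> cell m k" by (simp add: cell_def)
    qed
    moreover have "emeasure lborel ((+) ?c -` (A \<inter> cell m (\<sigma> k))) = emeasure lborel
        (A \<inter> cell m (\<sigma> k))"
    proof -
      have C: "A \<inter> cell m (\<sigma> k) \<in> sets borel"
        using A cell_sets[of m "\<sigma> k"] by (auto simp: sets_unit_interval_iff)
      have "emeasure lborel (A \<inter> cell m (\<sigma> k)) = emeasure (distr lborel borel ((+) ?c))
          (A \<inter> cell m (\<sigma> k))"
        by (simp add: lborel_distr_plus)
      also have "\<dots> = emeasure lborel ((+) ?c -` (A \<inter> cell m (\<sigma> k)))"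
        using C by (subst emeasure_distr) auto
      finally show ?thesis ..
    qed
    moreover have "?B \<inter> cell m k \<in> sets unit_interval" "A \<inter> cell m (\<sigma> k) \<in> sets unit_interval"
      using A B by auto
    ultimately show ?thesis by (simp add: emeasure_unit_interval)
  qed
  have "emeasure (distr unit_interval unit_interval (dperm m \<sigma>)) A = emeasure unit_interval ?B"
    using emeasure_distr[OF dperm_measurable[OF \<sigma>] A] by simp
  also have "\<dots> = (\<Sum>k\<le>2 ^ m. emeasure unit_interval (A \<inter> cell m (\<sigma> k)))"
    unfolding emeasure_cell_split[OF B, of m] piece ..
  also have "\<dots> = (\<Sum>k\<le>2 ^ m. emeasure unit_interval (A \<inter> cell m k))"
    using sum.permute[OF permutes_subset[OF \<sigma>], of "{..2 ^ m}" "\<lambda>k. emeasure unit_interval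
        (A \<inter> cell m k)"]
    by (simp add: comp_def subset_eq)
  also have "\<dots> = emeasure unit_interval A" by (rule emeasure_cell_split[OF A, symmetric])
  finally show "emeasure (distr unit_interval unit_interval (dperm m \<sigma>)) A = emeasure unit_interval
      A" .
qed simp

lemma dperm_inv_mp: "\<sigma> permutes {..<2 ^ m} \<Longrightarrow> dperm m \<sigma> \<in> inv_mp unit_interval"
  by (rule inv_mpI[where g="dperm m (inv \<sigma>)"])
     (use dperm_measurable permutes_inv distr_dperm dperm_inv in auto)

text \<open>The complements of the domain and of the image of \<open>t\<close> have equal
  cardinality, so any bijection between them completes \<open>t\<close>.\<close>

lemma extend_to_permutation:
  assumes "finite S" "A \<subseteq> S" "inj_on t A" "t ` A \<subseteq> S"
  obtains p where "p permutes S" "\<And>a. a \<in> A \<Longrightarrow> p a = t a"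
proof -
  have "card (S - A) = card (S - t ` A)"
    using assms by (simp add: card_Diff_subset finite_subset card_image)
  then obtain h where h: "bij_betw h (S - A) (S - t ` A)"
    using finite_same_card_bij[of "S - A" "S - t ` A"] assms by auto
  define p where "p x = (if x \<in> A then t x else if x \<in> S then h x else x)" for x
  have "bij_betw p (A \<union> (S - A)) (t ` A \<union> (S - t ` A))"
  proof (rule bij_betw_combine)
    show "bij_betw p A (t ` A)"
      using assms(3) by (subst bij_betw_cong[of A p t]) (auto simp: p_def bij_betw_def)
    show "bij_betw p (S - A) (S - t ` A)"
      using h by (subst bij_betw_cong[of "S - A" p h]) (auto simp: p_def)
  qed auto
  moreover have "A \<union> (S - A) = S" "t ` A \<union> (S - t ` A) = S" using assms by auto
  ultimately have "bij_betw p S S" by simp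
  then have "p permutes S"
    using assms(2) by (intro bij_imp_permutes) (auto simp: p_def)
  then show ?thesis by (rule that) (simp add: p_def)
qed

text \<open>Both differences complement the same intersection. Hence a bound on one of them controls
  the symmetric difference of two images of a set, and approximation errors can be measured on one
  side only.\<close>

lemma measure_Diff_commute:
  assumes "finite_measure M" "A \<in> sets M" "B \<in> sets M" "measure M A = measure M B"
  shows "measure M (A - B) = measure M (B - A)"
proof -
  interpret finite_measure M by fact
  have "measure M (A - B) = measure M A - measure M (A \<inter> B)"
    "measure M (B - A) = measure M B - measure M (B \<inter> A)"
    using assms by (simp_all add: finite_measure_Diff')
  then show ?thesis using assms by (simp add: Int_commute)
qed

lemma measure_dyadic_index:
  assumes "V \<subseteq> {..<2 ^ m}"
  shows "measure unit_interval {v \<in> {0..1}. dyadic m v \<in> V} = real (card V) / 2 ^ m"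
proof -
  have fin: "finite V" using assms finite_subset by blast
  have "{v \<in> {0..1}. dyadic m v \<in> V} = (\<Union>k\<in>V. cell m k)" by (auto simp: cell_def)
  also have "measure unit_interval \<dots> = (\<Sum>k\<in>V. measure unit_interval (cell m k))"
    using fin by (intro unit_interval.finite_measure_finite_Union)
        (auto intro: disjoint_family_cell[of UNIV, simplified])
  also have "\<dots> = (\<Sum>k\<in>V. 1 / 2 ^ m)"
    using assms by (intro sum.cong refl measure_cell) auto
  finally show ?thesis by simp
qed

text \<open>Halmos' weak approximation. For large \<open>m\<close> each image \<open>s ` cell n j\<close> is nearly a union
  of cells of level \<open>m\<close>; discard the cells in excess of \<open>2 ^ (m - n)\<close>, match the remaining
  ones with the cells contained in \<open>cell n j\<close>, and extend the matching to a permutation.\<close>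

lemma dperm_approx:
  assumes s: "s \<in> inv_mp unit_interval" and e: "0 < e"
  shows "\<exists>m\<ge>n. \<exists>\<sigma>. \<sigma> permutes {..<2 ^ m} \<and>
    (\<forall>j<2 ^ n. measure unit_interval (s ` cell n j - dperm m \<sigma> ` cell n j) \<le> e)"
proof -
  define r where "r = the_inv_into (space unit_interval) s"
  have r: "r \<in> inv_mp unit_interval" "\<And>x. x \<in> {0..1} \<Longrightarrow> r (s x) = x" "\<And>x. x \<in> {0..1} \<Longrightarrow> s (r x) = x"
    using inv_mp_inverse[OF s] by (auto simp: r_def)
  \<comment> \<open>\<open>X v\<close> is the index of the cell of level n whose image under
    \<open>s\<close> contains v. The images thus become level sets of a simple function, to which
    \<open>dyadic.approx_label\<close> applies.\<close>
  define X where "X v = dyadic n (r v)" for v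
  have X: "simple_function unit_interval X"
    unfolding X_def[abs_def] by (rule simple_function_inv_mp[OF r(1) simple_function_dyadic])
  define E where "E j = s ` cell n j" for j
  have E_sets: "E j \<in> sets unit_interval" and E_meas: "j < 2 ^ n \<Longrightarrow> measure unit_interval (E j) =
      1 / 2 ^ n" for j
    using inv_mp_image[OF s cell_sets] measure_cell by (auto simp: E_def)
  have E_eq: "v \<in> E j \<longleftrightarrow> v \<in> {0..1} \<and> X v = j" for v j
  proof
    assume "v \<in> E j"
    then obtain u where "u \<in> {0..1}" "dyadic n u = j" "v = s u" by (auto simp: E_def cell_def)
    then show "v \<in> {0..1} \<and> X v = j"
      using r(2)[of u] inv_mp_space[OF s, of u] by (simp add: X_def)
  next
    assume v: "v \<in> {0..1} \<and> X v = j"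
    then have "r v \<in> cell n j" "v = s (r v)"
      using r(3)[of v] inv_mp_space[OF r(1), of v] by (simp_all add: X_def cell_def)
    then show "v \<in> E j" unfolding E_def by blast
  qed
  have e2: "0 < e / 2" using e by simp
  obtain N where N: "\<And>m. m \<ge> N \<Longrightarrow> \<exists>f. range f \<subseteq> X ` {0..1} \<and> measure unit_interval {w \<in> {0..1}.
      X w \<noteq> f (dyadic m w)} < e / 2"
    using dyadic.approx_label[OF X e2, unfolded eventually_sequentially space_unit_interval]
        by blast
  define m where "m = max n N"
  have m: "n \<le> m" and "N \<le> m" by (simp_all add: m_def)
  from N[OF \<open>N \<le> m\<close>] obtain f where err: "measure unit_interval {w \<in> {0..1}. X w \<noteq> f (dyadic m w)} <
      e / 2"
    by blast
  let ?D = "{w \<in> {0..1}. X w \<noteq> f (dyadic m w)}"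
  have D: "?D \<in> sets unit_interval"
  proof -
    have "simple_function unit_interval (\<lambda>w. (X w, dyadic m w))"
      by (intro simple_function_Pair X simple_function_dyadic)
    from simple_functionD(2)[OF this, of "{(a, b). a \<noteq> f b}"] show ?thesis
      by (rule back_subst[where P="\<lambda>A. A \<in> sets unit_interval"]) auto
  qed
  \<comment> \<open>The number of cells of level m in one cell of level n.\<close>
  define c :: nat where "c = 2 ^ (m - n)"
  have c: "0 < c" "c * 2 ^ n = 2 ^ m" using m by (auto simp: c_def power_add[symmetric])
  have creal: "real c / 2 ^ m = 1 / 2 ^ n"
  proof -
    have "(2::real) ^ m = real c * 2 ^ n" using c(2)
        by (metis of_nat_mult of_nat_numeral of_nat_power)
    then show ?thesis using c(1) by simp
  qed
  \<comment> \<open>\<open>V j\<close> lists the cells of level m that \<open>f\<close> assigns to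
    the image \<open>E j\<close>; \<open>B j\<close> lists those contained in
    \<open>cell n j\<close>.\<close>
  define V where "V j = {k \<in> {..<2 ^ m}. f k = j}" for j
  define B where "B j = {j * c..<j * c + c}" for j :: nat
  have fin: "finite (V j)" for j by (simp add: V_def)
  have "\<exists>V'. V' \<subseteq> V j \<and> card V' = min c (card (V j))" for j
    by (rule obtain_subset_with_card_n[of "min c (card (V j))" "V j"]) auto
  then obtain V' where V': "\<And>j. V' j \<subseteq> V j" "\<And>j. card (V' j) = min c (card (V j))" by metis
  have fin': "finite (V' j)" for j using V'(1) fin finite_subset by blast
  have "\<exists>t. inj_on t (V' j) \<and> t ` V' j \<subseteq> B j" for j
    using V'(2)[of j] fin'[of j] by (intro inj_on_iff_card_le[THEN iffD2] ) (auto simp: B_def)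
  then obtain t where t: "\<And>j. inj_on (t j) (V' j)" "\<And>j. t j ` V' j \<subseteq> B j" by metis
  have B_div: "k div c = j" if "k \<in> B j" for k j
    using that c(1) by (auto simp: B_def intro!: div_nat_eqI simp: algebra_simps)
  define A where "A = (\<Union>j<2 ^ n. V' j)"
  define \<tau> where "\<tau> k = t (f k) k" for k
  have A_f: "k \<in> A \<Longrightarrow> k \<in> V' (f k) \<and> f k < 2 ^ n" for k
    using V'(1) by (auto simp: A_def V_def)
  have \<tau>_div: "\<tau> k div c = f k" if "k \<in> A" for k
    using t(2)[of "f k"] A_f[OF that] by (intro B_div) (auto simp: \<tau>_def)
  have "inj_on \<tau> A"
  proof (rule inj_onI)
    fix k l assume kl: "k \<in> A" "l \<in> A" "\<tau> k = \<tau> l"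
    then have "f k = f l" using \<tau>_div by metis
    then show "k = l"
      using kl A_f[of k] A_f[of l] inj_onD[OF t(1)[of "f l"], of k l] by (simp add: \<tau>_def)
  qed
  moreover have "\<tau> ` A \<subseteq> {..<2 ^ m}"
  proof (rule image_subsetI)
    fix k assume k: "k \<in> A"
    have "\<tau> k < 2 ^ n * c"
      using \<tau>_div[OF k] A_f[OF k] c(1) by (metis div_less_iff_less_mult)
    then show "\<tau> k \<in> {..<2 ^ m}" using c(2) by (simp add: mult.commute)
  qed
  moreover have "A \<subseteq> {..<2 ^ m}" using V'(1) by (auto simp: A_def V_def)
  ultimately have sub: "A \<subseteq> {..<2 ^ m}" and inj: "inj_on \<tau> A" and img: "\<tau> ` A \<subseteq> {..<2 ^ m}"
    by blast+
  obtain p where p: "p permutes {..<2 ^ m}" "\<And>k. k \<in> A \<Longrightarrow> p k = \<tau> k"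
    by (rule extend_to_permutation[OF finite_lessThan sub inj img]) blast
  \<comment> \<open>The matching was built from the image back into \<open>cell n j\<close>, so the
    approximating permutation is the inverse of \<open>p\<close>.\<close>
  define \<sigma> where "\<sigma> = inv p"
  have \<sigma>: "\<sigma> permutes {..<2 ^ m}" using p(1) by (simp add: \<sigma>_def permutes_inv)
  have p_inv: "p = inv \<sigma>" using p(1) by (simp add: \<sigma>_def permutes_inv_inv)
  have "measure unit_interval (E j - dperm m \<sigma> ` cell n j) \<le> e" if j: "j < 2 ^ n" for j
  proof -
    let ?W = "{v \<in> {0..1}. dyadic m v \<in> V j - V' j}"
    have W: "?W \<in> sets unit_interval"
      using simple_functionD(2)[OF simple_function_dyadic, of m "V j - V' j"]
      by (rule back_subst[where P="\<lambda>A. A \<in> sets unit_interval"]) auto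
    have U: "{v \<in> {0..1}. dyadic m v \<in> V j} \<in> sets unit_interval"
      using simple_functionD(2)[OF simple_function_dyadic, of m "V j"]
      by (rule back_subst[where P="\<lambda>A. A \<in> sets unit_interval"]) auto
    have one: "{1} \<in> sets unit_interval" by (simp add: sets_unit_interval_iff)
    note W1 = sets.Un[OF W one]
    \<comment> \<open>A point of \<open>E j\<close> outside the error set and the discarded cells,
      and different from 1, lies in a matched cell, which \<open>p\<close> carries into
      \<open>cell n j\<close>.\<close>
    have "E j - dperm m \<sigma> ` cell n j \<subseteq> ?D \<union> (?W \<union> {1})"
    proof
      fix v assume v: "v \<in> E j - dperm m \<sigma> ` cell n j"
      then have v1: "v \<in> {0..1}" "X v = j" using E_eq by auto
      show "v \<in> ?D \<union> (?W \<union> {1})"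
      proof (rule ccontr)
        assume n: "v \<notin> ?D \<union> (?W \<union> {1})"
        then have "f (dyadic m v) = j" "v < 1" "dyadic m v \<notin> V j - V' j" using v1 by auto
        moreover have "dyadic m v < 2 ^ m" using v1(1) \<open>v < 1\<close> by (intro dyadic_lt) auto
        ultimately have k: "dyadic m v \<in> V' j" by (auto simp: V_def)
        then have kA: "dyadic m v \<in> A" using j by (auto simp: A_def)
        define u where "u = dperm m p v"
        have u: "u \<in> {0..1}" "dyadic m u = \<tau> (dyadic m v)"
          using dperm[OF p(1) v1(1)] p(2)[OF kA] by (auto simp: u_def)
        have "dyadic n u = dyadic m u div c"
          unfolding c_def using u m by (intro dyadic_div) auto
        also have "\<dots> = j" using \<tau>_div[OF kA] \<open>f (dyadic m v) = j\<close> u by simp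
        finally have "u \<in> cell n j" using u by (simp add: cell_def)
        moreover have "dperm m \<sigma> u = v"
          unfolding u_def p_inv by (rule dperm_inv(2)[OF \<sigma> v1(1)])
        ultimately show False using v by blast
      qed
    qed
    then have "measure unit_interval (E j - dperm m \<sigma> ` cell n j) \<le> measure unit_interval (?D \<union>
        (?W \<union> {1}))"
      by (rule unit_interval.finite_measure_mono[OF _ sets.Un[OF D W1]])
    also have "\<dots> \<le> measure unit_interval ?D + measure unit_interval (?W \<union> {1})"
      by (rule measure_Un_le[OF D W1])
    also have "measure unit_interval (?W \<union> {1}) \<le> measure unit_interval ?W + measure unit_interval
        {1}"
      by (rule measure_Un_le[OF W one])
    also have "measure unit_interval {1} = 0" using one by (simp add: measure_unit_interval)
    also have "measure unit_interval ?W \<le> e / 2"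
    proof (cases "card (V j) \<le> c")
      case True
      then have "card (V' j) = card (V j)" using V'(2) by simp
      then have "V' j = V j" using V'(1) fin by (intro card_subset_eq) auto
      then show ?thesis using e by simp
    next
      case False
      \<comment> \<open>The excess over c cells is small because the cells in \<open>V j\<close> lie
        in \<open>E j\<close> up to \<open>?D\<close>, and \<open>E j\<close> has the measure of
        exactly c cells.\<close>
      have "measure unit_interval ?W = real (card (V j - V' j)) / 2 ^ m"
        by (intro measure_dyadic_index) (auto simp: V_def)
      also have "card (V j - V' j) = card (V j) - c"
        using False V'(1,2)[of j] fin' by (simp add: card_Diff_subset)
      also have "real (card (V j) - c) / 2 ^ m = real (card (V j)) / 2 ^ m - 1 / 2 ^ n"
        using False creal by (simp add: of_nat_diff diff_divide_distrib)
      also have "real (card (V j)) / 2 ^ m = measure unit_interval {v \<in> {0..1}. dyadic m v \<in> V j}"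
        by (intro measure_dyadic_index[symmetric]) (auto simp: V_def)
      also have "\<dots> \<le> measure unit_interval (E j \<union> ?D)"
        using D E_sets by (intro unit_interval.finite_measure_mono) (auto simp: E_eq V_def)
      also have "\<dots> \<le> measure unit_interval (E j) + measure unit_interval ?D"
        using D E_sets by (intro measure_Un_le) auto
      finally show ?thesis using E_meas[OF j] err by simp
    qed
    finally show ?thesis using err by simp
  qed
  then show ?thesis using m \<sigma> by (auto simp: E_def)
qed

section \<open>Measurable families of automorphisms of the interval\<close>

text \<open>Measurability of \<open>s\<close> as a map into the automorphism group, expressed without a topology.\<close>

definition measurable_field :: "'a measure \<Rightarrow> ('a \<Rightarrow> real \<Rightarrow> real) \<Rightarrow> bool" where
  "measurable_field M s \<longleftrightarrow> (\<forall>x\<in>space M. s x \<in> inv_mp unit_interval) \<and>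
     (\<forall>A\<in>sets unit_interval. \<forall>B\<in>sets unit_interval.
        (\<lambda>x. measure unit_interval (s x ` A \<inter> B)) \<in> borel_measurable M)"

abbreviation inv_I :: "(real \<Rightarrow> real) \<Rightarrow> real \<Rightarrow> real" where
  "inv_I f \<equiv> the_inv_into {0..1} f"

lemma inv_I:
  assumes "f \<in> inv_mp unit_interval"
  shows "inv_I f \<in> inv_mp unit_interval" "\<And>u. u \<in> {0..1} \<Longrightarrow> inv_I f (f u) = u"
    "\<And>u. u \<in> {0..1} \<Longrightarrow> f (inv_I f u) = u"
    "\<And>u. u \<in> {0..1} \<Longrightarrow> f u \<in> {0..1}" "\<And>u. u \<in> {0..1} \<Longrightarrow> inv_I f u \<in> {0..1}"
  using inv_mp_inverse[OF assms] inv_mp_space[OF assms] inv_mp_space[OF inv_mp_inverse(1)[OF assms]]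
      by auto

section \<open>Measurable choice of approximating dyadic permutations\<close>

definition dperms :: "(real \<Rightarrow> real) set" where
  "dperms = {dperm m \<sigma> | m \<sigma>. \<sigma> permutes {..<2 ^ m}}"

definition dperm_enum :: "nat \<Rightarrow> real \<Rightarrow> real" where
  "dperm_enum = from_nat_into dperms"

lemma countable_dperms: "countable dperms"
proof -
  have "dperms = (\<Union>m. dperm m ` {\<sigma>. \<sigma> permutes {..<2 ^ m}})"
    by (auto simp: dperms_def)
  also have "countable \<dots>"
    by (intro countable_UN countable_image) (auto intro: countable_finite finite_permutations)
  finally show ?thesis .
qed

lemma dperms_nonempty: "dperms \<noteq> {}"
  unfolding dperms_def using permutes_id by blast

lemma dperm_enum_in: "dperm_enum k \<in> dperms"
  unfolding dperm_enum_def by (rule from_nat_into[OF dperms_nonempty])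

lemma dperm_enum_surj: "p \<in> dperms \<Longrightarrow> \<exists>k. dperm_enum k = p"
  unfolding dperm_enum_def using from_nat_into_surj[OF countable_dperms] by blast

lemma dperms_inv_mp: "p \<in> dperms \<Longrightarrow> p \<in> inv_mp unit_interval"
  by (auto simp: dperms_def dperm_inv_mp)

lemma dperm_enum_inv_mp: "dperm_enum k \<in> inv_mp unit_interval"
  by (rule dperms_inv_mp[OF dperm_enum_in])

text \<open>With (1/4)^n allowed per cell, the 2^n cells together contribute at most (1/2)^n, a
  summable bound. The one-point cell with index 2^n is left out.\<close>

definition close_at :: "(real \<Rightarrow> real) \<Rightarrow> nat \<Rightarrow> nat \<Rightarrow> bool" where
  "close_at f n k \<longleftrightarrow> (\<forall>j<2 ^ n. measure unit_interval (f ` cell n j - dperm_enum k ` cell n j) \<le>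
      (1/4) ^ n)"

text \<open>The least admissible index is a measurable selection, because for each fixed k the
  condition \<open>close_at\<close> is measurable in a measurable field.\<close>

definition approx_index :: "(real \<Rightarrow> real) \<Rightarrow> nat \<Rightarrow> nat" where
  "approx_index f n = (LEAST k. close_at f n k)"

lemma close_at_approx_index:
  assumes "f \<in> inv_mp unit_interval"
  shows "close_at f n (approx_index f n)"
proof -
  obtain m \<sigma> where "\<sigma> permutes {..<2 ^ m}"
    "\<forall>j<2 ^ n. measure unit_interval (f ` cell n j - dperm m \<sigma> ` cell n j) \<le> (1/4) ^ n"
    using dperm_approx[OF assms, of "(1/4) ^ n" n] by auto
  moreover from this obtain k where "dperm_enum k = dperm m \<sigma>"
    using dperm_enum_surj[of "dperm m \<sigma>"] by (auto simp: dperms_def)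
  ultimately have "close_at f n k" by (simp add: close_at_def)
  then show ?thesis unfolding approx_index_def by (rule LeastI)
qed

lemma measurable_measure_Diff:
  assumes s: "measurable_field M s" and A: "A \<in> sets unit_interval" and B: "B \<in> sets unit_interval"
  shows "(\<lambda>x. measure unit_interval (s x ` A - B)) \<in> borel_measurable M"
proof -
  have [measurable]: "(\<lambda>x. measure unit_interval (s x ` A \<inter> B)) \<in> borel_measurable M"
    using s A B by (auto simp: measurable_field_def)
  have "measure unit_interval (s x ` A - B) = measure unit_interval A - measure unit_interval
      (s x ` A \<inter> B)"
    if "x \<in> space M" for x
  proof -
    have "s x \<in> inv_mp unit_interval" using s that by (auto simp: measurable_field_def)
    then show ?thesis
      using inv_mp_image[OF _ A, of "s x"] B by (simp add: unit_interval.finite_measure_Diff')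
  qed
  then show ?thesis by (subst measurable_cong) auto
qed

lemma measurable_approx_index:
  assumes s: "measurable_field M s"
  shows "(\<lambda>x. approx_index (s x) n) \<in> measurable M (count_space UNIV)"
proof -
  have "Measurable.pred M (\<lambda>x. close_at (s x) n k)" for k
  proof -
    have [measurable]: "(\<lambda>x. measure unit_interval (s x ` cell n j - dperm_enum k ` cell n j)) \<in>
        borel_measurable M" for j
      by (intro measurable_measure_Diff[OF s] inv_mp_image[OF dperm_enum_inv_mp] cell_sets)
    show ?thesis
      unfolding close_at_def by measurable
  qed
  then show ?thesis unfolding approx_index_def by (rule measurable_Least)
qed

text \<open>Applying the measure preserving map \<open>s x\<close> to the intersection of B with the
  preimage of A yields the intersection of A with the image of B, so the two sets exchange
  roles.\<close>

lemma measurable_field_inverse: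
  assumes s: "measurable_field M s"
  shows "measurable_field M (\<lambda>x. inv_I (s x))"
  unfolding measurable_field_def
proof (intro conjI ballI)
  fix x assume "x \<in> space M"
  then show "inv_I (s x) \<in> inv_mp unit_interval"
    using s inv_I(1) by (auto simp: measurable_field_def)
next
  fix A B assume A: "A \<in> sets unit_interval" and B: "B \<in> sets unit_interval"
  have [measurable]: "(\<lambda>x. measure unit_interval (s x ` B \<inter> A)) \<in> borel_measurable M"
    using s A B by (auto simp: measurable_field_def)
  have "measure unit_interval (inv_I (s x) ` A \<inter> B) = measure unit_interval (s x ` B \<inter> A)"
    if "x \<in> space M" for x
  proof -
    have f: "s x \<in> inv_mp unit_interval" using s that by (auto simp: measurable_field_def)
    have sub: "A \<subseteq> {0..1}" "B \<subseteq> {0..1}" using A B by (auto simp: sets_unit_interval_iff)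
    have "s x ` (inv_I (s x) ` A \<inter> B) = s x ` B \<inter> A"
    proof (intro equalityI subsetI)
      fix v assume "v \<in> s x ` (inv_I (s x) ` A \<inter> B)"
      then obtain a where a: "a \<in> A" "inv_I (s x) a \<in> B" "v = s x (inv_I (s x) a)" by auto
      then have "v = a" using inv_I(3)[OF f] sub by auto
      with a show "v \<in> s x ` B \<inter> A" by auto
    next
      fix v assume "v \<in> s x ` B \<inter> A"
      then obtain b where b: "b \<in> B" "v = s x b" "v \<in> A" by auto
      then have "inv_I (s x) v = b" using inv_I(2)[OF f] sub by auto
      with b(3) have "b \<in> inv_I (s x) ` A" by (metis image_eqI)
      with b show "v \<in> s x ` (inv_I (s x) ` A \<inter> B)" by blast
    qed
    then show ?thesis
      using inv_mp_image(2)[OF f, of "inv_I (s x) ` A \<inter> B"] inv_mp_image(1)[OF inv_I(1)[OF f] A] B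
          by simp
  qed
  then show "(\<lambda>x. measure unit_interval (inv_I (s x) ` A \<inter> B)) \<in> borel_measurable M"
    by (subst measurable_cong) auto
qed

lemma dyadic_eq_imp_dist_le:
  assumes "u \<in> {0..1}" "v \<in> {0..1}" "dyadic n u = dyadic n v"
  shows "\<bar>u - v\<bar> \<le> (1/2) ^ n"
proof -
  have "\<bar>2 ^ n * u - 2 ^ n * v\<bar> \<le> 1"
    using dyadic_bounds[of u n] dyadic_bounds[of v n] assms by auto
  then have "2 ^ n * \<bar>u - v\<bar> \<le> 1"
    by (simp add: abs_mult right_diff_distrib[symmetric])
  then show ?thesis by (simp add: field_simps)
qed

text \<open>A set of values of \<open>f\<close>, not of arguments: off it, a value of
  \<open>f\<close> is also taken by the approximating permutation in the same cell. For this reason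
  convergence is first obtained for the inverse maps.\<close>

definition approx_error :: "(real \<Rightarrow> real) \<Rightarrow> nat \<Rightarrow> real set" where
  "approx_error f n = (\<Union>j<2 ^ n. f ` cell n j - dperm_enum (approx_index f n) ` cell n j)"

lemma
  assumes f: "f \<in> inv_mp unit_interval"
  shows approx_error_sets: "approx_error f n \<in> sets unit_interval"
    and measure_approx_error: "measure unit_interval (approx_error f n) \<le> (1/2) ^ n"
proof -
  have S: "f ` cell n j - dperm_enum (approx_index f n) ` cell n j \<in> sets unit_interval" for j
    by (intro sets.Diff inv_mp_image[OF f] inv_mp_image[OF dperm_enum_inv_mp] cell_sets)
  then show "approx_error f n \<in> sets unit_interval"
    unfolding approx_error_def by (intro sets.finite_UN) auto
  have "measure unit_interval (approx_error f n) \<le>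
      (\<Sum>j<2 ^ n. measure unit_interval (f ` cell n j - dperm_enum (approx_index f n) ` cell n j))"
    unfolding approx_error_def using S by (intro measure_UNION_le) auto
  also have "\<dots> \<le> (\<Sum>j<(2::nat) ^ n. (1/4) ^ n)"
    using close_at_approx_index[OF f, of n] by (intro sum_mono) (auto simp: close_at_def)
  also have "\<dots> = (1/2) ^ n" by (simp add: power_mult_distrib[symmetric])
  finally show "measure unit_interval (approx_error f n) \<le> (1/2) ^ n" .
qed

lemma not_in_derrD:
  assumes "f u \<notin> approx_error f n" "u \<in> {0..1}" "u \<noteq> 1"
  shows "\<exists>w\<in>{0..1}. dyadic n w = dyadic n u \<and> f u = dperm_enum (approx_index f n) w"
proof -
  have "dyadic n u < 2 ^ n" using assms by (intro dyadic_lt) auto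
  moreover have "f u \<in> f ` cell n (dyadic n u)" using assms by (auto simp: cell_def)
  ultimately have "f u \<in> dperm_enum (approx_index f n) ` cell n (dyadic n u)" using assms(1) by
      (auto simp: approx_error_def)
  then show ?thesis by (auto simp: cell_def)
qed

lemma AE_not_one: "AE u in unit_interval. u \<noteq> 1"
proof -
  have "{1} \<in> null_sets unit_interval"
    by (intro null_setsI) (simp_all add: emeasure_unit_interval sets_unit_interval_iff)
  from AE_not_in[OF this] show ?thesis by simp
qed

text \<open>The errors are summable, so the Borel--Cantelli lemma gives convergence almost everywhere.\<close>

lemma dperm_enum_inverse_tendsto:
  assumes f: "f \<in> inv_mp unit_interval"
  shows "AE v in unit_interval. (\<lambda>n. inv_I (dperm_enum (approx_index f n)) v) \<longlonglongrightarrow> inv_I f v"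
proof -
  have "summable (\<lambda>n. measure unit_interval (approx_error f n))"
    using measure_approx_error[OF f] by (intro summable_comparison_test'[OF summable_geometric[of
        "1/2"]]) auto
  then have "AE v in unit_interval. \<forall>\<^sub>F n in sequentially. v \<in> space unit_interval - approx_error f
      n"
    using approx_error_sets[OF f] by (intro borel_cantelli_AE1)
        (auto simp: unit_interval.emeasure_eq_measure)
  moreover have "AE v in unit_interval. inv_I f v \<noteq> 1"
    by (rule inv_mp_AE[OF inv_I(1)[OF f] AE_not_one])
  moreover have "AE v in unit_interval. v \<in> space unit_interval" by (rule AE_space)
  ultimately show ?thesis
  proof eventually_elim
    fix v assume ev: "\<forall>\<^sub>F n in sequentially. v \<in> space unit_interval - approx_error f n" and v1:
        "inv_I f v \<noteq> 1"
      and "v \<in> space unit_interval"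
    then have v: "v \<in> {0..1}" by simp
    define u where "u = inv_I f v"
    have u: "u \<in> {0..1}" "f u = v" using inv_I(3,5)[OF f v] by (simp_all add: u_def)
    have "\<forall>\<^sub>F n in sequentially. norm (inv_I (dperm_enum (approx_index f n)) v - u) \<le> (1/2) ^ n"
      using ev
    proof eventually_elim
      fix n assume "v \<in> space unit_interval - approx_error f n"
      \<comment> \<open>The preimage u of v under \<open>f\<close> and its preimage w under the
        approximating permutation share a cell of level n, hence differ by at most (1/2)^n.\<close>
      then obtain w where w: "w \<in> {0..1}" "dyadic n w = dyadic n u"
          "v = dperm_enum (approx_index f n) w"
        using not_in_derrD[of f u n] u v1 by (auto simp: u_def)
      then have "inv_I (dperm_enum (approx_index f n)) v = w" using inv_I(2)[OF dperm_enum_inv_mp]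
          by simp
      then show "norm (inv_I (dperm_enum (approx_index f n)) v - u) \<le> (1/2) ^ n"
        using dyadic_eq_imp_dist_le[OF w(1) u(1) w(2)] by simp
    qed
    then have "(\<lambda>n. inv_I (dperm_enum (approx_index f n)) v - u) \<longlonglongrightarrow> 0"
      by (rule Lim_null_comparison) (simp add: LIMSEQ_power_zero)
    then show "(\<lambda>n. inv_I (dperm_enum (approx_index f n)) v) \<longlonglongrightarrow> inv_I f v"
      unfolding u_def by (rule LIM_zero_cancel)
  qed
qed

lemma realize_inverse:
  assumes s: "measurable_field M s"
  shows "\<exists>g\<in>measurable (M \<Otimes>\<^sub>M unit_interval) unit_interval.
    \<forall>x\<in>space M. AE v in unit_interval. g (x, v) = inv_I (s x) v"
proof -
  let ?q = "\<lambda>k. inv_I (dperm_enum k)"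
  have real_borel: "h \<in> borel_measurable N" if "h \<in> measurable N unit_interval" for h and N ::
      "'c measure"
    using measurable_compose[OF that borel_measurable_unit_interval[of "\<lambda>x. x"]] by simp
  \<comment> \<open>The n-th approximation depends on x only through a measurable index with
    countably many values, so it is jointly measurable.\<close>
  define gn where "gn n = (\<lambda>w. ?q (approx_index (s (fst w)) n) (snd w))" for n
  have "gn n \<in> measurable (M \<Otimes>\<^sub>M unit_interval) unit_interval" for n
    unfolding gn_def
  proof (rule measurable_compose_countable'[where f="\<lambda>k w. ?q k (snd w)" and I=UNIV])
    show "(\<lambda>w. ?q k (snd w)) \<in> measurable (M \<Otimes>\<^sub>M unit_interval) unit_interval" for k
      by (rule measurable_compose[OF measurable_snd inv_mpD(1)[OF inv_I(1)[OF dperm_enum_inv_mp]]])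
    show "(\<lambda>w. approx_index (s (fst w)) n) \<in> measurable (M \<Otimes>\<^sub>M unit_interval) (count_space UNIV)"
      by (rule measurable_compose[OF measurable_fst measurable_approx_index[OF s]])
  qed simp
  then have [measurable]: "gn n \<in> borel_measurable (M \<Otimes>\<^sub>M unit_interval)" for n
    by (rule real_borel)
  \<comment> \<open>Where the sequence diverges, \<open>lim\<close> is unspecified; clamping keeps
    the value in the interval there and changes nothing where the limit exists.\<close>
  define g where "g w = max 0 (min 1 (lim (\<lambda>n. gn n w)))" for w
  have "g \<in> measurable (M \<Otimes>\<^sub>M unit_interval) unit_interval"
  proof (rule measurable_unit_intervalI)
    have "(\<lambda>w. lim (\<lambda>n. gn n w)) \<in> borel_measurable (M \<Otimes>\<^sub>M unit_interval)"
      by (rule borel_measurable_lim_metric) simp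
    then show "g \<in> borel_measurable (M \<Otimes>\<^sub>M unit_interval)"
      unfolding g_def[abs_def] by measurable
  qed (auto simp: g_def)
  moreover have "AE v in unit_interval. g (x, v) = inv_I (s x) v" if x: "x \<in> space M" for x
  proof -
    have f: "s x \<in> inv_mp unit_interval" using s x by (auto simp: measurable_field_def)
    show ?thesis
      using dperm_enum_inverse_tendsto[OF f] AE_space
    proof eventually_elim
      fix v assume "(\<lambda>n. ?q (approx_index (s x) n) v) \<longlonglongrightarrow> inv_I (s x) v" and "v \<in> space unit_interval"
      then have "lim (\<lambda>n. gn n (x, v)) = inv_I (s x) v" "inv_I (s x) v \<in> {0..1}"
        using inv_I(5)[OF f, of v] by (auto simp: gn_def intro: limI)
      then show "g (x, v) = inv_I (s x) v" by (simp add: g_def)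
    qed
  qed
  ultimately show ?thesis by blast
qed

text \<open>The approximation yields versions of inverse maps only, so it is applied to the inverse
  field.\<close>

lemma realize_field:
  assumes s: "measurable_field M s"
  shows "\<exists>g\<in>measurable (M \<Otimes>\<^sub>M unit_interval) unit_interval.
    \<forall>x\<in>space M. AE v in unit_interval. g (x, v) = s x v"
proof -
  obtain g where g: "g \<in> measurable (M \<Otimes>\<^sub>M unit_interval) unit_interval"
    "\<And>x. x \<in> space M \<Longrightarrow> AE v in unit_interval. g (x, v) = inv_I (inv_I (s x)) v"
    using realize_inverse[OF measurable_field_inverse[OF s]] by blast
  have "AE v in unit_interval. g (x, v) = s x v" if x: "x \<in> space M" for x
    using g(2)[OF x] AE_space
  proof eventually_elim
    fix v assume "g (x, v) = inv_I (inv_I (s x)) v" and "v \<in> space unit_interval"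
    moreover have f: "s x \<in> inv_mp unit_interval" using s x by (auto simp: measurable_field_def)
    ultimately show "g (x, v) = s x v"
      using inv_I(2)[OF f, of v] inv_I(2)[OF inv_I(1)[OF f], of "s x v"] inv_I(4)[OF f, of v]
          by simp
  qed
  with g(1) show ?thesis by blast
qed

section \<open>Completing automorphisms modulo null sets\<close>

lemma injective_nat_to_dense:
  obtains q :: "nat \<Rightarrow> real" where "inj q" "\<And>u v. u < v \<Longrightarrow> \<exists>n. u < q n \<and> q n < v"
proof -
  have inf: "infinite (\<rat> :: real set)"
    using Ints_subset_Rats infinite_super Nats_infinite Nats_subset_Ints
    by (metis (no_types))
  have bij: "bij_betw (from_nat_into (\<rat> :: real set)) UNIV \<rat>"
    by (rule bij_betw_from_nat_into[OF countable_rat inf])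
  show ?thesis
  proof (rule that)
    show "inj (from_nat_into (\<rat> :: real set))" using bij by (simp add: bij_betw_def)
    fix u v :: real assume "u < v"
    then obtain r where "r \<in> \<rat>" "u < r" "r < v" using Rats_dense_in_real by blast
    moreover have "r \<in> range (from_nat_into \<rat>)"
      using \<open>r \<in> \<rat>\<close> bij by (simp add: bij_betw_def)
    ultimately show "\<exists>n. u < from_nat_into \<rat> n \<and> from_nat_into \<rat> n < v" by blast
  qed
qed

text \<open>A strictly increasing pure jump function: its range misses the gaps at the jumps, whose
  lengths add up to one.\<close>

lemma ex_null_copy:
  obtains \<theta> \<psi> :: "real \<Rightarrow> real" and C :: "real set" where
    "\<theta> \<in> measurable unit_interval unit_interval" "\<psi> \<in> measurable unit_interval unit_interval"
    "C \<in> null_sets unit_interval" "\<theta> ` {0..1} = C" "\<And>u. u \<in> {0..1} \<Longrightarrow> \<psi> (\<theta> u) = u"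
proof -
  obtain q :: "nat \<Rightarrow> real" where inj: "inj q" and dense: "\<And>u v. u < v \<Longrightarrow> \<exists>n. u < q n \<and> q n < v"
    using injective_nat_to_dense by blast
  define d where "d n = (1 / 2 :: real) ^ Suc n" for n
  have d: "d sums 1" unfolding d_def using power_half_series by simp
  have d0: "0 < d n" for n by (simp add: d_def)
  \<comment> \<open>Counting the jump at q n only for u strictly beyond it places the gap directly
    above \<open>\<theta> (q n)\<close>, where \<open>K n\<close> sits.\<close>
  define j where "j u n = (if q n < u then d n else 0)" for u n
  have j_sum: "summable (j u)" for u
    by (rule summable_comparison_test'[OF sums_summable[OF d], of 0])
        (auto simp: j_def d0 less_imp_le)
  define \<theta> where "\<theta> u = suminf (j u)" for u
  have range: "\<theta> u \<in> {0..1}" for u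
  proof -
    have "0 \<le> \<theta> u" unfolding \<theta>_def by (rule suminf_nonneg[OF j_sum])
        (auto simp: j_def d0 less_imp_le)
    moreover have "\<theta> u \<le> suminf d" unfolding \<theta>_def
      by (rule suminf_le[OF _ j_sum sums_summable[OF d]]) (auto simp: j_def d0 less_imp_le)
    ultimately show ?thesis using sums_unique[OF d] by simp
  qed
  have jump: "\<theta> u + d n \<le> \<theta> v" if "u \<le> q n" "q n < v" for u v n
  proof -
    have 1: "(\<lambda>k. if k = n then d n else 0) sums d n" by (rule sums_single)
    have "\<theta> u + d n = (\<Sum>k. j u k + (if k = n then d n else 0))"
      unfolding \<theta>_def using suminf_add[OF j_sum[of u] sums_summable[OF 1]] sums_unique[OF 1] by simp
    also have "\<dots> \<le> \<theta> v" unfolding \<theta>_def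
      by (rule suminf_le[OF _ summable_add[OF j_sum sums_summable[OF 1]] j_sum])
         (use that in \<open>auto simp: j_def d0 less_imp_le\<close>)
    finally show ?thesis .
  qed
  have strict: "\<theta> u < \<theta> v" if uv: "u < v" for u v
  proof -
    obtain n where "u < q n" "q n < v" using dense[OF uv] by blast
    then have "\<theta> u + d n \<le> \<theta> v" by (intro jump) auto
    then show ?thesis using d0[of n] by linarith
  qed
  have mono\<theta>: "mono \<theta>" using strict by (intro monoI) (metis less_eq_real_def)
  have meas\<theta>: "\<theta> \<in> measurable unit_interval unit_interval"
    by (intro measurable_unit_intervalI borel_measurable_unit_interval borel_measurable_mono mono\<theta>
        range)
  \<comment> \<open>A generalised inverse of the increasing function \<theta>. The maximum with
    \<open>\<theta> 0\<close> makes 0 a member of the set, so the supremum is always taken over a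
    nonempty set.\<close>
  define \<psi> where "\<psi> v = Sup {u \<in> {0..1}. \<theta> u \<le> max v (\<theta> 0)}" for v
  have bdd: "bdd_above {u \<in> {0..1}. \<theta> u \<le> w}" for w by (intro bdd_aboveI[of _ 1]) auto
  have ne: "{u \<in> {0..1}. \<theta> u \<le> max v (\<theta> 0)} \<noteq> {}" for v by (auto intro: exI[of _ 0])
  have range\<psi>: "\<psi> v \<in> {0..1}" for v
  proof -
    have "0 \<le> \<psi> v" unfolding \<psi>_def by (intro cSup_upper bdd) auto
    moreover have "\<psi> v \<le> 1" unfolding \<psi>_def by (intro cSup_least ne) auto
    ultimately show ?thesis by simp
  qed
  have "mono \<psi>"
    unfolding \<psi>_def by (intro monoI cSup_subset_mono ne bdd) auto
  then have meas\<psi>: "\<psi> \<in> measurable unit_interval unit_interval"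
    by (intro measurable_unit_intervalI borel_measurable_unit_interval borel_measurable_mono range\<psi>)
  have \<psi>\<theta>: "\<psi> (\<theta> u) = u" if u: "u \<in> {0..1}" for u
  proof -
    have "\<theta> 0 \<le> \<theta> u" using u by (intro monoD[OF mono\<theta>]) auto
    then have "max (\<theta> u) (\<theta> 0) = \<theta> u" by simp
    then have "{w \<in> {0..1}. \<theta> w \<le> max (\<theta> u) (\<theta> 0)} = {0..u}"
      using u strict mono\<theta> by (auto simp: mono_def not_less[symmetric]) 
    then show ?thesis using u by (simp add: \<psi>_def)
  qed
  define C where "C = \<theta> ` {0..1}"
  \<comment> \<open>Describing the range as the fixed points of a measurable map shows that it is
    measurable.\<close>
  have C_eq: "C = {v \<in> space unit_interval. \<theta> (\<psi> v) = v}"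
  proof (intro equalityI subsetI)
    fix v assume "v \<in> C"
    then show "v \<in> {v \<in> space unit_interval. \<theta> (\<psi> v) = v}"
      using \<psi>\<theta> range unfolding C_def by auto
  next
    fix v assume "v \<in> {v \<in> space unit_interval. \<theta> (\<psi> v) = v}"
    then have "v = \<theta> (\<psi> v)" by simp
    then show "v \<in> C" unfolding C_def using range\<psi> by (rule image_eqI)
  qed
  have C_sets: "C \<in> sets unit_interval"
  proof -
    have comp: "(\<lambda>v. \<theta> (\<psi> v)) \<in> measurable unit_interval unit_interval"
      by (rule measurable_compose[OF meas\<psi> meas\<theta>])
    have ident [measurable]: "(\<lambda>v. v) \<in> borel_measurable unit_interval"
      by (rule borel_measurable_unit_interval) simp
    have [measurable]: "(\<lambda>v. \<theta> (\<psi> v)) \<in> borel_measurable unit_interval"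
      by (rule measurable_compose[OF comp ident])
    show ?thesis unfolding C_eq by (rule borel_measurable_eq) measurable
  qed
  define K where "K n = {\<theta> (q n) <..< \<theta> (q n) + d n}" for n
  have K01: "K n \<subseteq> {0..1}" for n
  proof -
    have "\<theta> (q n) + d n \<le> \<theta> (q n + 1)" by (rule jump) auto
    then show ?thesis using range[of "q n"] range[of "q n + 1"] by (auto simp: K_def)
  qed
  have K_sets: "K n \<in> sets unit_interval" for n using K01 by
      (auto simp: sets_unit_interval_iff K_def)
  have K_disj: "K m \<inter> K n = {}" if "m \<noteq> n" for m n
  proof -
    have "q m \<noteq> q n" using inj that by (auto dest: injD)
    then have "q m < q n \<or> q n < q m" by auto
    then have "\<theta> (q m) + d m \<le> \<theta> (q n) \<or> \<theta> (q n) + d n \<le> \<theta> (q m)" by (auto intro: jump)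
    then show ?thesis by (auto simp: K_def)
  qed
  have K_C: "C \<inter> K n = {}" for n
  proof -
    have "\<theta> u \<le> \<theta> (q n) \<or> \<theta> (q n) + d n \<le> \<theta> u" for u
      using jump[of "q n" n u] mono\<theta> by (cases "q n < u") (auto simp: mono_def not_less)
    then have "\<theta> u \<notin> K n" for u by (simp add: K_def not_less)
    then show ?thesis by (auto simp: C_def)
  qed
  have K_sums: "(\<lambda>n. measure unit_interval (K n)) sums measure unit_interval (\<Union>n. K n)"
    using K_sets K_disj by (intro unit_interval.finite_measure_UNION)
        (auto simp: disjoint_family_on_def)
  have K_d: "measure unit_interval (K n) = d n" for n
    using K_sets d0[of n] by (simp add: measure_unit_interval) (simp add: K_def)
  have "measure unit_interval (\<Union>n. K n) = 1"
    using sums_unique2[OF K_sums[unfolded K_d] d] .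
  moreover have "measure unit_interval ((\<Union>n. K n) \<union> C) = measure unit_interval (\<Union>n. K n) +
      measure unit_interval C"
    using K_C K_sets C_sets by (intro unit_interval.finite_measure_Union) auto
  moreover have "measure unit_interval ((\<Union>n. K n) \<union> C) \<le> 1" by (rule unit_interval.prob_le_1)
  ultimately have "measure unit_interval C = 0" using measure_nonneg[of unit_interval C] by linarith
  then have "C \<in> null_sets unit_interval"
    using C_sets by (simp add: unit_interval.emeasure_eq_measure null_setsI)
  then show ?thesis
    using that[OF meas\<theta> meas\<psi> _ C_def[symmetric] \<psi>\<theta>] by blast
qed

text \<open>A Hilbert hotel: \<open>f\<close> embeds the whole space in C, so E - C is pushed one
  step along \<open>f\<close> together with all its iterated images, and the remaining points of E
  stay fixed.\<close>

lemma borel_schroeder_bernstein: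
  assumes f[measurable]: "f \<in> measurable N N" and g[measurable]: "g \<in> measurable N N"
    and gf: "\<And>w. w \<in> space N \<Longrightarrow> g (f w) = w" and fC: "f ` space N = C"
    and C[measurable]: "C \<in> sets N" and E[measurable]: "E \<in> sets N" and CE: "C \<subseteq> E"
  shows "\<exists>h k. h \<in> measurable N N \<and> k \<in> measurable N N \<and>
    (\<forall>w\<in>E. h w \<in> C \<and> k (h w) = w) \<and> (\<forall>w\<in>C. k w \<in> E \<and> h (k w) = w)"
proof -
  have EN: "E \<subseteq> space N" using E by (rule sets.sets_into_space)
  \<comment> \<open>\<open>D n\<close> is the n-th iterated image of E - C under \<open>f\<close>,
    written with preimages under the left inverse \<open>g\<close> so that measurability is
    immediate.\<close>
  define D where "D = rec_nat (E - C) (\<lambda>_ A. C \<inter> (g -` A \<inter> space N))"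
  have D_0: "D 0 = E - C" and D_Suc: "D (Suc n) = C \<inter> (g -` D n \<inter> space N)" for n
    by (simp_all add: D_def)
  have D_sets: "D n \<in> sets N" for n
  proof (induction n)
    case 0 then show ?case using C E by (auto simp: D_0)
  next
    case (Suc n)
    then have "g -` D n \<inter> space N \<in> sets N" by (rule measurable_sets[OF g])
    then show ?case using C by (auto simp: D_Suc)
  qed
  define U where "U = (\<Union>n. D n)"
  have [measurable]: "U \<in> sets N" unfolding U_def using D_sets by auto
  have U_E: "U \<subseteq> E"
  proof -
    have "D n \<subseteq> E" for n using CE by (cases n) (auto simp: D_0 D_Suc)
    then show ?thesis by (auto simp: U_def)
  qed
  have fg: "f (g w) = w" if "w \<in> C" for w
    using that gf unfolding fC[symmetric] by auto
  have U_C: "w \<in> U \<longleftrightarrow> g w \<in> U" if "w \<in> C" for w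
  proof
    assume "w \<in> U"
    then obtain n where n: "w \<in> D n" by (auto simp: U_def)
    with that obtain m where "n = Suc m" by (cases n) (auto simp: D_0)
    with n show "g w \<in> U" by (auto simp: D_Suc U_def)
  next
    assume "g w \<in> U"
    then obtain n where "g w \<in> D n" by (auto simp: U_def)
    then have "w \<in> D (Suc n)" using that CE EN by (auto simp: D_Suc)
    then show "w \<in> U" by (auto simp: U_def)
  qed
  define h where "h w = (if w \<in> U then f w else w)" for w
  define k where "k w = (if w \<in> C \<inter> U then g w else w)" for w
  have "h \<in> measurable N N" "k \<in> measurable N N"
    unfolding h_def[abs_def] k_def[abs_def] by measurable
  moreover have "h w \<in> C \<and> k (h w) = w" if "w \<in> E" for w
  proof (cases "w \<in> U")
    case True
    have w: "w \<in> space N" using that EN by auto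
    then have "f w \<in> C" "g (f w) = w" using fC gf by auto
    then show ?thesis using True U_C[of "f w"] by (simp add: h_def k_def)
  next
    case False
    then have "w \<notin> D 0" by (auto simp: U_def)
    then have "w \<in> C" using that by (simp add: D_0)
    then show ?thesis using False by (simp add: h_def k_def)
  qed
  moreover have "k w \<in> E \<and> h (k w) = w" if "w \<in> C" for w
    using that U_C[OF that] U_E CE fg[OF that] by (auto simp: h_def k_def)
  ultimately show ?thesis by blast
qed

text \<open>Countable separation makes the set where two measurable maps agree measurable. This is
  what permits almost everywhere identities on the product to be proved fibre by fibre.\<close>

definition point_separating :: "'a measure \<Rightarrow> 'a set set \<Rightarrow> bool" where
  "point_separating N \<B> \<longleftrightarrow> countable \<B> \<and> \<B> \<subseteq> sets N \<and>
     (\<forall>x\<in>space N. \<forall>y\<in>space N. (\<forall>B\<in>\<B>. x \<in> B \<longleftrightarrow> y \<in> B) \<longrightarrow> x = y)"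

lemma point_separating_eq_sets:
  assumes B: "point_separating N \<B>" and u: "u \<in> measurable L N" and v: "v \<in> measurable L N"
  shows "{w \<in> space L. u w = v w} \<in> sets L"
proof -
  have "{w \<in> space L. u w = v w} =
      space L \<inter> (\<Inter>A\<in>\<B>. ((u -` A \<inter> space L) \<inter> (v -` A \<inter> space L)) \<union>
          ((space L - (u -` A \<inter> space L)) \<inter> (space L - (v -` A \<inter> space L))))"
    (is "?l = space L \<inter> (\<Inter>A\<in>\<B>. ?S A)")
  proof (intro equalityI subsetI)
    fix w assume w: "w \<in> space L \<inter> (\<Inter>A\<in>\<B>. ?S A)"
    then have "\<forall>A\<in>\<B>. u w \<in> A \<longleftrightarrow> v w \<in> A" by blast
    moreover have "u w \<in> space N" "v w \<in> space N" using w u v by (auto dest: measurable_space)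
    ultimately have "u w = v w" using B by (auto simp: point_separating_def)
    then show "w \<in> ?l" using w by simp
  qed auto
  also have "\<dots> \<in> sets L"
  proof (cases "\<B> = {}")
    case False
    have "?S A \<in> sets L" if "A \<in> \<B>" for A
      using that B measurable_sets[OF u, of A] measurable_sets[OF v, of A] by
          (auto simp: point_separating_def)
    then have "(\<Inter>A\<in>\<B>. ?S A) \<in> sets L"
      using B False by (intro sets.countable_INT') (auto simp: point_separating_def)
    then show ?thesis by auto
  qed simp
  finally show ?thesis .
qed

lemma point_separating_pair:
  assumes B: "point_separating N \<B>" and C: "point_separating L \<C>"
  shows "point_separating (N \<Otimes>\<^sub>M L) ((\<lambda>A. A \<times> space L) ` \<B> \<union> (\<lambda>A. space N \<times> A) ` \<C>)"
  unfolding point_separating_def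
proof (intro conjI ballI impI)
  let ?A = "(\<lambda>A. A \<times> space L) ` \<B> \<union> (\<lambda>A. space N \<times> A) ` \<C>"
  show "countable ?A" using assms by (auto simp: point_separating_def)
  show "?A \<subseteq> sets (N \<Otimes>\<^sub>M L)" using assms by (auto simp: point_separating_def subset_eq)
  fix x y assume x: "x \<in> space (N \<Otimes>\<^sub>M L)" and y: "y \<in> space (N \<Otimes>\<^sub>M L)" and eq: "\<forall>B\<in>?A. x \<in> B \<longleftrightarrow>
      y \<in> B"
  obtain a b c d where xy: "x = (a, b)" "y = (c, d)" by (cases x, cases y)
  have sp: "a \<in> space N" "b \<in> space L" "c \<in> space N" "d \<in> space L"
    using x y by (auto simp: xy space_pair_measure)
  have "\<forall>A\<in>\<B>. a \<in> A \<longleftrightarrow> c \<in> A"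
  proof
    fix A assume "A \<in> \<B>"
    then have "x \<in> A \<times> space L \<longleftrightarrow> y \<in> A \<times> space L" using eq by blast
    then show "a \<in> A \<longleftrightarrow> c \<in> A" using sp by (simp add: xy)
  qed
  then have "a = c" using B sp by (simp add: point_separating_def)
  have "\<forall>A\<in>\<C>. b \<in> A \<longleftrightarrow> d \<in> A"
  proof
    fix A assume "A \<in> \<C>"
    then have "x \<in> space N \<times> A \<longleftrightarrow> y \<in> space N \<times> A" using eq by blast
    then show "b \<in> A \<longleftrightarrow> d \<in> A" using sp by (simp add: xy)
  qed
  then have "b = d" using C sp by (simp add: point_separating_def)
  with \<open>a = c\<close> show "x = y" by (simp add: xy)
qed

text \<open>The set where \<open>F\<close> and \<open>G\<close> fail to be inverse to each other is enlarged by the null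
  set \<open>C\<close>; both enlarged exceptional sets are Borel isomorphic to \<open>C\<close>.\<close>

lemma automorphism_completion:
  assumes F: "F \<in> measurable N N" and G: "G \<in> measurable N N" and dF: "distr N N F = N"
    and GF: "AE w in N. G (F w) = w" and FG: "AE w in N. F (G w) = w"
    and sep: "point_separating N \<B>"
    and f: "f \<in> measurable N N" and g: "g \<in> measurable N N"
    and gf: "\<And>w. w \<in> space N \<Longrightarrow> g (f w) = w" and fC: "f ` space N = C" and C: "C \<in> null_sets N"
  shows "\<exists>p\<in>inv_mp N. AE w in N. p w = F w"
proof -
  note FN = measurable_space[OF F] and GN = measurable_space[OF G]
  have C_sets: "C \<in> sets N" using C by auto
  have CN: "C \<subseteq> space N" using C_sets by (rule sets.sets_into_space)
  define A0 where "A0 = {w \<in> space N. G (F w) = w}"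
  \<comment> \<open>C and its preimage are removed so that C is disjoint from both \<open>A\<close>
    and \<open>B\<close>; \<open>F\<close> then maps \<open>A\<close> bijectively onto
    \<open>B\<close>.\<close>
  define A where "A = A0 - C - (F -` C \<inter> space N)"
  define B0 where "B0 = {w \<in> space N. F (G w) = w}"
  define B where "B = B0 \<inter> (G -` A \<inter> space N)"
  have A0: "A0 \<in> sets N" unfolding A0_def
    by (rule point_separating_eq_sets[OF sep measurable_compose[OF F G]
        measurable_ident_sets[OF refl]])
  have B0: "B0 \<in> sets N" unfolding B0_def
    by (rule point_separating_eq_sets[OF sep measurable_compose[OF G F]
        measurable_ident_sets[OF refl]])
  have FC: "F -` C \<inter> space N \<in> sets N" by (rule measurable_sets[OF F C_sets])
  have A: "A \<in> sets N" unfolding A_def using A0 C_sets FC by auto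
  have B: "B \<in> sets N" unfolding B_def using B0 measurable_sets[OF G A] by auto
  have FA: "F w \<in> B" "G (F w) = w" if "w \<in> A" for w
    using that FN by (auto simp: A_def A0_def B_def B0_def)
  have GB: "G w \<in> A" "F (G w) = w" if "w \<in> B" for w
    using that by (auto simp: B_def B0_def)
  have AN: "A \<subseteq> space N" and BN: "B \<subseteq> space N" using A B sets.sets_into_space by auto
  have CA: "C \<subseteq> space N - A" using CN by (auto simp: A_def)
  have CB: "C \<subseteq> space N - B"
  proof -
    have "w \<notin> C" if "w \<in> B" for w
    proof
      assume "w \<in> C"
      with GB[OF that] have "F (G w) \<in> C" by simp
      moreover have "F (G w) \<notin> C" using GB(1)[OF that] by (auto simp: A_def A0_def)
      ultimately show False by simp
    qed
    then show ?thesis using CN by auto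
  qed
  obtain h k where h: "h \<in> measurable N N" and k: "k \<in> measurable N N"
    and hk: "\<And>w. w \<in> space N - A \<Longrightarrow> h w \<in> C \<and> k (h w) = w" "\<And>w. w \<in> C \<Longrightarrow> k w \<in> space N - A \<and> h (k w) =
        w"
    using borel_schroeder_bernstein[OF f g gf fC C_sets sets.Diff[OF sets.top A] CA] by blast
  obtain h' k' where h': "h' \<in> measurable N N" and k': "k' \<in> measurable N N"
    and hk': "\<And>w. w \<in> space N - B \<Longrightarrow> h' w \<in> C \<and> k' (h' w) = w" "\<And>w. w \<in> C \<Longrightarrow> k' w \<in> space N - B \<and>
        h' (k' w) = w"
    using borel_schroeder_bernstein[OF f g gf fC C_sets sets.Diff[OF sets.top B] CB] by blast
  \<comment> \<open>Outside \<open>A\<close> the map runs through C: \<open>h\<close> takes the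
    complement of \<open>A\<close> onto C, and \<open>k'\<close> takes C onto the complement of
    \<open>B\<close>.\<close>
  define p where "p w = (if w \<in> A then F w else k' (h w))" for w
  define r where "r w = (if w \<in> B then G w else k (h' w))" for w
  have pm: "p \<in> measurable N N"
    unfolding p_def[abs_def] by (rule measurable_If_set[OF F measurable_compose[OF h k']])
        (use A AN in \<open>simp add: Int_absorb2\<close>)
  have rm: "r \<in> measurable N N"
    unfolding r_def[abs_def] by (rule measurable_If_set[OF G measurable_compose[OF h' k]])
        (use B BN in \<open>simp add: Int_absorb2\<close>)
  have "AE w in N. w \<in> A"
  proof -
    have "AE w in N. w \<notin> C" using C by (rule AE_not_in)
    moreover have "AE w in N. F w \<notin> C"
    proof (rule AE_distrD[OF F])
      show "AE w in distr N N F. w \<notin> C" unfolding dF using C by (rule AE_not_in)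
    qed
    moreover have "AE w in N. w \<in> space N" by (rule AE_space)
    ultimately show ?thesis using GF
      by eventually_elim (simp add: A_def A0_def)
  qed
  then have ae: "AE w in N. p w = F w"
    by eventually_elim (simp add: p_def)
  have "distr N N p = distr N N F"
    using pm F ae by (intro distr_cong_AE) auto
  then have "distr N N p = N" using dF by simp
  moreover have "r (p w) = w" if "w \<in> space N" for w
    using that FA[of w] hk(1)[of w] hk'(2)[of "h w"] by (auto simp: p_def r_def)
  moreover have "p (r w) = w" if "w \<in> space N" for w
    using that GB[of w] hk'(1)[of w] hk(2)[of "h' w"] by (auto simp: p_def r_def)
  ultimately have "p \<in> inv_mp N"
    using pm rm by (intro inv_mpI[where g=r])
  with ae show ?thesis by blast
qed

lemma unit_interval_point_separating: "\<exists>\<B>. point_separating unit_interval \<B>"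
proof -
  let ?B = "(\<lambda>r. {0..r} \<inter> {0..1}) ` (\<rat> :: real set)"
  have "point_separating unit_interval ?B"
    unfolding point_separating_def
  proof (intro conjI ballI impI)
    show "countable ?B" by (intro countable_image countable_rat)
    show "?B \<subseteq> sets unit_interval" by (auto simp: sets_unit_interval_iff)
    fix x y :: real
    assume xy: "x \<in> space unit_interval" "y \<in> space unit_interval" and eq: "\<forall>B\<in>?B. x \<in> B \<longleftrightarrow> y \<in> B"
    have "x \<le> r \<longleftrightarrow> y \<le> r" if "r \<in> \<rat>" for r
      using eq that xy by auto
    moreover have "\<exists>r\<in>\<rat>. a < r \<and> r < b" if "a < b" for a b :: real
      using Rats_dense_in_real[OF that] by blast
    ultimately show "x = y" by (metis linorder_neqE less_le_not_le order.strict_trans1 not_less)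
  qed
  then show ?thesis by blast
qed

section \<open>Realising a measurable field as a skew product\<close>

context
  fixes M :: "'a measure" and T :: "'a \<Rightarrow> 'a" and \<B> :: "'a set set"
  assumes prob: "prob_space M" and T: "T \<in> inv_mp M" and sep: "point_separating M \<B>"
begin

interpretation M: prob_space M by (rule prob)
interpretation P: pair_prob_space M unit_interval ..

lemma product_point_separating: "\<exists>\<C>. point_separating (M \<Otimes>\<^sub>M unit_interval) \<C>"
  using unit_interval_point_separating point_separating_pair[OF sep] by blast

text \<open>Measurable versions of the fibre maps and of their inverses give \<open>F\<close> and
  \<open>G\<close>, inverse to each other almost everywhere. \<open>F\<close> preserves measure by
  integration over fibres on rectangles, and the completion replaces it by a genuine
  bijection.\<close>

lemma skew_realization:
  assumes s: "measurable_field M s"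
  shows "\<exists>p\<in>inv_mp (M \<Otimes>\<^sub>M unit_interval). AE x in M. AE u in unit_interval. p (x, u) = (T x, s x u)"
proof -
  let ?N = "M \<Otimes>\<^sub>M unit_interval"
  define R where "R = the_inv_into (space M) T"
  have R: "R \<in> inv_mp M" "\<And>x. x \<in> space M \<Longrightarrow> R (T x) = x" "\<And>x. x \<in> space M \<Longrightarrow> T (R x) = x"
    using inv_mp_inverse[OF T] by (auto simp: R_def)
  note TR_space = inv_mp_space[OF T] inv_mp_space[OF R(1)]
  have s_inv: "s x \<in> inv_mp unit_interval" if "x \<in> space M" for x
    using s that by (auto simp: measurable_field_def)
  obtain a where a: "a \<in> measurable ?N unit_interval"
    "\<And>x. x \<in> space M \<Longrightarrow> AE u in unit_interval. a (x, u) = s x u"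
    using realize_field[OF s] by blast
  obtain b where b: "b \<in> measurable ?N unit_interval"
    "\<And>x. x \<in> space M \<Longrightarrow> AE v in unit_interval. b (x, v) = inv_I (s x) v"
    using realize_inverse[OF s] by blast
  note [measurable] = a(1) b(1) inv_mpD(1)[OF T] inv_mpD(1)[OF R(1)]
  define F where "F w = (T (fst w), a w)" for w
  define G where "G w = (R (fst w), b (R (fst w), snd w))" for w
  have F: "F \<in> measurable ?N ?N" unfolding F_def[abs_def] by measurable
  have G: "G \<in> measurable ?N ?N" unfolding G_def[abs_def] by measurable
  obtain \<C> where sepN: "point_separating ?N \<C>" using product_point_separating by blast
  have GF: "AE w in ?N. G (F w) = w"
  proof (rule P.AE_pair_measure)
    show "{w \<in> space ?N. G (F w) = w} \<in> sets ?N"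
      by (rule point_separating_eq_sets[OF sepN measurable_compose[OF F G]
          measurable_ident_sets[OF refl]])
    show "AE x in M. AE u in unit_interval. G (F (x, u)) = (x, u)"
    proof (rule AE_I2)
      fix x assume x: "x \<in> space M"
      note f = s_inv[OF x]
      show "AE u in unit_interval. G (F (x, u)) = (x, u)"
        using a(2)[OF x] inv_mp_AE[OF f b(2)[OF x]] AE_space
      proof eventually_elim
        fix u assume "a (x, u) = s x u" "b (x, s x u) = inv_I (s x) (s x u)"
            "u \<in> space unit_interval"
        then show "G (F (x, u)) = (x, u)"
          using R(2)[OF x] inv_I(2)[OF f, of u] by (simp add: F_def G_def)
      qed
    qed
  qed
  have FG: "AE w in ?N. F (G w) = w"
  proof (rule P.AE_pair_measure)
    show "{w \<in> space ?N. F (G w) = w} \<in> sets ?N"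
      by (rule point_separating_eq_sets[OF sepN measurable_compose[OF G F]
          measurable_ident_sets[OF refl]])
    show "AE x in M. AE u in unit_interval. F (G (x, u)) = (x, u)"
    proof (rule AE_I2)
      fix y assume y: "y \<in> space M"
      then have x: "R y \<in> space M" by (rule TR_space)
      note f = s_inv[OF x]
      show "AE u in unit_interval. F (G (y, u)) = (y, u)"
        using b(2)[OF x] inv_mp_AE[OF inv_I(1)[OF f] a(2)[OF x]] AE_space
      proof eventually_elim
        fix u assume "b (R y, u) = inv_I (s (R y)) u"
          "a (R y, inv_I (s (R y)) u) = s (R y) (inv_I (s (R y)) u)" "u \<in> space unit_interval"
        then show "F (G (y, u)) = (y, u)"
          using R(3)[OF y] inv_I(3)[OF f, of u] by (simp add: F_def G_def)
      qed
    qed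
  qed
  have dF: "distr ?N ?N F = ?N"
  proof (rule pair_measure_eqI[symmetric])
    show "sigma_finite_measure M" "sigma_finite_measure unit_interval"
      by (rule M.sigma_finite_measure_axioms unit_interval.sigma_finite_measure_axioms)+
    fix A B assume A: "A \<in> sets M" and B: "B \<in> sets unit_interval"
    have AB: "A \<times> B \<in> sets ?N" using A B by auto
    have "emeasure (distr ?N ?N F) (A \<times> B) = emeasure ?N (F -` (A \<times> B) \<inter> space ?N)"
      by (rule emeasure_distr[OF F AB])
    also have "\<dots> = (\<integral>\<^sup>+x. emeasure unit_interval (Pair x -` (F -` (A \<times> B) \<inter> space ?N)) \<partial>M)"
      by (rule unit_interval.emeasure_pair_measure_alt[OF measurable_sets[OF F AB]])
    also have "\<dots> = (\<integral>\<^sup>+x. emeasure unit_interval B * indicator (T -` A \<inter> space M) x \<partial>M)"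
    proof (rule nn_integral_cong)
      fix x assume x: "x \<in> space M"
      note f = s_inv[OF x]
      have sets1: "Pair x -` (F -` (A \<times> B) \<inter> space ?N) \<in> sets unit_interval"
        by (rule sets_Pair1[OF measurable_sets[OF F AB]])
      show "emeasure unit_interval (Pair x -` (F -` (A \<times> B) \<inter> space ?N)) =
        emeasure unit_interval B * indicator (T -` A \<inter> space M) x"
      proof (cases "T x \<in> A")
        case True
        have "emeasure unit_interval (Pair x -` (F -` (A \<times> B) \<inter> space ?N)) =
            emeasure unit_interval (s x -` B \<inter> space unit_interval)"
        proof (rule emeasure_eq_AE[OF _ sets1 inv_mp_vimage(1)[OF f B]])
          show "AE u in unit_interval. u \<in> Pair x -` (F -` (A \<times> B) \<inter> space ?N) \<longleftrightarrow>
              u \<in> s x -` B \<inter> space unit_interval"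
            using a(2)[OF x] AE_space
          proof eventually_elim
            fix u assume "a (x, u) = s x u" "u \<in> space unit_interval"
            then show "u \<in> Pair x -` (F -` (A \<times> B) \<inter> space ?N) \<longleftrightarrow> u \<in> s x -` B \<inter> space unit_interval"
              using x True by (simp add: F_def space_pair_measure)
          qed
        qed
        also have "\<dots> = emeasure unit_interval B"
          using inv_mp_vimage(2)[OF f B] by (simp add: unit_interval.emeasure_eq_measure)
        finally show ?thesis using True x by simp
      next
        case False
        then have "Pair x -` (F -` (A \<times> B) \<inter> space ?N) = {}" by (auto simp: F_def)
        then show ?thesis using False by simp
      qed
    qed
    also have "\<dots> = emeasure unit_interval B * emeasure M (T -` A \<inter> space M)"
      using inv_mp_vimage(1)[OF T A] by (rule nn_integral_cmult_indicator)
    also have "emeasure M (T -` A \<inter> space M) = emeasure M A"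
      using inv_mp_vimage(2)[OF T A] by (simp add: M.emeasure_eq_measure)
    finally show "emeasure M A * emeasure unit_interval B = emeasure (distr ?N ?N F) (A \<times> B)"
      by (simp add: mult.commute)
  qed simp
  obtain \<theta> \<psi> :: "real \<Rightarrow> real" and C :: "real set" where
    \<theta>: "\<theta> \<in> measurable unit_interval unit_interval" "\<psi> \<in> measurable unit_interval unit_interval"
    "C \<in> null_sets unit_interval" "\<theta> ` {0..1} = C" "\<And>u. u \<in> {0..1} \<Longrightarrow> \<psi> (\<theta> u) = u"
    by (rule ex_null_copy) blast
  note [measurable] = \<theta>(1,2)
  have "\<exists>p\<in>inv_mp ?N. AE w in ?N. p w = F w"
  \<comment> \<open>Compressing only the fibre coordinate embeds the whole product in the null set
    formed by \<open>space M\<close> and \<open>C\<close>.\<close>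
  proof (rule automorphism_completion[OF F G dF GF FG sepN])
    show "(\<lambda>w. (fst w, \<theta> (snd w))) \<in> measurable ?N ?N" by measurable
    show "(\<lambda>w. (fst w, \<psi> (snd w))) \<in> measurable ?N ?N" by measurable
    show "(\<lambda>w. (fst w, \<theta> (snd w))) ` space ?N = space M \<times> C"
      unfolding \<theta>(4)[symmetric] by (force simp: space_pair_measure image_iff)
    show "space M \<times> C \<in> null_sets ?N"
    proof (rule null_setsI)
      have "C \<in> sets unit_interval" using \<theta>(3) by auto
      then show "space M \<times> C \<in> sets ?N" "emeasure ?N (space M \<times> C) = 0"
        using \<theta>(3) by (auto simp: unit_interval.emeasure_pair_measure_Times)
    qed
  qed (auto simp: space_pair_measure \<theta>(5))
  then obtain p where p: "p \<in> inv_mp ?N" "AE w in ?N. p w = F w" by blast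
  have "AE x in M. AE u in unit_interval. p (x, u) = F (x, u)"
    using P.AE_pair[OF p(2)] .
  with AE_space have "AE x in M. AE u in unit_interval. p (x, u) = (T x, s x u)"
  proof eventually_elim
    fix x assume x: "x \<in> space M" and "AE u in unit_interval. p (x, u) = F (x, u)"
    from this(2) a(2)[OF x] show "AE u in unit_interval. p (x, u) = (T x, s x u)"
      by eventually_elim (simp add: F_def)
  qed
  with p(1) show ?thesis by blast
qed

end

section \<open>The automorphism group and continuity of finite entropies\<close>

definition ae_class :: "'a measure \<Rightarrow> ('a \<Rightarrow> 'b) set \<Rightarrow> ('a \<Rightarrow> 'b) \<Rightarrow> ('a \<Rightarrow> 'b) set" where
  "ae_class M F f = {g \<in> F. AE x in M. f x = g x}"

lemma ae_quotient_eq: "F // ae_rel M F = ae_class M F ` F"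
  unfolding quotient_def ae_class_def ae_rel_def by (auto simp: Image_def)

lemma ae_class_self: "f \<in> F \<Longrightarrow> f \<in> ae_class M F f"
  by (simp add: ae_class_def)

lemma ae_class_eq:
  assumes "AE x in M. f x = g x"
  shows "ae_class M F f = ae_class M F g"
proof -
  have "(AE x in M. f x = h x) \<longleftrightarrow> (AE x in M. g x = h x)" for h
  proof
    assume "AE x in M. f x = h x"
    with assms show "AE x in M. g x = h x" by eventually_elim simp
  next
    assume "AE x in M. g x = h x"
    with assms show "AE x in M. f x = h x" by eventually_elim simp
  qed
  then show ?thesis by (simp add: ae_class_def)
qed

lemma ae_quotientD:
  assumes "C \<in> F // ae_rel M F" and "f \<in> C"
  shows "f \<in> F" "C = ae_class M F f"
proof -
  from assms(1) obtain g where "g \<in> F" "C = ae_class M F g" by (auto simp: ae_quotient_eq)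
  with assms(2) show "f \<in> F" "C = ae_class M F f"
    using ae_class_eq[of g f M F] by (auto simp: ae_class_def)
qed

lemma ae_quotient_nonempty: "C \<in> F // ae_rel M F \<Longrightarrow> C \<noteq> {}"
  by (auto simp: ae_quotient_eq dest: ae_class_self)

text \<open>The identity as default puts every \<open>repr M q\<close> in \<open>inv_mp M\<close>,
  so statements about limits need no side condition; on \<open>Aut M\<close> the choice is the one
  made by \<open>Aut_entropy\<close>.\<close>

definition repr :: "'a measure \<Rightarrow> ('a \<Rightarrow> 'a) set \<Rightarrow> 'a \<Rightarrow> 'a" where
  "repr M q = (if q \<in> Aut M then SOME f. f \<in> q else (\<lambda>x. x))"

lemma repr_in: "q \<in> Aut M \<Longrightarrow> repr M q \<in> q"
  using ae_quotient_nonempty[of q] some_in_eq[of q] by (auto simp: repr_def Aut_def)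

lemma AutD:
  assumes "q \<in> Aut M" "f \<in> q"
  shows "f \<in> inv_mp M" "q = ae_class M (inv_mp M) f"
  using ae_quotientD[of q "inv_mp M" M f] assms by (auto simp: Aut_def)

lemma Aut_AE: "q \<in> Aut M \<Longrightarrow> f \<in> q \<Longrightarrow> g \<in> q \<Longrightarrow> AE x in M. f x = g x"
  using AutD(2)[of q M f] by (auto simp: ae_class_def)

lemma ae_class_Aut: "f \<in> inv_mp M \<Longrightarrow> ae_class M (inv_mp M) f \<in> Aut M"
  by (auto simp: Aut_def ae_quotient_eq)

lemma repr_inv_mp: "repr M q \<in> inv_mp M"
  using AutD(1)[OF _ repr_in, of q M] by (cases "q \<in> Aut M") (auto simp: repr_def)

text \<open>For almost every x the two maps agree at the preimage of x under \<open>f\<close>. By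
  injectivity both memberships then say that this preimage lies in A.\<close>

lemma inv_mp_image_AE_cong:
  assumes f: "f \<in> inv_mp M" and g: "g \<in> inv_mp M" and eq: "AE x in M. f x = g x" and A: "A \<in> sets M"
  shows "AE x in M. x \<in> f ` A \<longleftrightarrow> x \<in> g ` A"
proof -
  note fi = inv_mp_inverse[OF f] and gi = inv_mp_inverse[OF g]
  have AM: "A \<subseteq> space M" using A by (rule sets.sets_into_space)
  have "AE x in M. f (the_inv_into (space M) f x) = g (the_inv_into (space M) f x)"
    by (rule inv_mp_AE[OF fi(1) eq])
  with AE_space show ?thesis
  proof eventually_elim
    fix x assume x: "x \<in> space M" and e: "f (the_inv_into (space M) f x) =
        g (the_inv_into (space M) f x)"
    let ?y = "the_inv_into (space M) f x"
    have y: "?y \<in> space M" "f ?y = x" "g ?y = x"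
      using x e fi(3) inv_mp_space[OF fi(1)] by auto
    have "x \<in> h ` A \<longleftrightarrow> ?y \<in> A" if h: "h \<in> inv_mp M" and hy: "h ?y = x" for h
    proof
      assume "x \<in> h ` A"
      then obtain z where z: "z \<in> A" "h z = h ?y" unfolding hy by blast
      then have "z = ?y" using inv_mpD(2)[OF h] AM y(1) by (auto simp: bij_betw_def dest: inj_onD)
      with z show "?y \<in> A" by simp
    next
      assume "?y \<in> A"
      then show "x \<in> h ` A" using hy by (intro image_eqI[of x h ?y]) simp_all
    qed
    from this[OF f y(2)] this[OF g y(3)] show "x \<in> f ` A \<longleftrightarrow> x \<in> g ` A" by simp
  qed
qed

lemma measure_sym_diff_triangle:
  assumes "finite_measure M" "A \<in> sets M" "B \<in> sets M" "C \<in> sets M"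
  shows "measure M (sym_diff A C) \<le> measure M (sym_diff A B) + measure M (sym_diff B C)"
proof -
  interpret finite_measure M by fact
  have "measure M (sym_diff A C) \<le> measure M (sym_diff A B \<union> sym_diff B C)"
    using assms by (intro finite_measure_mono) auto
  also have "\<dots> \<le> measure M (sym_diff A B) + measure M (sym_diff B C)"
    using assms by (intro measure_Un_le) auto
  finally show ?thesis .
qed

lemma measure_sym_diff_cong:
  assumes f: "f \<in> inv_mp M" and g: "g \<in> inv_mp M" and eq: "AE x in M. f x = g x"
    and A: "A \<in> sets M" and B: "B \<in> sets M"
  shows "measure M (sym_diff (f ` A) B) = measure M (sym_diff (g ` A) B)"
  using inv_mp_image_AE_cong[OF f g eq A] inv_mp_image(1)[OF f A] inv_mp_image(1)[OF g A] B
  by (intro measure_eq_AE) auto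

lemma topspace_Aut_top: "topspace (Aut_top M) = Aut M"
proof -
  let ?S = "{{q \<in> Aut M. \<exists>f\<in>q. measure M (sym_diff (f ` A) (g ` A)) < e} | g A e.
        g \<in> inv_mp M \<and> A \<in> sets M \<and> (0::real) < e}"
  have "\<Union>?S = Aut M"
  proof (intro equalityI subsetI)
    fix q assume q: "q \<in> Aut M"
    \<comment> \<open>The empty set with radius 1 gives a subbasic set that is all of
      \<open>Aut M\<close>.\<close>
    have "q \<in> {q \<in> Aut M. \<exists>f\<in>q. measure M (sym_diff (f ` {}) ((\<lambda>x. x) ` {})) < 1}"
      using q repr_in[OF q] by auto
    then show "q \<in> \<Union>?S"
      by (intro UnionI[of "{q \<in> Aut M. \<exists>f\<in>q. measure M (sym_diff (f ` {}) ((\<lambda>x. x) ` {})) < 1}"]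
          CollectI exI[of _ "\<lambda>x. x"] exI[of _ "{}"] exI[of _ 1] conjI refl) auto
  qed auto
  then show ?thesis by (simp add: Aut_top_def)
qed

text \<open>Finite intersections and unions preserve the claim, so only subbasic balls matter; their
  centres are arbitrary, and the triangle inequality moves them to \<open>f\<close>.\<close>

lemma limitin_Aut_topI:
  assumes fin: "finite_measure M" and q: "q \<in> Aut M" and f: "f \<in> q"
    and qs: "\<And>i. qs i \<in> Aut M" and fs: "\<And>i. fs i \<in> qs i"
    and lim: "\<And>A. A \<in> sets M \<Longrightarrow> ((\<lambda>i. measure M (sym_diff (fs i ` A) (f ` A))) \<longlongrightarrow> 0) F"
  shows "limitin (Aut_top M) qs q F"
  unfolding limitin_def
proof (intro conjI allI impI)
  show "q \<in> topspace (Aut_top M)" using q by (simp add: topspace_Aut_top)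
  fix U assume U: "openin (Aut_top M) U \<and> q \<in> U"
  let ?S = "{{q \<in> Aut M. \<exists>f\<in>q. measure M (sym_diff (f ` A) (g ` A)) < e} | g A e.
        g \<in> inv_mp M \<and> A \<in> sets M \<and> (0::real) < e}"
  have "generate_topology_on ?S U"
    using U unfolding Aut_top_def by (simp add: openin_topology_generated_by_iff)
  then have "q \<in> U \<longrightarrow> (\<forall>\<^sub>F i in F. qs i \<in> U)"
  proof (induction rule: generate_topology_on.induct)
    case Empty then show ?case by simp
  next
    case (Int a b) then show ?case by (auto intro: eventually_conj)
  next
    case (UN K)
    show ?case
    proof
      assume "q \<in> \<Union>K"
      then obtain k where "k \<in> K" "q \<in> k" by blast
      then have "\<forall>\<^sub>F i in F. qs i \<in> k" using UN by blast
      then show "\<forall>\<^sub>F i in F. qs i \<in> \<Union>K" by eventually_elim (use \<open>k \<in> K\<close> in blast)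
    qed
  next
    case (Basis s)
    then obtain g A e where s: "s = {q \<in> Aut M. \<exists>f\<in>q. measure M (sym_diff (f ` A) (g ` A)) < e}"
      and g: "g \<in> inv_mp M" and A: "A \<in> sets M" and e: "0 < e" by blast
    show ?case
    proof
      assume "q \<in> s"
      then obtain f' where f': "f' \<in> q" "measure M (sym_diff (f' ` A) (g ` A)) < e" by
          (auto simp: s)
      have gA: "g ` A \<in> sets M" by (rule inv_mp_image[OF g A])
      have "measure M (sym_diff (f ` A) (g ` A)) < e"
        using f'(2) measure_sym_diff_cong[OF AutD(1)[OF q f] AutD(1)[OF q f'(1)]
            Aut_AE[OF q f f'(1)] A gA] by simp
      then have "0 < e - measure M (sym_diff (f ` A) (g ` A))" by simp
      then have "\<forall>\<^sub>F i in F. measure M (sym_diff (fs i ` A) (f ` A)) <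
          e - measure M (sym_diff (f ` A) (g ` A))"
        using lim[OF A] by (intro order_tendstoD)
      then show "\<forall>\<^sub>F i in F. qs i \<in> s"
      proof eventually_elim
        fix i assume *: "measure M (sym_diff (fs i ` A) (f ` A)) <
            e - measure M (sym_diff (f ` A) (g ` A))"
        have "measure M (sym_diff (fs i ` A) (g ` A)) \<le>
            measure M (sym_diff (fs i ` A) (f ` A)) + measure M (sym_diff (f ` A) (g ` A))"
          by (intro measure_sym_diff_triangle[OF fin] gA inv_mp_image[OF AutD(1)[OF q f] A]
              inv_mp_image[OF AutD(1)[OF qs fs] A])
        with * have "measure M (sym_diff (fs i ` A) (g ` A)) < e" by simp
        then show "qs i \<in> s" using qs fs unfolding s by blast
      qed
    qed
  qed
  then show "\<forall>\<^sub>F i in F. qs i \<in> U" using U by blast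
qed

lemma tendsto_repr:
  assumes q: "q \<in> Aut M" and A: "A \<in> sets M"
  shows "((\<lambda>r. measure M (sym_diff (repr M r ` A) (repr M q ` A))) \<longlongrightarrow> 0) (atin (Aut_top M) q)"
proof (rule tendstoI)
  fix e :: real assume e: "0 < e"
  let ?U = "{r \<in> Aut M. \<exists>f\<in>r. measure M (sym_diff (f ` A) (repr M q ` A)) < e}"
  have "openin (Aut_top M) ?U"
    unfolding Aut_top_def
    by (rule topology_generated_by_Basis)
       (use repr_inv_mp[of M q] A e in blast)
  moreover have "q \<in> ?U" using q repr_in[OF q] e by force
  moreover have "dist (measure M (sym_diff (repr M r ` A) (repr M q ` A))) 0 < e" if "r \<in> ?U" for r
  proof -
    from that obtain f where r: "r \<in> Aut M" and f: "f \<in> r"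
        "measure M (sym_diff (f ` A) (repr M q ` A)) < e" by blast
    have qA: "repr M q ` A \<in> sets M" by (rule inv_mp_image[OF repr_inv_mp A])
    have "measure M (sym_diff (repr M r ` A) (repr M q ` A)) < e"
      using f(2) measure_sym_diff_cong[OF repr_inv_mp AutD(1)[OF r f(1)] Aut_AE[OF r repr_in[OF r]
          f(1)] A qA] by simp
    then show ?thesis by simp
  qed
  ultimately show "\<forall>\<^sub>F r in atin (Aut_top M) q.
      dist (measure M (sym_diff (repr M r ` A) (repr M q ` A))) 0 < e"
    unfolding eventually_atin by blast
qed

lemma tendsto_0_le_measure:
  assumes "\<And>i. measure M (A i) \<le> b i" and "(b \<longlongrightarrow> 0) F"
  shows "((\<lambda>i. measure M (A i)) \<longlongrightarrow> 0) F"
  by (rule Lim_null_comparison[OF always_eventually assms(2)]) (use assms(1) in simp)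

text \<open>The topology controls images under one application, itineraries need preimages under
  powers. With B the preimage of A under \<open>f\<close>, applying \<open>fs i\<close> turns the
  difference of the two preimages of A into that of the images of B under \<open>f\<close> and
  \<open>fs i\<close>; invariance under powers of \<open>fs i\<close> carries this through the
  induction.\<close>

lemma tendsto_vimage_funpow:
  assumes fin: "finite_measure M" and f: "f \<in> inv_mp M" and fs: "\<And>i. fs i \<in> inv_mp M"
    and lim: "\<And>A. A \<in> sets M \<Longrightarrow> ((\<lambda>i. measure M (sym_diff (fs i ` A) (f ` A))) \<longlongrightarrow> 0) F"
    and A: "A \<in> sets M"
  shows "((\<lambda>i. measure M (sym_diff ((fs i ^^ n) -` A \<inter> space M) ((f ^^ n) -` A \<inter> space M))) \<longlongrightarrow> 0) F"
  using A
proof (induction n arbitrary: A)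
  case 0 then show ?case by simp
next
  case (Suc n)
  let ?B = "f -` A \<inter> space M"
  have B: "?B \<in> sets M" by (rule inv_mp_vimage[OF f Suc.prems])
  note fB = inv_mp_image_vimage(1)[OF f Suc.prems]
  have vn: "(g ^^ n) -` C \<inter> space M \<in> sets M" if "g \<in> inv_mp M" "C \<in> sets M" for g C
    by (rule inv_mp_vimage[OF inv_mp_funpow[OF that(1)] that(2)])
  have pow: "(g ^^ Suc n) -` A \<inter> space M = (g ^^ n) -` (g -` A \<inter> space M) \<inter> space M" if
      "g \<in> inv_mp M" for g
    using inv_mp_space[OF inv_mp_funpow[OF that, of n]] by auto
  have vim: "fs i -` A \<inter> space M \<in> sets M" for i by (rule inv_mp_vimage[OF fs Suc.prems])
  have "measure M (sym_diff ((fs i ^^ Suc n) -` A \<inter> space M) ((f ^^ Suc n) -` A \<inter> space M)) \<le>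
      measure M (sym_diff (fs i ` ?B) (f ` ?B)) +
      measure M (sym_diff ((fs i ^^ n) -` ?B \<inter> space M) ((f ^^ n) -` ?B \<inter> space M))" for i
  proof -
    have "measure M (sym_diff ((fs i ^^ n) -` (fs i -` A \<inter> space M) \<inter> space M) ((fs i ^^ n) -` ?B \<inter>
        space M)) =
        measure M ((fs i ^^ n) -` (sym_diff (fs i -` A \<inter> space M) ?B) \<inter> space M)"
      by (rule arg_cong[where f="measure M"]) auto
    also have "\<dots> = measure M (sym_diff (fs i -` A \<inter> space M) ?B)"
      using vim B by (intro inv_mp_vimage(2)[OF inv_mp_funpow[OF fs]]) auto
    also have "\<dots> = measure M (fs i ` (sym_diff (fs i -` A \<inter> space M) ?B))"
      using vim B by (intro inv_mp_image(2)[OF fs, symmetric]) auto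
    also have "fs i ` (sym_diff (fs i -` A \<inter> space M) ?B) = sym_diff (fs i ` (fs i -` A \<inter> space M))
        (fs i ` ?B)"
    proof -
      have "inj_on (fs i) (space M)" using inv_mpD(2)[OF fs] by (auto simp: bij_betw_def)
      then have d: "fs i ` (P - Q) = fs i ` P - fs i ` Q" if "P \<subseteq> space M" "Q \<subseteq> space M" for P Q
        using that by (intro inj_on_image_set_diff[of _ "space M"]) auto
      show ?thesis
        unfolding image_Un using d[of "fs i -` A \<inter> space M" ?B] d[of ?B "fs i -` A \<inter> space M"]
            by simp
    qed
    also have "fs i ` (fs i -` A \<inter> space M) = f ` ?B"
      unfolding fB by (rule inv_mp_image_vimage(1)[OF fs Suc.prems])
    finally have 1: "measure M (sym_diff ((fs i ^^ n) -` (fs i -` A \<inter> space M) \<inter> space M)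
        ((fs i ^^ n) -` ?B \<inter> space M)) =
        measure M (sym_diff (fs i ` ?B) (f ` ?B))" by (simp add: Un_commute)
    show ?thesis
      unfolding pow[OF fs] pow[OF f] 1[symmetric]
      by (intro measure_sym_diff_triangle[OF fin] vn fs f vim B)
  qed
  moreover have "((\<lambda>i. measure M (sym_diff (fs i ` ?B) (f ` ?B)) +
      measure M (sym_diff ((fs i ^^ n) -` ?B \<inter> space M) ((f ^^ n) -` ?B \<inter> space M))) \<longlongrightarrow> 0) F"
    using tendsto_add[OF lim[OF B] Suc.IH[OF B]] by simp
  ultimately show ?case
    by (rule tendsto_0_le_measure)
qed

text \<open>Two itineraries of length n differ only on the finitely many symmetric differences of
  preimages of the levels of \<open>X\<close> under powers below n.\<close>

lemma tendsto_label_entropy_itin: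
  assumes prob: "prob_space M" and f: "f \<in> inv_mp M" and fs: "\<And>i. fs i \<in> inv_mp M"
    and lim: "\<And>A. A \<in> sets M \<Longrightarrow> ((\<lambda>i. measure M (sym_diff (fs i ` A) (f ` A))) \<longlongrightarrow> 0) F"
    and X: "simple_function M X"
  shows "((\<lambda>i. label_entropy M (itin (fs i) X n)) \<longlongrightarrow> label_entropy M (itin f X n)) F"
proof -
  interpret prob_space M by (rule prob)
  let ?R = "X ` space M"
  have R: "finite ?R" and Xa: "X -` {a} \<inter> space M \<in> events" for a using simple_functionD[OF X]
      by auto
  let ?S = "\<lambda>i j a. sym_diff ((fs i ^^ j) -` (X -` {a} \<inter> space M) \<inter> space M)
      ((f ^^ j) -` (X -` {a} \<inter> space M) \<inter> space M)"
  have S: "?S i j a \<in> events" for i j a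
    using inv_mp_vimage(1)[OF inv_mp_funpow[OF fs] Xa] inv_mp_vimage(1)[OF inv_mp_funpow[OF f] Xa]
        by auto
  have "prob {w \<in> space M. itin (fs i) X n w \<noteq> itin f X n w} \<le> (\<Sum>j<n. \<Sum>a\<in>?R. prob (?S i j a))" for i
  proof -
    have "{w \<in> space M. itin (fs i) X n w \<noteq> itin f X n w} \<subseteq> (\<Union>j<n. \<Union>a\<in>?R. ?S i j a)"
    proof
      fix w assume "w \<in> {w \<in> space M. itin (fs i) X n w \<noteq> itin f X n w}"
      then obtain j where w: "w \<in> space M" "j < n" "X ((fs i ^^ j) w) \<noteq> X ((f ^^ j) w)"
        by (auto simp: itin_def)
      have sp: "(fs i ^^ j) w \<in> space M" "(f ^^ j) w \<in> space M"
        using w(1) inv_mp_space[OF inv_mp_funpow[OF fs]] inv_mp_space[OF inv_mp_funpow[OF f]]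
            by auto
      then have "w \<in> ?S i j (X ((f ^^ j) w))" using w by auto
      with sp w show "w \<in> (\<Union>j<n. \<Union>a\<in>?R. ?S i j a)" by blast
    qed
    then have "prob {w \<in> space M. itin (fs i) X n w \<noteq> itin f X n w} \<le> prob (\<Union>j<n. \<Union>a\<in>?R. ?S i j a)"
      using S R by (intro finite_measure_mono sets.finite_UN) auto
    also have "\<dots> \<le> (\<Sum>j<n. prob (\<Union>a\<in>?R. ?S i j a))"
      using S R by (intro measure_UNION_le sets.finite_UN) auto
    also have "\<dots> \<le> (\<Sum>j<n. \<Sum>a\<in>?R. prob (?S i j a))"
      using S R by (intro sum_mono measure_UNION_le) auto
    finally show ?thesis .
  qed
  moreover have "((\<lambda>i. \<Sum>j<n. \<Sum>a\<in>?R. prob (?S i j a)) \<longlongrightarrow> (\<Sum>j<n. \<Sum>a\<in>?R. 0)) F"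
    by (intro tendsto_sum tendsto_vimage_funpow[OF finite_measure_axioms f fs lim Xa])
  ultimately have "((\<lambda>i. prob {w \<in> space M. itin (fs i) X n w \<noteq> itin f X n w}) \<longlongrightarrow> 0) F"
    using tendsto_0_le_measure[of M "\<lambda>i. {w \<in> space M. itin (fs i) X n w \<noteq> itin f X n w}"
        "\<lambda>i. \<Sum>j<n. \<Sum>a\<in>?R. prob (?S i j a)"] by simp
  moreover have R': "itin g X n ` space M \<subseteq> {l. set l \<subseteq> ?R \<and> length l = n}" if "g \<in> inv_mp M" for g
    using inv_mp_space[OF inv_mp_funpow[OF that]] by (auto simp: itin_def)
  ultimately show ?thesis
    by (intro tendsto_label_entropy_of_diff[OF simple_function_itin[OF f X]
        simple_function_itin[OF fs X]
          finite_lists_length_eq[OF R] R'[OF f] R'[OF fs]])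
qed

lemma openin_label_rate_less:
  assumes prob: "prob_space M" and X: "simple_function M X"
  shows "openin (Aut_top M) {q \<in> Aut M. label_rate M (repr M q) X < c}"
proof -
  interpret prob_space M by (rule prob)
  define V where "V n = {q \<in> topspace (Aut_top M). label_entropy M (itin (repr M q) X n) \<in>
      {..<c * real n}}" for n
  have "continuous_map (Aut_top M) euclideanreal (\<lambda>q. label_entropy M (itin (repr M q) X n))" for n
    unfolding continuous_map_atin limitin_canonical_iff topspace_Aut_top
    by (intro ballI tendsto_label_entropy_itin[OF prob repr_inv_mp repr_inv_mp tendsto_repr X])
  then have "openin (Aut_top M) (V n)" for n
    unfolding V_def by (rule openin_continuous_map_preimage) simp
  then have "openin (Aut_top M) (\<Union>n\<in>{1..}. V n)" by blast
  also have "(\<Union>n\<in>{1..}. V n) = {q \<in> Aut M. label_rate M (repr M q) X < c}"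
  proof (intro equalityI subsetI)
    fix q assume "q \<in> (\<Union>n\<in>{1..}. V n)"
    then obtain n where n: "1 \<le> n" "q \<in> Aut M" "label_entropy M (itin (repr M q) X n) < c * real n"
      by (auto simp: V_def topspace_Aut_top)
    then have "label_entropy M (itin (repr M q) X n) / real n < c" by (simp add: field_simps)
    with label_rate(2)[OF prob repr_inv_mp X n(1), of q] n show
        "q \<in> {q \<in> Aut M. label_rate M (repr M q) X < c}"
      by auto
  next
    fix q assume q: "q \<in> {q \<in> Aut M. label_rate M (repr M q) X < c}"
    then have "\<forall>\<^sub>F n in sequentially. label_entropy M (itin (repr M q) X n) / real n < c"
      using label_rate(1)[OF prob repr_inv_mp X, of q] by (intro order_tendstoD) auto
    then have "\<exists>n. label_entropy M (itin (repr M q) X n) / real n < c \<and> n \<ge> 1"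
      using eventually_happens'[OF sequentially_bot eventually_conj[OF _
          eventually_ge_at_top[of 1]]] by blast
    then obtain n where "label_entropy M (itin (repr M q) X n) / real n < c" "n \<ge> 1" by blast
    then have "q \<in> V n" using q by (simp add: V_def topspace_Aut_top field_simps)
    with \<open>n \<ge> 1\<close> show "q \<in> (\<Union>n\<in>{1..}. V n)" by auto
  qed
  finally show ?thesis .
qed

section \<open>Cocycles and their skew products\<close>

text \<open>A countable base of the Polish topology does both: the Hausdorff property separates
  points, and every open set is a countable union of basic ones.\<close>

lemma standard_borel_generator:
  assumes "standard_borel M"
  obtains \<B> where "point_separating M \<B>" "sets M = sigma_sets (space M) \<B>"
proof -
  obtain X where X: "second_countable X" "completely_metrizable_space X"
    "space M = topspace X" "sets M = sets (borel_space X)"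
    using assms by (auto simp: standard_borel_def)
  obtain \<B> where B0: "countable \<B>" "\<forall>V\<in>\<B>. openin X V"
    "\<forall>U x. openin X U \<and> x \<in> U \<longrightarrow> (\<exists>V\<in>\<B>. x \<in> V \<and> V \<subseteq> U)"
    using X(1) unfolding second_countable_def by (elim exE conjE) (rule that)
  note \<B> = B0(1) bspec[OF B0(2)] B0(3)[rule_format, OF conjI]
  have sets: "sets M = sigma_sets (topspace X) {U. openin X U}"
    unfolding X(4) borel_space_def by (intro sets_measure_of) (auto dest: openin_subset)
  have haus: "Hausdorff_space X"
    using X(2) completely_metrizable_imp_metrizable_space metrizable_imp_Hausdorff_space by blast
  have "point_separating M \<B>"
    unfolding point_separating_def
  proof (intro conjI ballI impI)
    show "\<B> \<subseteq> sets M" using \<B>(2) unfolding sets by (auto intro: sigma_sets.Basic)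
    fix x y assume xy: "x \<in> space M" "y \<in> space M" and eq: "\<forall>B\<in>\<B>. x \<in> B \<longleftrightarrow> y \<in> B"
    show "x = y"
    proof (rule ccontr)
      assume "x \<noteq> y"
      then obtain U V where UV: "openin X U" "openin X V" "x \<in> U" "y \<in> V" "disjnt U V"
        using haus xy unfolding Hausdorff_space_def X(3) by blast
      then obtain B where "B \<in> \<B>" "x \<in> B" "B \<subseteq> U" using \<B>(3) by blast
      with eq UV show False by (auto simp: disjnt_def)
    qed
  qed (rule \<B>(1))
  moreover have "sets M = sigma_sets (space M) \<B>"
    unfolding sets X(3)
  proof (rule sigma_sets_eqI)
    fix U assume "U \<in> {U. openin X U}"
    then have U: "openin X U" by simp
    have "U = \<Union>{V \<in> \<B>. V \<subseteq> U}" using \<B>(3)[OF U] by blast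
    moreover have "\<Union>{V \<in> \<B>. V \<subseteq> U} \<in> sigma_sets (topspace X) \<B>"
      using countable_subset[OF _ \<B>(1), of "{V \<in> \<B>. V \<subseteq> U}"]
      by (intro sigma_sets_UNION) (auto intro: sigma_sets.Basic)
    ultimately show "U \<in> sigma_sets (topspace X) \<B>" by simp
  next
    fix V assume "V \<in> \<B>"
    then show "V \<in> sigma_sets (topspace X) {U. openin X U}" using \<B>(2) by
        (auto intro: sigma_sets.Basic)
  qed
  ultimately show ?thesis by (rule that)
qed

lemma space_borel_space: "space (borel_space X) = topspace X"
  unfolding borel_space_def by (rule space_measure_of) (auto dest: openin_subset)

lemma openin_borel_space: "openin X U \<Longrightarrow> U \<in> sets (borel_space X)"
  unfolding borel_space_def by (subst sets_measure_of)
      (auto dest: openin_subset intro: sigma_sets.Basic)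

lemma cocycle_maps_Aut: "S \<in> cocycle_maps M \<Longrightarrow> x \<in> space M \<Longrightarrow> S x \<in> Aut unit_interval"
  using measurable_space[of S M "borel_space (Aut_top unit_interval)" x]
  by (simp add: cocycle_maps_def space_borel_space topspace_Aut_top)

text \<open>For fixed A and B the measured quantity changes by at most the symmetric difference of
  the images of A, so it is continuous on the automorphism group and hence Borel. This trades the
  topology for plain measurability.\<close>

lemma measurable_field_repr:
  assumes S: "S \<in> cocycle_maps M"
  shows "measurable_field M (\<lambda>x. repr unit_interval (S x))"
  unfolding measurable_field_def
proof (intro conjI ballI repr_inv_mp)
  fix A B assume A: "A \<in> sets unit_interval" and B: "B \<in> sets unit_interval"
  let ?\<phi> = "\<lambda>q. measure unit_interval (repr unit_interval q ` A \<inter> B)"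
  have "(?\<phi> \<longlongrightarrow> ?\<phi> q) (atin (Aut_top unit_interval) q)" if q: "q \<in> Aut unit_interval" for q
  proof -
    have rA: "repr unit_interval r ` A \<in> sets unit_interval" for r
        by (rule inv_mp_image[OF repr_inv_mp A])
    have "\<bar>?\<phi> r - ?\<phi> q\<bar> \<le> measure unit_interval (sym_diff (repr unit_interval r ` A)
        (repr unit_interval q ` A))" for r
    proof -
      have 1: "measure unit_interval (C \<inter> B) \<le> measure unit_interval (D \<inter> B) + measure unit_interval
          (sym_diff C D)"
        if "C \<in> sets unit_interval" "D \<in> sets unit_interval" for C D
      proof -
        have DB: "D \<inter> B \<in> sets unit_interval" "sym_diff C D \<in> sets unit_interval" using that B
            by auto
        have "measure unit_interval (C \<inter> B) \<le> measure unit_interval ((D \<inter> B) \<union> sym_diff C D)"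
          by (rule unit_interval.finite_measure_mono[OF _ sets.Un[OF DB]]) auto
        also have "\<dots> \<le> measure unit_interval (D \<inter> B) + measure unit_interval (sym_diff C D)"
          by (rule measure_Un_le[OF DB])
        finally show ?thesis .
      qed
      show ?thesis using 1[OF rA[of r] rA[of q]] 1[OF rA[of q] rA[of r]] by (simp add: Un_commute)
    qed
    then have "((\<lambda>r. ?\<phi> r - ?\<phi> q) \<longlongrightarrow> 0) (atin (Aut_top unit_interval) q)"
      by (intro Lim_null_comparison[OF always_eventually tendsto_repr[OF q A]]) simp
    then show ?thesis by (rule LIM_zero_cancel)
  qed
  then have cont: "continuous_map (Aut_top unit_interval) euclideanreal ?\<phi>"
    unfolding continuous_map_atin limitin_canonical_iff topspace_Aut_top by blast
  have "?\<phi> \<in> borel_measurable (borel_space (Aut_top unit_interval))"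
  proof (rule borel_measurableI)
    fix U :: "real set" assume U: "open U"
    then have "openin (Aut_top unit_interval) {q \<in> topspace (Aut_top unit_interval). ?\<phi> q \<in> U}"
      by (intro openin_continuous_map_preimage[OF cont]) simp
    from openin_borel_space[OF this]
    show "?\<phi> -` U \<inter> space (borel_space (Aut_top unit_interval)) \<in> sets
        (borel_space (Aut_top unit_interval))"
      by (rule back_subst[where P="\<lambda>A. A \<in> sets (borel_space (Aut_top unit_interval))"])
         (auto simp: space_borel_space)
  qed
  from measurable_compose[OF S[unfolded cocycle_maps_def] this]
  show "(\<lambda>x. measure unit_interval (repr unit_interval (S x) ` A \<inter> B)) \<in> borel_measurable M" .
qed

definition I_class :: "(real \<Rightarrow> real) \<Rightarrow> (real \<Rightarrow> real) set" where
  "I_class f = ae_class unit_interval (inv_mp unit_interval) f"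

lemma I_class_cocycle:
  assumes k: "k \<in> measurable M (count_space UNIV)"
  shows "(\<lambda>x. I_class (dperm_enum (k x))) \<in> cocycle_maps M"
  unfolding cocycle_maps_def
proof (rule measurable_compose[OF k])
  show "(\<lambda>n. I_class (dperm_enum n)) \<in> measurable (count_space UNIV)
      (borel_space (Aut_top unit_interval))"
    using ae_class_Aut[OF dperm_enum_inv_mp] by (simp add: space_borel_space topspace_Aut_top
        I_class_def)
qed

lemma repr_I_class_AE: "f \<in> inv_mp unit_interval \<Longrightarrow> AE u in unit_interval. repr unit_interval
    (I_class f) u = f u"
  unfolding I_class_def
  by (intro Aut_AE[OF ae_class_Aut repr_in[OF ae_class_Aut]] ae_class_self)

lemma cocyclesD:
  assumes "C \<in> cocycles M" "S \<in> C"
  shows "S \<in> cocycle_maps M" "C = ae_class M (cocycle_maps M) S"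
  using ae_quotientD[of C "cocycle_maps M" M S] assms by (auto simp: cocycles_def)

lemma cocycles_ex: "C \<in> cocycles M \<Longrightarrow> \<exists>S. S \<in> C"
  using ae_quotient_nonempty[of C] by (auto simp: cocycles_def)

section \<open>Skew products as classes of automorphisms\<close>

locale skew_base = M: prob_space M for M :: "'a measure" +
  fixes T :: "'a \<Rightarrow> 'a" and \<B> :: "'a set set"
  assumes T: "T \<in> inv_mp M" and sep: "point_separating M \<B>" and gen: "sets M = sigma_sets (space M)
      \<B>"
begin

abbreviation N :: "('a \<times> real) measure" where "N \<equiv> M \<Otimes>\<^sub>M unit_interval"

sublocale P: pair_prob_space M unit_interval ..

lemma N_prob: "prob_space N"
proof
  show "emeasure N (space N) = 1"
    unfolding space_pair_measure
    using M.emeasure_space_1 unit_interval.emeasure_space_1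
    by (subst unit_interval.emeasure_pair_measure_Times[OF sets.top sets.top]) auto
qed

text \<open>One representative per fibre suffices, since the elements of a class agree almost
  everywhere.\<close>

definition fibre_map :: "('a \<Rightarrow> (real \<Rightarrow> real) set) \<Rightarrow> ('a \<times> real \<Rightarrow> 'a \<times> real) \<Rightarrow> bool" where
  "fibre_map S f \<longleftrightarrow> (AE x in M. AE u in unit_interval. f (x, u) = (T x, repr unit_interval (S x) u))"

lemma skew_product_fibre_map:
  assumes C: "C \<in> cocycles M" and S: "S \<in> C" and g: "g \<in> skew_product M T C"
  shows "g \<in> inv_mp N" "fibre_map S g"
proof -
  show "g \<in> inv_mp N" using g by (auto simp: skew_product_def)
  obtain S' where S': "S' \<in> C" and ae: "AE x in M. \<forall>s\<in>S' x. AE u in unit_interval. g (x, u) =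
      (T x, s u)"
    using g by (auto simp: skew_product_def)
  have "AE x in M. S x = S' x"
    using cocyclesD(2)[OF C S] S' by (auto simp: ae_class_def)
  with ae AE_space show "fibre_map S g"
    unfolding fibre_map_def
  proof eventually_elim
    fix x assume "\<forall>s\<in>S' x. AE u in unit_interval. g (x, u) = (T x, s u)" "x \<in> space M" "S x = S' x"
    moreover from this have "repr unit_interval (S x) \<in> S x"
      using cocycle_maps_Aut[OF cocyclesD(1)[OF C S]] by (intro repr_in)
    ultimately show "AE u in unit_interval. g (x, u) = (T x, repr unit_interval (S x) u)" by auto
  qed
qed

text \<open>Agreement with \<open>f\<close> is known fibre by fibre. It passes to almost every point
  of the product because the agreement set is measurable, by countable separation; the converse
  inclusion slices an almost everywhere equality.\<close>

lemma skew_product_eq: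
  assumes C: "C \<in> cocycles M" and S: "S \<in> C" and f: "f \<in> inv_mp N" and fm: "fibre_map S f"
  shows "skew_product M T C = ae_class N (inv_mp N) f"
proof (intro equalityI subsetI)
  fix g assume g: "g \<in> skew_product M T C"
  note gS = skew_product_fibre_map[OF C S g]
  obtain \<C> where sepN: "point_separating N \<C>"
    using product_point_separating[OF M.prob_space_axioms T sep] by blast
  have "AE w in N. f w = g w"
  proof (rule P.AE_pair_measure)
    show "{w \<in> space N. f w = g w} \<in> sets N"
      by (rule point_separating_eq_sets[OF sepN inv_mpD(1)[OF f] inv_mpD(1)[OF gS(1)]])
    show "AE x in M. AE u in unit_interval. f (x, u) = g (x, u)"
      using fm[unfolded fibre_map_def] gS(2)[unfolded fibre_map_def]
    proof eventually_elim
      fix x assume "AE u in unit_interval. f (x, u) = (T x, repr unit_interval (S x) u)"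
        "AE u in unit_interval. g (x, u) = (T x, repr unit_interval (S x) u)"
      then show "AE u in unit_interval. f (x, u) = g (x, u)" by eventually_elim simp
    qed
  qed
  with gS(1) show "g \<in> ae_class N (inv_mp N) f" by (simp add: ae_class_def)
next
  fix g assume "g \<in> ae_class N (inv_mp N) f"
  then have g: "g \<in> inv_mp N" and eq: "AE w in N. f w = g w" by (auto simp: ae_class_def)
  have "AE x in M. \<forall>s\<in>S x. AE u in unit_interval. g (x, u) = (T x, s u)"
    using fm[unfolded fibre_map_def] P.AE_pair[OF eq] AE_space
  proof eventually_elim
    fix x assume 1: "AE u in unit_interval. f (x, u) = (T x, repr unit_interval (S x) u)"
      and 2: "AE u in unit_interval. f (x, u) = g (x, u)" and x: "x \<in> space M"
    have Sx: "S x \<in> Aut unit_interval" by (rule cocycle_maps_Aut[OF cocyclesD(1)[OF C S] x])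
    show "\<forall>s\<in>S x. AE u in unit_interval. g (x, u) = (T x, s u)"
    proof
      fix s assume "s \<in> S x"
      from 1 2 Aut_AE[OF Sx this repr_in[OF Sx]]
      show "AE u in unit_interval. g (x, u) = (T x, s u)" by eventually_elim simp
    qed
  qed
  with g S show "g \<in> skew_product M T C" by (auto simp: skew_product_def)
qed

text \<open>The point is that some representative exists: \<open>skew_realization\<close> supplies a
  bijection with the prescribed fibre maps, and all others form its class.\<close>

lemma skew_product_Aut:
  assumes C: "C \<in> cocycles M"
  shows "skew_product M T C \<in> Aut N"
proof -
  obtain S where S: "S \<in> C" using cocycles_ex[OF C] by blast
  obtain p where p: "p \<in> inv_mp N" "fibre_map S p"
    using skew_realization[OF M.prob_space_axioms T sep measurable_field_repr[OF cocyclesD(1)[OF C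
        S]]]
    unfolding fibre_map_def by blast
  show ?thesis
    unfolding skew_product_eq[OF C S p] by (rule ae_class_Aut[OF p(1)])
qed

lemma topspace_cocycle_top: "topspace (cocycle_top M T) = cocycles M"
  using skew_product_Aut by (auto simp: cocycle_top_def topspace_pullback_topology topspace_Aut_top)

lemma repr_skew_product:
  assumes C: "C \<in> cocycles M" and S: "S \<in> C"
  shows "repr N (skew_product M T C) \<in> inv_mp N" "fibre_map S (repr N (skew_product M T C))"
  using skew_product_fibre_map[OF C S repr_in[OF skew_product_Aut[OF C]]] by auto

lemma fibre_map_fst:
  assumes f: "f \<in> inv_mp N" and fm: "fibre_map S f"
  shows "AE w in N. \<forall>i. fst ((f ^^ i) w) = (T ^^ i) (fst w)"
proof -
  have f1: "AE w in N. fst (f w) = T (fst w)"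
  proof (rule P.AE_pair_measure)
    show "{w \<in> space N. fst (f w) = T (fst w)} \<in> sets N"
      by (rule point_separating_eq_sets[OF sep measurable_compose[OF inv_mpD(1)[OF f]
          measurable_fst]
            measurable_compose[OF measurable_fst inv_mpD(1)[OF T]]])
    show "AE x in M. AE u in unit_interval. fst (f (x, u)) = T (fst (x, u))"
      using fm[unfolded fibre_map_def]
    proof eventually_elim
      fix x assume "AE u in unit_interval. f (x, u) = (T x, repr unit_interval (S x) u)"
      then show "AE u in unit_interval. fst (f (x, u)) = T (fst (x, u))" by eventually_elim simp
    qed
  qed
  have "AE w in N. \<forall>i. fst (f ((f ^^ i) w)) = T (fst ((f ^^ i) w))"
    unfolding AE_all_countable using inv_mp_AE[OF inv_mp_funpow[OF f] f1] by blast
  then show ?thesis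
  proof eventually_elim
    fix w assume *: "\<forall>i. fst (f ((f ^^ i) w)) = T (fst ((f ^^ i) w))"
    have "fst ((f ^^ i) w) = (T ^^ i) (fst w)" for i
      by (induction i) (use * in auto)
    then show "\<forall>i. fst ((f ^^ i) w) = (T ^^ i) (fst w)" by blast
  qed
qed

lemma simple_function_fst: "simple_function M X \<Longrightarrow> simple_function N (\<lambda>w. X (fst w))"
  by (rule simple_function_comp[OF measurable_fst])

lemma simple_function_snd: "simple_function unit_interval X \<Longrightarrow> simple_function N (\<lambda>w. X (snd w))"
  by (rule simple_function_comp[OF measurable_snd])

lemma label_entropy_fst:
  assumes X: "simple_function M X"
  shows "label_entropy N (\<lambda>w. X (fst w)) = label_entropy M X"
proof (rule label_entropy_measure_preserving[OF measurable_fst _ X])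
  show "distr N M fst = M"
    by (rule unit_interval.distr_pair_fst)
  show "fst ` space N = space M" by (force simp: space_pair_measure)
qed

lemma KS_entropy_base_le:
  assumes f: "f \<in> inv_mp N" and fm: "fibre_map S f"
  shows "KS_entropy M T \<le> KS_entropy N f"
proof (rule KS_entropy_le[OF M.prob_space_axioms T])
  fix X :: "'a \<Rightarrow> 'a set" assume X: "simple_function M X"
  have X': "simple_function N (\<lambda>w. X (fst w))" by (rule simple_function_fst[OF X])
  have "label_entropy N (itin f (\<lambda>w. X (fst w)) n) = label_entropy M (itin T X n)" for n
  proof -
    have "label_entropy N (itin f (\<lambda>w. X (fst w)) n) = label_entropy N (\<lambda>w. itin T X n (fst w))"
    proof (rule prob_space.label_entropy_cong_AE[OF N_prob simple_function_itin[OF f X']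
        simple_function_fst[OF simple_function_itin[OF T X]]])
      show "AE w in N. itin f (\<lambda>w. X (fst w)) n w = itin T X n (fst w)"
        using fibre_map_fst[OF f fm] by eventually_elim (simp add: itin_def)
    qed
    also have "\<dots> = label_entropy M (itin T X n)"
      by (rule label_entropy_fst[OF simple_function_itin[OF T X]])
    finally show ?thesis .
  qed
  then have "label_rate M T X = label_rate N f (\<lambda>w. X (fst w))"
    by (simp add: label_rate_def)
  then show "ereal (label_rate M T X) \<le> KS_entropy N f"
    using label_rate_le_KS_entropy[OF N_prob f X'] by simp
qed

end

section \<open>Cocycles with finitely many dyadic values\<close>

lemma cell_subset: "cell n j \<subseteq> {0..1}"
  by (auto simp: cell_def)

section \<open>A refining sequence of labels on the product\<close>

context skew_base begin

text \<open>Adding the whole space makes the enumerated family nonempty and lets it cover the space,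
  as the product generator requires.\<close>

definition basis :: "nat \<Rightarrow> 'a set" where
  "basis = from_nat_into (insert (space M) \<B>)"

lemma range_basis: "range basis = insert (space M) \<B>"
  using sep unfolding basis_def by (intro range_from_nat_into) (auto simp: point_separating_def)

lemma basis_sets: "basis i \<in> sets M"
proof -
  have "basis i \<in> range basis" by simp
  then show ?thesis unfolding range_basis using sep by (auto simp: point_separating_def)
qed

definition base_label :: "nat \<Rightarrow> 'a \<Rightarrow> bool list" where
  "base_label m x = map (\<lambda>i. x \<in> basis i) [0..<m]"

definition prod_label :: "nat \<Rightarrow> 'a \<times> real \<Rightarrow> bool list \<times> nat" where
  "prod_label m w = (base_label m (fst w), dyadic m (snd w))"

lemma simple_base_label: "simple_function M (base_label m)"
proof (induction m)
  case 0
  show ?case by (simp add: base_label_def)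
next
  case (Suc m)
  have "simple_function M (\<lambda>x. x \<in> basis m)"
    unfolding simple_function_def
  proof (intro conjI ballI)
    fix c
    have "(\<lambda>x. x \<in> basis m) -` {c} \<inter> space M = (if c then basis m else space M - basis m)"
      using sets.sets_into_space[OF basis_sets] by auto
    then show "(\<lambda>x. x \<in> basis m) -` {c} \<inter> space M \<in> sets M" using basis_sets by auto
  qed (rule finite_subset[OF subset_UNIV], simp)
  then have "simple_function M (\<lambda>x. (base_label m x, x \<in> basis m))"
    by (intro simple_function_Pair Suc)
  from simple_function_compose[OF this, of "\<lambda>(l, b). l @ [b]"]
  show ?case by (simp add: comp_def base_label_def[abs_def])
qed

lemma simple_prod_label: "simple_function N (prod_label m)"
  unfolding prod_label_def[abs_def]
  by (intro simple_function_Pair simple_function_fst[OF simple_base_label]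
      simple_function_snd[OF simple_function_dyadic])

lemma sets_N_eq:
  assumes "Ea \<subseteq> Pow (space M)" "sets M = sigma_sets (space M) Ea" "space M \<in> Ea"
  shows "sets N = sigma_sets (space N) {A \<times> D | A D. A \<in> Ea \<and> D \<in> {cell n j | n j. True}}"
proof -
  let ?D = "{cell n j | n j. True}"
  \<comment> \<open>The cells of level 0 are the half-open interval and the single point 1; they
    form the countable cover needed for the second factor.\<close>
  have cov: "cell 0 0 \<union> cell 0 1 = {0..1}"
    using dyadic_le[of _ 0] by (fastforce simp: cell_def le_Suc_eq)
  have dsub: "?D \<subseteq> Pow {0..1}" by (auto simp: cell_def)
  have "sets N = sets (sigma (space M \<times> {0..1}) {A \<times> D | A D. A \<in> Ea \<and> D \<in> ?D})"
  proof (rule trans[OF sets_pair_eq[where Ea=Ea and Ca="{space M}" and Eb="?D" and Cb="{cell 0 0,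
      cell 0 1}"]])
    show "sets unit_interval = sigma_sets (space unit_interval) ?D" by
        (simp add: sets_unit_interval_cell)
  qed (use assms cov dsub in auto)
  also have "\<dots> = sigma_sets (space M \<times> {0..1}) {A \<times> D | A D. A \<in> Ea \<and> D \<in> ?D}"
    by (intro sets_measure_of) (use assms(1) cell_subset in blast)
  finally show ?thesis by (simp add: space_pair_measure)
qed

lemma refining_prod_label:
  "refining_labels N prod_label {A \<times> D | A D. A \<in> range basis \<and> D \<in> {cell n j | n j. True}}"
proof -
  interpret prob_space N by (rule N_prob)
  have basis_sub: "range basis \<subseteq> Pow (space M)"
    using sets.sets_into_space[OF basis_sets] by auto
  have gen': "sets M = sigma_sets (space M) (range basis)"
    unfolding range_basis
  proof (intro antisym)
    show "sets M \<subseteq> sigma_sets (space M) (insert (space M) \<B>)"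
      unfolding gen by (intro sigma_sets_mono') auto
    show "sigma_sets (space M) (insert (space M) \<B>) \<subseteq> sets M"
      using sep by (intro sets.sigma_sets_subset) (auto simp: point_separating_def)
  qed
  show ?thesis
  proof
    show "simple_function N (prod_label m)" for m by (rule simple_prod_label)
    show "\<exists>f. \<forall>w\<in>space N. prod_label m w = f (prod_label (Suc m) w)" for m
      by (intro exI[of _ "\<lambda>(l, k). (butlast l, k div 2)"])
         (auto simp: prod_label_def base_label_def space_pair_measure dyadic_div[of _ m "Suc m"])
    show "{A \<times> D | A D. A \<in> range basis \<and> D \<in> {cell n j | n j. True}} \<subseteq> Pow (space N)"
      unfolding space_pair_measure space_unit_interval using basis_sub cell_subset by blast
    show "sets N = sigma_sets (space N) {A \<times> D | A D. A \<in> range basis \<and> D \<in> {cell n j | n j. True}}"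
      using range_basis by (intro sets_N_eq basis_sub gen') auto
    fix R assume "R \<in> {A \<times> D | A D. A \<in> range basis \<and> D \<in> {cell n j | n j. True}}"
    then obtain i n j where R: "R = basis i \<times> cell n j" by auto
    \<comment> \<open>Position i must exist in the list of length m, and level m must refine level
      n.\<close>
    define m where "m = max (Suc i) n"
    have "w \<in> R \<longleftrightarrow> (\<lambda>(l, k). l ! i \<and> k div 2 ^ (m - n) = j) (prod_label m w)" if "w \<in> space N" for w
    proof -
      have "snd w \<in> {0..1}" using that by (auto simp: space_pair_measure)
      moreover have "i < m" "n \<le> m" by (simp_all add: m_def)
      ultimately show ?thesis
        using dyadic_div[of "snd w" n m] by (cases w)
            (auto simp: R prod_label_def base_label_def cell_def)
    qed
    then show "\<exists>m f. \<forall>w\<in>space N. (w \<in> R) = f (prod_label m w)"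
      by (intro exI[of _ m] exI[of _ "\<lambda>(l, k). l ! i \<and> k div 2 ^ (m - n) = j"] ballI)
  qed
qed

end

text \<open>The dyadic index of level L then evolves autonomously under the map, through \<tau>,
  which makes it a finite state.\<close>

definition coarse_at :: "(real \<Rightarrow> real) \<Rightarrow> nat \<Rightarrow> bool" where
  "coarse_at p L \<longleftrightarrow> (\<exists>\<tau>. \<forall>u\<in>{0..1}. dyadic L (p u) = \<tau> (dyadic L u))"

lemma dperm_coarse:
  assumes \<sigma>: "\<sigma> permutes {..<2 ^ m}" and mL: "m \<le> L"
  shows "coarse_at (dperm m \<sigma>) L"
proof -
  let ?c = "2 ^ (L - m) :: nat"
  \<comment> \<open>An index l of level L lies in block l div c; its block is moved by \<sigma> and
    its offset is kept. Adding before subtracting avoids truncation in the natural numbers.\<close>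
  let ?\<tau> = "\<lambda>l. l + ?c * \<sigma> (l div ?c) - ?c * (l div ?c)"
  have "dyadic L (dperm m \<sigma> u) = ?\<tau> (dyadic L u)" if u: "u \<in> {0..1}" for u
  proof -
    have j: "dyadic m u = dyadic L u div ?c" using u mL by (intro dyadic_div) auto
    have pow: "(2::real) ^ L = 2 ^ m * real ?c" using mL by (simp add: power_add[symmetric])
    have "?c * (dyadic L u div ?c) \<le> dyadic L u" by simp
    then have \<tau>: "real (?\<tau> (dyadic L u)) = real (dyadic L u) + real ?c * real (\<sigma> (dyadic m u)) -
        real ?c * real (dyadic m u)"
      unfolding j by (subst of_nat_diff) (auto simp del: times_div_less_eq_dividend)
    have "2 ^ L * dperm m \<sigma> u = 2 ^ L * u + real ?c * (real (\<sigma> (dyadic m u)) - real (dyadic m u))"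
      unfolding dperm_def pow by (simp add: field_simps)
    then have "real (?\<tau> (dyadic L u)) \<le> 2 ^ L * dperm m \<sigma> u" "2 ^ L * dperm m \<sigma> u <
        real (?\<tau> (dyadic L u)) + 1"
      unfolding \<tau> using dyadic_bounds[of u L] u by (simp_all add: right_diff_distrib)
    then show ?thesis
      using dyadic_eq_iff[of "dperm m \<sigma> u" L "?\<tau> (dyadic L u)"] dperm(1)[OF \<sigma> u] by auto
  qed
  then show ?thesis unfolding coarse_at_def by (intro exI[of _ ?\<tau>]) blast
qed

lemma dperm_enum_eventually_coarse: "\<exists>m. \<forall>L\<ge>m. coarse_at (dperm_enum k) L"
proof -
  obtain m \<sigma> where "\<sigma> permutes {..<2 ^ m}" "dperm_enum k = dperm m \<sigma>"
    using dperm_enum_in[of k] by (auto simp: dperms_def)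
  then show ?thesis using dperm_coarse by (intro exI[of _ m]) auto
qed

lemma dperm_enum_common_level: "\<exists>L\<ge>m. \<forall>k\<le>K. coarse_at (dperm_enum k) L"
proof -
  have "\<forall>k. \<exists>m. \<forall>L\<ge>m. coarse_at (dperm_enum k) L" using dperm_enum_eventually_coarse by blast
  from choice[OF this] obtain l where l: "\<forall>k. \<forall>L\<ge>l k. coarse_at (dperm_enum k) L" ..
  let ?L = "max m (Max (l ` {..K}))"
  have "l k \<le> ?L" if "k \<le> K" for k
    using that by (intro max.coboundedI2 Max_ge) auto
  then show ?thesis using l by (intro exI[of _ ?L]) auto
qed

section \<open>Entropy rates of dyadic cocycles\<close>

context skew_base begin

text \<open>A cocycle with finitely many dyadic permutations as values moves the dyadic intervals of a
  fixed level, so the itinerary in the product is determined by an itinerary in the base together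
  with the initial dyadic interval.\<close>

lemma label_rate_dyadic_le:
  assumes k: "k \<in> measurable M (count_space UNIV)" and bdd: "\<And>x. k x \<le> K"
    and f: "f \<in> inv_mp N" and fm: "fibre_map (\<lambda>x. I_class (dperm_enum (k x))) f"
  shows "ereal (label_rate N f (prod_label m)) \<le> KS_entropy M T"
proof -
  obtain L where mL: "m \<le> L" and resp: "\<forall>k\<le>K. coarse_at (dperm_enum k) L"
      using dperm_enum_common_level by blast
  then have "\<forall>k. \<exists>\<tau>. k \<le> K \<longrightarrow> (\<forall>u\<in>{0..1}. dyadic L (dperm_enum k u) = \<tau> (dyadic L u))"
    unfolding coarse_at_def by blast
  from choice[OF this] obtain \<tau> where \<tau>: "\<And>k u. k \<le> K \<Longrightarrow> u \<in> {0..1} \<Longrightarrow> dyadic L (dperm_enum k u) =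
      \<tau> k (dyadic L u)"
    by blast
  \<comment> \<open>The base label also records which permutation acts over the point, so its
    itinerary drives the evolution of the dyadic index.\<close>
  define \<gamma> where "\<gamma> x = (base_label m x, k x)" for x
  have k_simple: "simple_function M k"
    unfolding simple_function_def
  proof (intro conjI ballI)
    have "k ` space M \<subseteq> {..K}" using bdd by auto
    then show "finite (k ` space M)" by (rule finite_subset) simp
    show "k -` {i} \<inter> space M \<in> sets M" for i by (rule measurable_sets[OF k]) simp
  qed
  have \<gamma>: "simple_function M \<gamma>"
    unfolding \<gamma>_def[abs_def] by (intro simple_function_Pair simple_base_label k_simple)
  \<comment> \<open>\<open>st l d\<close> is the index of level L reached from d after the symbols
    in l. \<open>\<Phi>\<close> decodes the product itinerary from these states, dividing by 2^(L -
    m) to return to level m.\<close>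
  define st where "st l d = fold (\<lambda>a d. \<tau> (snd a) d) l d" for l :: "(bool list \<times> nat) list" and d
  define \<Phi> where "\<Phi> n p = map (\<lambda>i. (fst (fst p ! i), st (take i (fst p)) (snd p) div 2 ^ (L - m)))
      [0..<n]"
    for n and p :: "(bool list \<times> nat) list \<times> nat"
  have step: "AE w in N. snd w \<in> {0..1} \<and> dyadic L (snd (f w)) = \<tau> (k (fst w)) (dyadic L (snd w))"
  proof (rule P.AE_pair_measure)
    have dN: "simple_function N (\<lambda>w. dyadic L (snd w))"
      by (rule simple_function_snd[OF simple_function_dyadic])
    have "simple_function N (\<lambda>w. (dyadic L (snd (f w)), k (fst w), dyadic L (snd w)))"
      by (rule simple_function_Pair[OF simple_function_inv_mp[OF f dN]
          simple_function_Pair[OF simple_function_fst[OF k_simple] dN]])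
    from simple_functionD(2)[OF this, of "{(a, b, c). a = \<tau> b c}"]
    have "{w \<in> space N. dyadic L (snd (f w)) = \<tau> (k (fst w)) (dyadic L (snd w))} \<in> sets N"
      by (rule back_subst[where P="\<lambda>A. A \<in> sets N"]) auto
    moreover have "{w \<in> space N. snd w \<in> {0..1} \<and> dyadic L (snd (f w)) =
        \<tau> (k (fst w)) (dyadic L (snd w))} =
        {w \<in> space N. dyadic L (snd (f w)) = \<tau> (k (fst w)) (dyadic L (snd w))}"
      by (auto simp: space_pair_measure)
    ultimately show "{w \<in> space N. snd w \<in> {0..1} \<and> dyadic L (snd (f w)) =
        \<tau> (k (fst w)) (dyadic L (snd w))} \<in> sets N"
      by simp
    show "AE x in M. AE u in unit_interval. snd (x, u) \<in> {0..1} \<and> dyadic L (snd (f (x, u))) =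
        \<tau> (k (fst (x, u))) (dyadic L (snd (x, u)))"
      using fm[unfolded fibre_map_def]
    proof eventually_elim
      fix x assume "AE u in unit_interval. f (x, u) =
          (T x, repr unit_interval (I_class (dperm_enum (k x))) u)"
      then show "AE u in unit_interval. snd (x, u) \<in> {0..1} \<and> dyadic L (snd (f (x, u))) =
          \<tau> (k (fst (x, u))) (dyadic L (snd (x, u)))"
        using repr_I_class_AE[OF dperm_enum_inv_mp, of "k x"] AE_space
        by eventually_elim (simp add: \<tau>[OF bdd])
    qed
  qed
  have "AE w in N. \<forall>i. snd ((f ^^ i) w) \<in> {0..1} \<and> dyadic L (snd (f ((f ^^ i) w))) =
      \<tau> (k (fst ((f ^^ i) w))) (dyadic L (snd ((f ^^ i) w)))"
    unfolding AE_all_countable using inv_mp_AE[OF inv_mp_funpow[OF f] step] by blast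
  with fibre_map_fst[OF f fm]
  have key: "AE w in N. itin f (prod_label m) n w = \<Phi> n (itin T \<gamma> n (fst w), dyadic L (snd w))"
      for n
  proof eventually_elim
    fix w assume T': "\<forall>i. fst ((f ^^ i) w) = (T ^^ i) (fst w)"
      and st': "\<forall>i. snd ((f ^^ i) w) \<in> {0..1} \<and> dyadic L (snd (f ((f ^^ i) w))) =
          \<tau> (k (fst ((f ^^ i) w))) (dyadic L (snd ((f ^^ i) w)))"
    have state: "dyadic L (snd ((f ^^ i) w)) = st (itin T \<gamma> i (fst w)) (dyadic L (snd w))" for i
    proof (induction i)
      case 0 then show ?case by (simp add: st_def)
    next
      case (Suc i)
      then show ?case using st' T' by (simp add: st_def itin_Suc \<gamma>_def)
    qed
    have "prod_label m ((f ^^ i) w) =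
        (fst (itin T \<gamma> n (fst w) ! i), st (take i (itin T \<gamma> n (fst w))) (dyadic L (snd w)) div 2 ^
            (L - m))" if "i < n" for i
    proof -
      have "take i (itin T \<gamma> n (fst w)) = itin T \<gamma> i (fst w)"
        using that by (simp add: itin_def take_map take_upt)
      moreover have "dyadic m (snd ((f ^^ i) w)) = dyadic L (snd ((f ^^ i) w)) div 2 ^ (L - m)"
        using st' mL by (intro dyadic_div) auto
      ultimately show ?thesis
        using that T' state[of i] by (simp add: prod_label_def itin_def \<gamma>_def)
    qed
    then show "itin f (prod_label m) n w = \<Phi> n (itin T \<gamma> n (fst w), dyadic L (snd w))"
      by (simp add: \<Phi>_def itin_def[of f])
  qed
  \<comment> \<open>The only information beyond the base itinerary is the initial index of level L,
    with at most 2^L + 1 values because the endpoint 1 has its own.\<close>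
  define d where "d = ln (real (2 ^ L + 1))"
  have "label_entropy N (itin f (prod_label m) n) \<le> label_entropy M (itin T \<gamma> n) + real n * 0 + d"
      for n
  proof -
    have s1: "simple_function N (\<lambda>w. itin T \<gamma> n (fst w))"
      by (rule simple_function_fst[OF simple_function_itin[OF T \<gamma>]])
    have s2: "simple_function N (\<lambda>w. dyadic L (snd w))"
        by (rule simple_function_snd[OF simple_function_dyadic])
    note s12 = simple_function_Pair[OF s1 s2]
    have s3: "simple_function N (\<lambda>w. \<Phi> n (itin T \<gamma> n (fst w), dyadic L (snd w)))"
      using simple_function_compose[OF s12, of "\<Phi> n"] by (simp add: comp_def)
    have "label_entropy N (itin f (prod_label m) n) = label_entropy N
        (\<lambda>w. \<Phi> n (itin T \<gamma> n (fst w), dyadic L (snd w)))"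
      by (rule prob_space.label_entropy_cong_AE[OF N_prob simple_function_itin[OF f
          simple_prod_label] s3 key])
    also have "\<dots> \<le> label_entropy N (\<lambda>w. (itin T \<gamma> n (fst w), dyadic L (snd w)))"
      by (rule prob_space.label_entropy_compose_le[OF N_prob s12])
    also have "\<dots> \<le> label_entropy N (\<lambda>w. itin T \<gamma> n (fst w)) + label_entropy N
        (\<lambda>w. dyadic L (snd w))"
      by (rule prob_space.label_entropy_Pair_le[OF N_prob s1 s2])
    also have "label_entropy N (\<lambda>w. itin T \<gamma> n (fst w)) = label_entropy M (itin T \<gamma> n)"
      by (rule label_entropy_fst[OF simple_function_itin[OF T \<gamma>]])
    also have "label_entropy N (\<lambda>w. dyadic L (snd w)) \<le>
        ln (real (card ((\<lambda>w. dyadic L (snd w)) ` space N)))"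
      by (rule prob_space.label_entropy_le_card[OF N_prob s2])
    also have "\<dots> \<le> d"
    proof -
      have "(\<lambda>w. dyadic L (snd w)) ` space N \<subseteq> {..2 ^ L}" using dyadic_le by
          (auto simp: space_pair_measure)
      then have "card ((\<lambda>w. dyadic L (snd w)) ` space N) \<le> card {..(2::nat) ^ L}"
          by (intro card_mono) auto
      moreover have "card ((\<lambda>w. dyadic L (snd w)) ` space N) > 0"
        using simple_functionD(1)[OF s2] prob_space.not_empty[OF N_prob] by
            (auto simp: card_gt_0_iff)
      ultimately show ?thesis
        unfolding d_def by (subst ln_le_cancel_iff) (auto simp del: of_nat_power of_nat_Suc simp:
            card_gt_0_iff)
    qed
    finally show ?thesis by simp
  qed
  from label_rate_le[OF N_prob f simple_prod_label M.prob_space_axioms T \<gamma> this]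
  have "label_rate N f (prod_label m) \<le> label_rate M T \<gamma>" by simp
  then have "ereal (label_rate N f (prod_label m)) \<le> ereal (label_rate M T \<gamma>)" by simp
  also have "\<dots> \<le> KS_entropy M T" by (rule label_rate_le_KS_entropy[OF M.prob_space_axioms T \<gamma>])
  finally show ?thesis .
qed

end

section \<open>Density of dyadic cocycles\<close>

text \<open>Dyadic cells are nested or disjoint. A disjoint pair is written as a rectangle with
  empty base, so that it stays in the family.\<close>

lemma Int_stable_cell_rectangles:
  "Int_stable {A \<times> D | A D. A \<in> sets M \<and> D \<in> {cell n j | n j. True}}"
proof (rule Int_stableI)
  fix R R' assume "R \<in> {A \<times> D | A D. A \<in> sets M \<and> D \<in> {cell n j | n j. True}}"
    "R' \<in> {A \<times> D | A D. A \<in> sets M \<and> D \<in> {cell n j | n j. True}}"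
  then obtain A n j A' n' j' where R: "R = A \<times> cell n j" "R' = A' \<times> cell n' j'" "A \<in> sets M"
      "A' \<in> sets M" by auto
  have nest: "cell m j \<inter> cell l i = {} \<or> cell m j \<inter> cell l i = cell l i" if "m \<le> l" for m l i j
    using dyadic_div[OF _ that] by (auto simp: cell_def)
  have "cell n j \<inter> cell n' j' = {} \<or> cell n j \<inter> cell n' j' = cell n' j' \<or> cell n j \<inter> cell n' j' =
      cell n j"
    using nest[of n n' j j'] nest[of n' n j' j] by (cases "n \<le> n'") (auto simp: Int_commute)
  then have "R \<inter> R' = {} \<times> cell 0 0 \<or> R \<inter> R' = (A \<inter> A') \<times> cell n' j' \<or> R \<inter> R' = (A \<inter> A') \<times> cell n j"
    unfolding R Times_Int_Times by auto
  moreover have rect: "A'' \<times> cell l i \<in> {A \<times> D | A D. A \<in> sets M \<and> D \<in> {cell n j | n j. True}}"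
    if "A'' \<in> sets M" for A'' l i
    using that by blast
  ultimately show "R \<inter> R' \<in> {A \<times> D | A D. A \<in> sets M \<and> D \<in> {cell n j | n j. True}}"
    using R(3,4) by (elim disjE) (simp_all only: rect sets.empty_sets sets.Int)
qed

section \<open>Weak convergence of skew products\<close>

context skew_base begin

text \<open>Pulling the misplaced part back along \<open>f\<close> turns it into a set of arguments,
  whose measure can be integrated over the fibres.\<close>

lemma image_Diff_eq_vimage:
  assumes f: "f \<in> inv_mp N" and g: "g \<in> inv_mp N" and A: "A \<in> sets N"
  shows "{w \<in> A. f w \<notin> g ` A} \<in> sets N" "measure N (f ` A - g ` A) = measure N {w \<in> A. f w \<notin> g ` A}"
proof -
  have AN: "A \<subseteq> space N" using A by (rule sets.sets_into_space)
  have "{w \<in> A. f w \<notin> g ` A} = A - (f -` (g ` A) \<inter> space N)" using AN by auto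
  also have "\<dots> \<in> sets N"
    using A inv_mp_vimage(1)[OF f inv_mp_image(1)[OF g A]] by auto
  finally show Z: "{w \<in> A. f w \<notin> g ` A} \<in> sets N" .
  have "f ` A - g ` A = f ` {w \<in> A. f w \<notin> g ` A}"
  proof (intro equalityI subsetI)
    fix v assume "v \<in> f ` A - g ` A"
    then obtain w where "w \<in> A" "v = f w" "v \<notin> g ` A" by blast
    then show "v \<in> f ` {w \<in> A. f w \<notin> g ` A}" by (intro image_eqI[of v f w]) simp_all
  next
    fix v assume "v \<in> f ` {w \<in> A. f w \<notin> g ` A}"
    then obtain w where "w \<in> {w \<in> A. f w \<notin> g ` A}" "v = f w" by (rule imageE)
    then show "v \<in> f ` A - g ` A" by simp
  qed
  then show "measure N (f ` A - g ` A) = measure N {w \<in> A. f w \<notin> g ` A}"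
    using inv_mp_image(2)[OF f Z] by simp
qed

text \<open>If s u is not an error value, it equals the approximating permutation at some w in the
  cell of u of level n, and so of level m. Then \<open>g\<close> sends (x, w) to f (x, u), so u is
  not misplaced.\<close>

lemma fibre_error:
  assumes s: "s \<in> inv_mp unit_interval" and nm: "m \<le> n" and x: "x \<in> B"
    and f: "AE u in unit_interval. f (x, u) = (T x, s u)"
    and g: "AE u in unit_interval. g (x, u) = (T x, dperm_enum (approx_index s n) u)"
    and meas: "Pair x -` {w \<in> B \<times> cell m j. f w \<notin> g ` (B \<times> cell m j)} \<in> sets unit_interval"
  shows "emeasure unit_interval (Pair x -` {w \<in> B \<times> cell m j. f w \<notin> g ` (B \<times> cell m j)}) \<le>
      ennreal ((1/2) ^ n)"
    (is "emeasure _ ?Z \<le> _")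
proof -
  let ?p = "dperm_enum (approx_index s n)"
  \<comment> \<open>The formula for \<open>g\<close> is needed at the point w, not at u, so its
    exceptional null set is transported by the inverse permutation and by \<open>s\<close>.\<close>
  have "AE u in unit_interval. u \<in> ?Z \<longrightarrow> u \<in> s -` approx_error s n \<inter> space unit_interval"
    using f inv_mp_AE[OF s inv_mp_AE[OF inv_I(1)[OF dperm_enum_inv_mp] g]] AE_not_one AE_space
  proof eventually_elim
    fix u assume fu: "f (x, u) = (T x, s u)"
      and gu: "g (x, inv_I ?p (s u)) = (T x, ?p (inv_I ?p (s u)))"
      and u1: "u \<noteq> 1" and us: "u \<in> space unit_interval"
    show "u \<in> ?Z \<longrightarrow> u \<in> s -` approx_error s n \<inter> space unit_interval"
    proof (rule impI, rule ccontr)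
      assume u: "u \<in> ?Z" and "u \<notin> s -` approx_error s n \<inter> space unit_interval"
      then have "s u \<notin> approx_error s n" using us by simp
      then obtain w where w: "w \<in> {0..1}" "dyadic n w = dyadic n u" "s u = ?p w"
        using not_in_derrD[of s u n] us u1 by auto
      have "inv_I ?p (s u) = w" using inv_I(2)[OF dperm_enum_inv_mp w(1)] w(3) by simp
      then have "g (x, w) = f (x, u)" using gu fu w(3) by simp
      moreover have "w \<in> cell m j"
        using u w nm us dyadic_div[of w m n] dyadic_div[of u m n] by (auto simp: cell_def)
      ultimately have "f (x, u) \<in> g ` (B \<times> cell m j)" using x by (intro image_eqI[of _ g "(x, w)"])
          auto
      with u show False by simp
    qed
  qed
  then have "emeasure unit_interval ?Z \<le> emeasure unit_interval (s -` approx_error s n \<inter> space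
      unit_interval)"
    by (rule emeasure_mono_AE) (rule inv_mp_vimage(1)[OF s approx_error_sets[OF s]])
  also have "\<dots> = ennreal (measure unit_interval (approx_error s n))"
    using inv_mp_vimage(2)[OF s approx_error_sets[OF s]] by
        (simp add: unit_interval.emeasure_eq_measure)
  also have "\<dots> \<le> ennreal ((1/2) ^ n)"
    by (rule ennreal_leI[OF measure_approx_error[OF s]])
  finally show ?thesis .
qed

lemma tail_index:
  assumes k: "k \<in> measurable M (count_space UNIV)" and e: "(0::real) < e"
  shows "\<exists>K::nat. measure M {x \<in> space M. \<not> k x \<le> K} \<le> e"
proof -
  have S: "{x \<in> space M. \<not> k x \<le> K} \<in> sets M" for K
  proof -
    have "{x \<in> space M. \<not> k x \<le> K} = k -` {K<..} \<inter> space M" by auto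
    then show ?thesis using measurable_sets[OF k, of "{K<..}"] by simp
  qed
  have "(\<lambda>K. measure M {x \<in> space M. \<not> k x \<le> K}) \<longlonglongrightarrow> measure M (\<Inter>K. {x \<in> space M. \<not> k x \<le> K})"
    using S by (intro M.finite_Lim_measure_decseq) (auto simp: decseq_def)
  also have "(\<Inter>K. {x \<in> space M. \<not> k x \<le> K}) = {}" by auto
  finally have "\<forall>\<^sub>F K in sequentially. measure M {x \<in> space M. \<not> k x \<le> K} < e"
    using e by (intro order_tendstoD) auto
  then obtain K where "measure M {x \<in> space M. \<not> k x \<le> K} < e"
    using eventually_happens'[OF sequentially_bot] by blast
  then show ?thesis by (intro exI[of _ K]) simp
qed

text \<open>The sets for which convergence holds form a Dynkin system containing an
  intersection-stable generator. For a disjoint union, the image of a late tail under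
  \<open>f\<close> is small uniformly in n.\<close>

lemma tendsto_image_Diff:
  assumes f: "f \<in> inv_mp N" and g: "\<And>n. g n \<in> inv_mp N"
    and rect: "\<And>B m j. B \<in> sets M \<Longrightarrow> (\<lambda>n. measure N (f ` (B \<times> cell m j) - g n ` (B \<times> cell m j))) \<longlonglongrightarrow> 0"
    and A: "A \<in> sets N"
  shows "(\<lambda>n. measure N (f ` A - g n ` A)) \<longlonglongrightarrow> 0"
proof -
  let ?G = "{A \<times> D | A D. A \<in> sets M \<and> D \<in> {cell n j | n j. True}}"
  have setsG: "sets N = sigma_sets (space N) ?G"
    by (rule sets_N_eq) (auto simp: sets.sigma_sets_eq sets.space_closed)
  have GN: "?G \<subseteq> Pow (space N)"
    unfolding space_pair_measure space_unit_interval using sets.sets_into_space cell_subset by blast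
  have D_sets: "f ` A - g n ` A \<in> sets N" if "A \<in> sets N" for A n
    using inv_mp_image(1)[OF f that] inv_mp_image(1)[OF g that] by auto
  show ?thesis
    using Int_stable_cell_rectangles GN A[unfolded setsG]
  proof (induction rule: sigma_sets_induct_disjoint)
    case (basic A)
    then show ?case using rect by auto
  next
    case empty then show ?case by simp
  next
    case (compl A)
    then have A: "A \<in> sets N" using setsG by simp
    have img: "p ` (space N - A) = space N - p ` A" if "p \<in> inv_mp N" for p
      using inv_mpD(2)[OF that] inj_on_image_set_diff[of p "space N" "space N" A]
          sets.sets_into_space[OF A]
      by (auto simp: bij_betw_def)
    have sub: "p ` A \<subseteq> space N" if "p \<in> inv_mp N" for p
      using inv_mp_image(1)[OF that A] by (rule sets.sets_into_space)
    have "measure N (f ` (space N - A) - g n ` (space N - A)) = measure N (f ` A - g n ` A)" for n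
    proof -
      \<comment> \<open>Complementation exchanges the two one-sided differences, which have equal
        measure.\<close>
      have "f ` (space N - A) - g n ` (space N - A) = g n ` A - f ` A"
        unfolding img[OF f] img[OF g] using sub[OF f] sub[OF g] by auto
      then show ?thesis
        using measure_Diff_commute[OF P.finite_measure_axioms inv_mp_image(1)[OF f A]
            inv_mp_image(1)[OF g A]]
          inv_mp_image(2)[OF f A] inv_mp_image(2)[OF g A] by simp
    qed
    then show ?case using compl.IH by simp
  next
    case (union A)
    have A: "A i \<in> sets N" for i using union.hyps(2) unfolding setsG by blast
    let ?U = "\<Union>i. A i"
    show ?case
    proof (rule LIMSEQ_I)
      fix e :: real assume e: "0 < e"
      have "(\<lambda>I. measure N (\<Union>i<I. A i)) \<longlonglongrightarrow> measure N (\<Union>I. \<Union>i<I. A i)"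
        using A by (intro P.finite_Lim_measure_incseq) (auto simp: incseq_def, force)
      moreover have "(\<Union>I. \<Union>i<I. A i) = ?U" by auto
      ultimately have "\<forall>\<^sub>F I in sequentially. measure N ?U - e / 2 < measure N (\<Union>i<I. A i)"
        using e by (intro order_tendstoD) auto
      then obtain I where I: "measure N ?U - e / 2 < measure N (\<Union>i<I. A i)"
        using eventually_happens'[OF sequentially_bot] by blast
      let ?R = "?U - (\<Union>i<I. A i)"
      have US: "?U \<in> sets N" "(\<Union>i<I. A i) \<in> sets N" using A by auto
      then have RS: "?R \<in> sets N" by auto
      have R: "measure N (f ` ?R) < e / 2"
        using I inv_mp_image(2)[OF f RS] P.finite_measure_Diff[OF US UN_mono[OF subset_UNIV
            order_refl]]
        by simp
      have "(\<lambda>n. \<Sum>i<I. measure N (f ` A i - g n ` A i)) \<longlonglongrightarrow> (\<Sum>i<I. 0)"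
        using union.IH by (intro tendsto_sum) auto
      then have "\<forall>\<^sub>F n in sequentially. (\<Sum>i<I. measure N (f ` A i - g n ` A i)) < e / 2"
        using e by (intro order_tendstoD) auto
      then obtain n0 where n0: "\<And>n. n \<ge> n0 \<Longrightarrow> (\<Sum>i<I. measure N (f ` A i - g n ` A i)) < e / 2"
        unfolding eventually_sequentially by blast
      have "norm (measure N (f ` ?U - g n ` ?U) - 0) < e" if n: "n \<ge> n0" for n
      proof -
        let ?D = "\<Union>i<I. f ` A i - g n ` A i"
        have DS: "?D \<in> sets N" using D_sets[OF A] by auto
        note fR = inv_mp_image(1)[OF f RS]
        have "f ` ?U - g n ` ?U \<subseteq> ?D \<union> f ` ?R"
        proof
          fix v assume v: "v \<in> f ` ?U - g n ` ?U"
          then obtain w where w: "w \<in> ?U" "v = f w" by auto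
          show "v \<in> ?D \<union> f ` ?R"
          proof (cases "w \<in> (\<Union>i<I. A i)")
            case True
            then obtain i where "i < I" "w \<in> A i" by auto
            then show ?thesis using v w(2) by auto
          next
            case False
            then show ?thesis using w by auto
          qed
        qed
        then have "measure N (f ` ?U - g n ` ?U) \<le> measure N (?D \<union> f ` ?R)"
          by (rule P.finite_measure_mono[OF _ sets.Un[OF DS fR]])
        also have "\<dots> \<le> measure N ?D + measure N (f ` ?R)"
          by (rule measure_Un_le[OF DS fR])
        also have "measure N ?D \<le> (\<Sum>i<I. measure N (f ` A i - g n ` A i))"
          using D_sets[OF A] by (intro measure_UNION_le) auto
        finally show ?thesis using R n0[OF n] by simp
      qed
      then show "\<exists>no. \<forall>n\<ge>no. norm (measure N (f ` ?U - g n ` ?U) - 0) < e" by blast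
    qed
  qed
qed

lemma dyadic_cocycles_approximate:
  assumes C: "C \<in> cocycles M"
  shows "\<exists>Cn. (\<forall>n. Cn n \<in> cocycles M) \<and> limitin (cocycle_top M T) Cn C sequentially \<and>
    (\<forall>n m. ereal (label_rate N (repr N (skew_product M T (Cn n))) (prod_label m)) \<le> KS_entropy M T)"
proof -
  obtain S where S: "S \<in> C" using cocycles_ex[OF C] by blast
  define s where "s x = repr unit_interval (S x)" for x
  have s: "s x \<in> inv_mp unit_interval" for x unfolding s_def by (rule repr_inv_mp)
  have sf: "measurable_field M s"
    unfolding s_def[abs_def] by (rule measurable_field_repr[OF cocyclesD(1)[OF C S]])
  define kk where "kk n x = approx_index (s x) n" for n x
  have kk: "kk n \<in> measurable M (count_space UNIV)" for n
    unfolding kk_def[abs_def] by (rule measurable_approx_index[OF sf])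
  have "\<forall>n. \<exists>K. measure M {x \<in> space M. \<not> kk n x \<le> K} \<le> (1/2) ^ n"
    using tail_index[OF kk] by simp
  from choice[OF this] obtain K where K: "\<And>n. measure M {x \<in> space M. \<not> kk n x \<le> K n} \<le> (1/2) ^ n"
    by blast
  \<comment> \<open>Truncation makes the cocycle finitely valued; index 0 is the filler on a set of
    base measure at most (1/2)^n.\<close>
  define k' where "k' n x = (if kk n x \<le> K n then kk n x else 0)" for n x
  have k': "k' n \<in> measurable M (count_space UNIV)" for n
    unfolding k'_def[abs_def] by (rule measurable_compose[OF kk]) simp
  have k'_bdd: "k' n x \<le> K n" for n x by (simp add: k'_def)
  define S' where "S' n = (\<lambda>x. I_class (dperm_enum (k' n x)))" for n
  have S'_map: "S' n \<in> cocycle_maps M" for n unfolding S'_def by (rule I_class_cocycle[OF k'])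
  define Cn where "Cn n = ae_class M (cocycle_maps M) (S' n)" for n
  have Cn: "Cn n \<in> cocycles M" for n
    using S'_map by (auto simp: Cn_def cocycles_def ae_quotient_eq)
  have S'_Cn: "S' n \<in> Cn n" for n unfolding Cn_def by (rule ae_class_self[OF S'_map])
  define f where "f = repr N (skew_product M T C)"
  define g where "g n = repr N (skew_product M T (Cn n))" for n
  have f: "f \<in> inv_mp N" "fibre_map S f" unfolding f_def by (rule repr_skew_product[OF C S])+
  have g: "g n \<in> inv_mp N" "fibre_map (S' n) (g n)" for n
    unfolding g_def by (rule repr_skew_product[OF Cn S'_Cn])+
  have rate: "ereal (label_rate N (g n) (prod_label m)) \<le> KS_entropy M T" for n m
    using label_rate_dyadic_le[OF k' k'_bdd g(1)] g(2) unfolding S'_def by blast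
  have "(\<lambda>n. measure N (f ` A - g n ` A)) \<longlonglongrightarrow> 0" if "A \<in> sets N" for A
  proof (rule tendsto_image_Diff[OF f(1) g(1) _ that])
    fix B m j assume B: "B \<in> sets M"
    let ?R = "B \<times> cell m j"
    have R: "?R \<in> sets N" using B by auto
    \<comment> \<open>One summand (1/2)^n comes from the fibres where the chosen permutation is
      used, the other from the truncated base points, whose fibres may be lost entirely.\<close>
    have bound: "measure N (f ` ?R - g n ` ?R) \<le> 2 * (1/2) ^ n" if nm: "m \<le> n" for n
    proof -
      let ?Z = "{w \<in> ?R. f w \<notin> g n ` ?R}"
      let ?bad = "{x \<in> space M. \<not> kk n x \<le> K n}"
      note Z = image_Diff_eq_vimage[OF f(1) g(1)[of n] R]
      have bad: "?bad \<in> sets M"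
      proof -
        have "?bad = kk n -` {K n<..} \<inter> space M" by auto
        then show ?thesis using measurable_sets[OF kk, of "{K n<..}"] by simp
      qed
      have "emeasure N ?Z = (\<integral>\<^sup>+x. emeasure unit_interval (Pair x -` ?Z) \<partial>M)"
        by (rule unit_interval.emeasure_pair_measure_alt[OF Z(1)])
      also have "\<dots> \<le> (\<integral>\<^sup>+x. ennreal ((1/2) ^ n) + indicator ?bad x \<partial>M)"
      proof (rule nn_integral_mono_AE)
        show "AE x in M. emeasure unit_interval (Pair x -` ?Z) \<le> ennreal ((1/2) ^ n) +
            indicator ?bad x"
          using f(2)[unfolded fibre_map_def] g(2)[of n, unfolded fibre_map_def] AE_space
        proof eventually_elim
          fix x assume fx: "AE u in unit_interval. f (x, u) = (T x, repr unit_interval (S x) u)"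
            and gx: "AE u in unit_interval. g n (x, u) = (T x, repr unit_interval (S' n x) u)"
            and x: "x \<in> space M"
          have Zx: "Pair x -` ?Z \<in> sets unit_interval" by (rule sets_Pair1[OF Z(1)])
          show "emeasure unit_interval (Pair x -` ?Z) \<le> ennreal ((1/2) ^ n) + indicator ?bad x"
          proof (cases "x \<in> ?bad")
            case True
            have "emeasure unit_interval (Pair x -` ?Z) \<le> 1" by (rule unit_interval.emeasure_le_1)
            also have "\<dots> \<le> ennreal ((1/2) ^ n) + indicator ?bad x" using True by simp
            finally show ?thesis .
          next
            case False
            then have k'x: "k' n x = approx_index (s x) n" using x by (simp add: k'_def kk_def)
            show ?thesis
            proof (cases "x \<in> B")
              case True
              have "AE u in unit_interval. g n (x, u) = (T x, dperm_enum (approx_index (s x) n) u)"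
                using gx repr_I_class_AE[OF dperm_enum_inv_mp, of "k' n x"]
                by eventually_elim (simp add: S'_def k'x)
              then have "emeasure unit_interval (Pair x -` ?Z) \<le> ennreal ((1/2) ^ n)"
                using fx by (intro fibre_error[OF s nm True _ _ Zx]) (simp_all add: s_def)
              also have "\<dots> \<le> ennreal ((1/2) ^ n) + indicator ?bad x" by simp
              finally show ?thesis .
            next
              case False
              then have empty: "Pair x -` ?Z = {}" by auto
              show ?thesis unfolding empty by simp
            qed
          qed
        qed
      qed
      also have "\<dots> = ennreal ((1/2) ^ n) + emeasure M ?bad"
        using bad by (subst nn_integral_add) (auto simp: M.emeasure_space_1)
      also have "\<dots> \<le> ennreal ((1/2) ^ n) + ennreal ((1/2) ^ n)"
        using K[of n] by (intro add_left_mono) (simp add: M.emeasure_eq_measure ennreal_leI)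
      also have "\<dots> = ennreal (2 * (1/2) ^ n)" by (simp flip: ennreal_plus)
      finally have "measure N ?Z \<le> 2 * (1/2) ^ n"
        by (simp add: P.emeasure_eq_measure)
      then show ?thesis using Z(2) by simp
    qed
    show "(\<lambda>n. measure N (f ` ?R - g n ` ?R)) \<longlonglongrightarrow> 0"
    proof (rule Lim_null_comparison)
      show "\<forall>\<^sub>F n in sequentially. norm (measure N (f ` ?R - g n ` ?R)) \<le> 2 * (1/2) ^ n"
        using eventually_ge_at_top[of m] by eventually_elim (use bound in simp)
      show "(\<lambda>n. 2 * (1/2) ^ n :: real) \<longlonglongrightarrow> 0"
        using tendsto_mult_right_zero[OF LIMSEQ_power_zero[of "1/2 :: real"], of 2] by simp
    qed
  qed
  then have diff: "(\<lambda>n. measure N (sym_diff (g n ` A) (f ` A))) \<longlonglongrightarrow> 0" if A: "A \<in> sets N" for A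
  proof -
    have "measure N (sym_diff (g n ` A) (f ` A)) \<le> 2 * measure N (f ` A - g n ` A)" for n
    proof -
      note gA = inv_mp_image[OF g(1)[of n] A] and fA = inv_mp_image[OF f(1) A]
      have "measure N (sym_diff (g n ` A) (f ` A)) \<le> measure N (g n ` A - f ` A) +
          measure N (f ` A - g n ` A)"
        using gA fA by (intro measure_Un_le) auto
      also have "measure N (g n ` A - f ` A) = measure N (f ` A - g n ` A)"
        using gA fA by (intro measure_Diff_commute P.finite_measure_axioms) auto
      finally show ?thesis by simp
    qed
    moreover have "(\<lambda>n. 2 * measure N (f ` A - g n ` A)) \<longlonglongrightarrow> 0"
      using tendsto_mult_right_zero[of "\<lambda>n. measure N (f ` A - g n ` A)" sequentially 2]
        \<open>\<And>A. A \<in> sets N \<Longrightarrow> (\<lambda>n. measure N (f ` A - g n ` A)) \<longlonglongrightarrow> 0\<close>[OF A] by simp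
    ultimately show ?thesis by (rule tendsto_0_le_measure)
  qed
  have "limitin (Aut_top N) (\<lambda>n. skew_product M T (Cn n)) (skew_product M T C) sequentially"
    by (rule limitin_Aut_topI[OF P.finite_measure_axioms skew_product_Aut[OF C]
        repr_in[OF skew_product_Aut[OF C]]
          skew_product_Aut[OF Cn] repr_in[OF skew_product_Aut[OF Cn]] diff[unfolded f_def g_def]])
  then have "limitin (cocycle_top M T) Cn C sequentially"
    using C Cn unfolding limitin_def topspace_cocycle_top
    by (auto simp: cocycle_top_def openin_pullback_topology elim!: eventually_mono)
  with Cn rate show ?thesis unfolding g_def by blast
qed

lemma Aut_entropy_skew_product:
  "C \<in> cocycles M \<Longrightarrow> Aut_entropy N (skew_product M T C) = KS_entropy N (repr N (skew_product M T C))"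
  using skew_product_Aut by (simp add: Aut_entropy_def repr_def)

lemma nowhere_dense_label_rate_ge:
  assumes h: "KS_entropy M T = ereal h" and e: "0 < e"
  shows "nowhere_dense_in (cocycle_top M T)
    {C \<in> cocycles M. h + e \<le> label_rate N (repr N (skew_product M T C)) (prod_label m)}" (is
        "nowhere_dense_in _ ?W")
proof -
  let ?r = "\<lambda>C. label_rate N (repr N (skew_product M T C)) (prod_label m)"
  have "openin (cocycle_top M T) {C \<in> cocycles M. ?r C < h + e}"
    unfolding cocycle_top_def openin_pullback_topology
    using openin_label_rate_less[OF N_prob simple_prod_label, of m "h + e"] skew_product_Aut
    by (intro exI[of _ "{q \<in> Aut N. label_rate N (repr N q) (prod_label m) < h + e}"]) auto
  moreover have "topspace (cocycle_top M T) - ?W = {C \<in> cocycles M. ?r C < h + e}"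
    by (auto simp: topspace_cocycle_top)
  ultimately have "closedin (cocycle_top M T) ?W"
    by (auto simp: closedin_def topspace_cocycle_top)
  then have cl: "cocycle_top M T closure_of ?W = ?W" by (rule closure_of_closedin)
  have no_open: "U = {}" if U: "openin (cocycle_top M T) U" "U \<subseteq> ?W" for U
  proof (rule ccontr)
    assume "U \<noteq> {}"
    then obtain C where C: "C \<in> U" by auto
    then have "C \<in> cocycles M" using U(2) by auto
    from dyadic_cocycles_approximate[OF this] obtain Cn where
      lim: "limitin (cocycle_top M T) Cn C sequentially" and rate: "\<And>n. ereal (?r (Cn n)) \<le>
          KS_entropy M T"
      by blast
    have "\<forall>\<^sub>F n in sequentially. Cn n \<in> U" using lim U(1) C unfolding limitin_def by blast
    then obtain n where "Cn n \<in> U" using eventually_happens'[OF sequentially_bot] by blast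
    then have "h + e \<le> ?r (Cn n)" using U(2) by auto
    with rate[of n] e h show False by simp
  qed
  have "cocycle_top M T interior_of ?W = {}"
    by (rule no_open[OF openin_interior_of interior_of_subset])
  then show ?thesis
    unfolding nowhere_dense_in_def cl by (auto simp: topspace_cocycle_top)
qed

theorem generic_extension_entropy:
  "comeager_in (cocycle_top M T) {C \<in> cocycles M. Aut_entropy N (skew_product M T C) =
      KS_entropy M T}"
    (is "comeager_in ?X ?E")
proof -
  let ?r = "\<lambda>C. repr N (skew_product M T C)"
  have lower: "KS_entropy M T \<le> KS_entropy N (?r C)" if C: "C \<in> cocycles M" for C
  proof -
    obtain S where "S \<in> C" using cocycles_ex[OF C] by blast
    from repr_skew_product[OF C this] show ?thesis by (rule KS_entropy_base_le)
  qed
  have "meager_in ?X (topspace ?X - ?E)"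
  proof (cases "KS_entropy M T = \<infinity>")
    \<comment> \<open>The factor inequality forces infinite entropy on every extension, so no
      cocycle is exceptional.\<close>
    case True
    then have "topspace ?X - ?E = {}"
      using lower by (auto simp: topspace_cocycle_top Aut_entropy_skew_product)
    then show ?thesis
      unfolding meager_in_def by (intro exI[of _ "\<lambda>_. {}"]) (auto simp: nowhere_dense_in_def)
  next
    case False
    \<comment> \<open>The real rate of a constant label excludes the value minus infinity, so the
      entropy is a real number.\<close>
    have "ereal (label_rate M T (\<lambda>_. ())) \<le> KS_entropy M T"
      by (rule label_rate_le_KS_entropy[OF M.prob_space_axioms T]) simp
    with False obtain h where h: "KS_entropy M T = ereal h"
      by (cases "KS_entropy M T") auto
    define W where "W m j = {C \<in> cocycles M. h + 1 / real (Suc j) \<le> label_rate N (?r C)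
        (prod_label m)}" for m j
    \<comment> \<open>By the lower bound a cocycle is exceptional only through an entropy above h,
      and since the labels generate, some label then has rate at least h + 1/(j + 1) for some j. The
      pairs (m, j) are enumerated by \<open>prod_decode\<close>.\<close>
    have "topspace ?X - ?E = (\<Union>n. W (fst (prod_decode n)) (snd (prod_decode n)))"
    proof (intro equalityI subsetI)
      fix C assume "C \<in> topspace ?X - ?E"
      then have C: "C \<in> cocycles M" and ne: "KS_entropy N (?r C) \<noteq> KS_entropy M T"
        by (auto simp: topspace_cocycle_top Aut_entropy_skew_product)
      have "\<exists>m j. C \<in> W m j"
      proof (rule ccontr)
        assume "\<nexists>m j. C \<in> W m j"
        then have lt: "label_rate N (?r C) (prod_label m) < h + 1 / real (Suc j)" for m j
          using C unfolding W_def by (auto simp: not_le)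
        have "label_rate N (?r C) (prod_label m) \<le> h" for m
        proof (rule field_le_epsilon)
          fix e :: real assume "0 < e"
          then obtain j where "1 / real (Suc j) < e" using nat_approx_posE by blast
          with lt[of m j] show "label_rate N (?r C) (prod_label m) \<le> h + e" by simp
        qed
        then have "KS_entropy N (?r C) \<le> ereal h"
          by (rule refining_labels.KS_entropy_le_of_refining[OF refining_prod_label repr_inv_mp])
        with lower[OF C] ne h show False by simp
      qed
      then obtain m j where "C \<in> W m j" by blast
      then show "C \<in> (\<Union>n. W (fst (prod_decode n)) (snd (prod_decode n)))"
        by (intro UN_I[of "prod_encode (m, j)"]) auto
    next
      fix C assume "C \<in> (\<Union>n. W (fst (prod_decode n)) (snd (prod_decode n)))"
      then obtain m j where "C \<in> W m j" by blast
      then have C: "C \<in> cocycles M" and ge: "h + 1 / real (Suc j) \<le> label_rate N (?r C)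
          (prod_label m)"
        by (auto simp: W_def)
      have "h < h + 1 / real (Suc j)" by simp
      with ge have "h < label_rate N (?r C) (prod_label m)" by linarith
      then have "ereal h < ereal (label_rate N (?r C) (prod_label m))" by simp
      also have "\<dots> \<le> KS_entropy N (?r C)"
        by (rule label_rate_le_KS_entropy[OF N_prob repr_inv_mp simple_prod_label])
      finally show "C \<in> topspace ?X - ?E"
        using C h by (auto simp: topspace_cocycle_top Aut_entropy_skew_product)
    qed
    moreover have "nowhere_dense_in ?X (W m j)" for m j
      unfolding W_def by (rule nowhere_dense_label_rate_ge[OF h]) simp
    ultimately show ?thesis
      unfolding meager_in_def by (intro exI[of _ "\<lambda>n. W (fst (prod_decode n))
          (snd (prod_decode n))"]) auto
  qed
  then show ?thesis
    unfolding comeager_in_def by (auto simp: topspace_cocycle_top)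
qed

end

theorem theorem4p1:
  fixes M :: "'a measure" and T :: "'a \<Rightarrow> 'a"
  assumes "prob_space M" and "standard_borel M" and "nonatomic M"
    and "T \<in> inv_mp M" and "ergodic M T"
  shows "comeager_in (cocycle_top M T)
    {C \<in> cocycles M. Aut_entropy (M \<Otimes>\<^sub>M unit_interval) (skew_product M T C) = KS_entropy M T}"
proof -
  obtain \<B> where B: "point_separating M \<B>" "sets M = sigma_sets (space M) \<B>"
    using standard_borel_generator[OF assms(2)] by blast
  have "skew_base M T \<B>"
    unfolding skew_base_def skew_base_axioms_def using assms(1,4) B by blast
  then show ?thesis by (rule skew_base.generic_extension_entropy)
qed

end
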